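(* Let $\mathcal{Q}$ be a small quantaloid. There is an essentially bijective correspondence between saturated classes $\mathcal{C}$ of presheaves on $\mathcal{Q}$-categories and full sub-KZ-doctrines $(\mathcal{T},\varepsilon)$ of the free cocompletion KZ-doctrine $\mathcal{P}:\mathrm{Cat}(\mathcal{Q})\to\mathrm{Cat}(\mathcal{Q})$, determined as follows. (a) To a saturated class $\mathcal{C}$ corresponds the full sub-KZ-doctrine $(\mathcal{C},J)$, where $\mathcal{C}(\mathbb{A})$ is the full subcategory of $\mathcal{P}(\mathbb{A})$ on those presheaves on $\mathbb{A}$ that belong to $\mathcal{C}$, where $J_{\mathbb{A}}:\mathcal{C}(\mathbb{A})\to\mathcal{P}(\mathbb{A})$ is the inclusion, and where $\mathcal{C}(F):\mathcal{C}(\mathbb{A})\to\mathcal{C}(\mathbb{B}):\phi\mapsto\mathbb{B}(-,F-)\otimes\phi$ for a functor $F:\mathbb{A}\to\mathbb{B}$. (b) To a full sub-KZ-doctrine $(\mathcal{T},\varepsilon)$ corresponds the saturated class $\mathcal{C}_{\mathcal{T}}=\{\varepsilon_{\mathbb{A}}(t)\mid \mathbb{A}\in\mathrm{Cat}(\mathcal{Q}),\ t\in\mathcal{T}(\mathbb{A})\}$. (c) Starting from a saturated class $\mathcal{C}$, applying (a) and then (b) gives back $\mathcal{C}$. Starting from $(\mathcal{T},\varepsilon)$, applying (b) and then (a) gives a full sub-KZ-doctrine $(\widetilde{\mathcal{T}},\widetilde{\varepsilon})$ which is equivalent to $(\mathcal{T},\varepsilon)$: there is a 2-natural transformation $\delta:\mathcal{T}\Rightarrow\widetilde{\mathcal{T}}$,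 all of whose components are equivalences of $\mathcal{Q}$-categories, such that $\widetilde{\varepsilon}\circ\delta=\varepsilon$. (d) A saturated class $\mathcal{C}$ and a full sub-KZ-doctrine $(\mathcal{T},\varepsilon)$ correspond with each other if and only if the $\mathcal{T}$-algebras and their homomorphisms are precisely the $\mathcal{C}$-cocomplete $\mathcal{Q}$-categories and the $\mathcal{C}$-cocontinuous functors between them. (e) In this case there is a normal lax $\mathrm{Sup}$-functor $\mathcal{T}':\mathrm{Dist}(\mathcal{Q})\to\mathrm{Dist}(\mathcal{Q})$, given on objects by $\mathbb{A}\mapsto\mathcal{T}(\mathbb{A})$ and sending a distributor $\Phi:\mathbb{A}\to\mathbb{B}$ to the distributor $\mathcal{T}'(\Phi):\mathcal{T}(\mathbb{A})\to\mathcal{T}(\mathbb{B})$ with elements $$\mathcal{T}'(\Phi)(t,s)=\mathcal{P}(\mathbb{B})(\varepsilon_{\mathbb{B}}(t),\Phi\otimes\varepsilon_{\mathbb{A}}(s)),\qquad s\in\mathcal{T}(\mathbb{A}),\ t\in\mathcal{T}(\mathbb{B}),$$ and satisfying $\mathcal{T}'\circ i=i\circ\mathcal{T}$, where $i:\mathrm{Cat}(\mathcal{Q})\to\mathrm{Dist}(\mathcal{Q})$ is the identity on objects and sends a functor $F:\mathbb{A}\to\mathbb{B}$ to the distributor $\mathbb{B}(-,F-)$.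
   Context: A quantaloid is a category whose hom-sets are complete lattices and whose composition preserves arbitrary suprema in each variable. $\mathcal{Q}$ is a small quantaloid, with set of objects $\mathcal{Q}_0$. A $\mathcal{Q}$-category $\mathbb{A}$ is a set $\mathbb{A}_0$ with a type function $t:\mathbb{A}_0\to\mathcal{Q}_0$ and $\mathcal{Q}$-arrows $\mathbb{A}(a',a):ta\to ta'$ with $1_{ta}\le\mathbb{A}(a,a)$ and $\mathbb{A}(a'',a')\circ\mathbb{A}(a',a)\le\mathbb{A}(a'',a)$. A functor $F:\mathbb{A}\to\mathbb{B}$ is a type-preserving map with $\mathbb{A}(a',a)\le\mathbb{B}(Fa',Fa)$; it is fully faithful if equality always holds. A distributor $\Phi$ from $\mathbb{A}$ to $\mathbb{B}$ is a matrix of arrows $\Phi(b,a):ta\to tb$ with $\Phi(b,a')\circ\mathbb{A}(a',a)\le\Phi(b,a)$ and $\mathbb{B}(b,b')\circ\Phi(b',a)\le\Phi(b,a)$. Composition is $(\Psi\otimes\Phi)(c,a)=\bigvee_b\Psi(c,b)\circ\Phi(b,a)$, the identity on $\mathbb{A}$ is the hom-matrix of $\mathbb{A}$, and distributors are ordered elementwise; this gives a (large) quantaloid $\mathrm{Dist}(\mathcal{Q})$. For $\Phi:\mathbb{A}\to\mathbb{C}$ and $\Psi:\mathbb{B}\to\mathbb{C}$ in $\mathrm{Dist}(\mathcal{Q})$, the lifting $[\Psi,\Phi]:\mathbb{A}\to\mathbb{B}$ is the largest distributor with $\Psi\otimes[\Psi,\Phi]\le\Phi$. A functor $F:\mathbb{A}\to\mathbb{B}$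 gives a distributor $\mathbb{B}(-,F-):\mathbb{A}\to\mathbb{B}$ with right adjoint $\mathbb{B}(F-,-)$. Parallel functors are preordered by $F\le G$ iff $\mathbb{B}(-,F-)\le\mathbb{B}(-,G-)$, and $F\cong G$ means $F\le G\le F$; this makes $\mathrm{Cat}(\mathcal{Q})$ a locally (pre)ordered 2-category. Since local orders are only preorders, equations between functors (naturality, factorisations, monad and algebra laws) are understood up to $\cong$. Equivalences and adjunctions of $\mathcal{Q}$-categories are meant in this 2-category. $*_X$ is the one-object $\mathcal{Q}$-category with object $*$ of type $X$ and hom-arrow $1_X$. A presheaf on $\mathbb{A}$ is a distributor $\phi:*_X\to\mathbb{A}$, $X\in\mathcal{Q}_0$. Presheaves on $\mathbb{A}$ are the objects of the $\mathcal{Q}$-category $\mathcal{P}(\mathbb{A})$, with $t\phi=X$ and $\mathcal{P}(\mathbb{A})(\psi,\phi)=$ the single element of $[\psi,\phi]$. The Yoneda embedding is $Y_{\mathbb{A}}:\mathbb{A}\to\mathcal{P}(\mathbb{A}):a\mapsto\mathbb{A}(-,a)$ (the representable presheaves). $\mathcal{P}$ is a 2-functor on $\mathrm{Cat}(\mathcal{Q})$ via $\mathcal{P}(F)(\phi)=\mathbb{B}(-,F-)\otimes\phi$. The colimit of $F:\mathbb{A}\to\mathbb{B}$ weighted by a presheaf $\phi:*_X\to\mathbb{A}$ is an object $\mathrm{colim}(\phi,F)$ of $\mathbb{B}$ of type $X$ with $\mathbb{B}(\mathrm{colim}(\phi,F),-)=[\phi,\mathbb{B}(F-,-)]$. $G:\mathbb{B}\to\mathbb{B}'$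 preserves it if $G(\mathrm{colim}(\phi,F))$ is the $\phi$-weighted colimit of $G\circ F$. In $\mathcal{P}(\mathbb{B})$ all weighted colimits exist: for $G:\mathbb{A}\to\mathcal{P}(\mathbb{B})$, $\mathrm{colim}(\phi,G)(b)=\bigvee_{a}G(a)(b)\circ\phi(a)$. $\mathcal{P}$ is a 2-monad with unit $Y$ and multiplication $M_{\mathbb{A}}:\mathcal{P}(\mathcal{P}(\mathbb{A}))\to\mathcal{P}(\mathbb{A}):\Theta\mapsto\mathrm{colim}(\Theta,1_{\mathcal{P}(\mathbb{A})})$. For a class $\mathcal{C}$ of presheaves, a $\mathcal{Q}$-category is $\mathcal{C}$-cocomplete if it has all colimits weighted by elements of $\mathcal{C}$; a functor is $\mathcal{C}$-cocontinuous if it preserves all colimits weighted by elements of $\mathcal{C}$. $\mathcal{C}$ is saturated if (1) it contains all representable presheaves and (2) for each $\phi:*_X\to\mathbb{A}$ in $\mathcal{C}$ and each functor $G:\mathbb{A}\to\mathcal{P}(\mathbb{B})$ with every $G(a)$ in $\mathcal{C}$, $\mathrm{colim}(\phi,G)$ is in $\mathcal{C}$. A KZ-doctrine on a locally ordered 2-category $\mathcal{K}$ is a 2-monad $(\mathcal{T},\mu,\eta)$ on $\mathcal{K}$ with $\mathcal{T}(\eta_K)\le\eta_{\mathcal{T}(K)}$ for all objects $K$. $\mathcal{P}$ is a KZ-doctrine. A full sub-KZ-doctrine of $\mathcal{P}$ is a pair $(\mathcal{T},\varepsilon)$ of a 2-functor $\mathcal{T}$ on $\mathrm{Cat}(\mathcal{Q})$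 and a 2-natural transformation $\varepsilon:\mathcal{T}\Rightarrow\mathcal{P}$ with all components fully faithful, such that there are (essentially unique) factorisations $M\circ(\varepsilon*\varepsilon)=\varepsilon\circ\mu$ and $Y=\varepsilon\circ\eta$, with $\mu:\mathcal{T}\circ\mathcal{T}\Rightarrow\mathcal{T}$ and $\eta:1\Rightarrow\mathcal{T}$; then $(\mathcal{T},\mu,\eta)$ is a KZ-doctrine. A $\mathcal{T}$-algebra is a $\mathcal{Q}$-category $\mathbb{B}$ with a functor $L:\mathcal{T}(\mathbb{B})\to\mathbb{B}$ satisfying $L\circ\eta_{\mathbb{B}}\cong1$ and $L\circ\mu_{\mathbb{B}}\cong L\circ\mathcal{T}(L)$; for a KZ-doctrine such $L$ is left adjoint to $\eta_{\mathbb{B}}$, so it is essentially unique and being an algebra is a property. A homomorphism $G:(\mathbb{B},L)\to(\mathbb{B}',L')$ is a functor with $G\circ L\cong L'\circ\mathcal{T}(G)$. A $\mathrm{Sup}$-functor (homomorphism of quantaloids) is a functor that preserves suprema of parallel arrows. A lax functor $\mathcal{T}'$ between quantaloids is order-preserving on homs with $\mathcal{T}'(\Psi)\otimes\mathcal{T}'(\Phi)\le\mathcal{T}'(\Psi\otimes\Phi)$ and $1_{\mathcal{T}'(\mathbb{A})}\le\mathcal{T}'(1_{\mathbb{A}})$. It is normal if it preserves identities strictly, and a lax $\mathrm{Sup}$-functor if it preserves suprema of parallel arrows.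
   Formalization: In (e), "lax Sup-functor" is read as sup T'(Φ_i) ≤ T'(sup Φ_i) instead of strict preservation of suprema, which fails already for T = P over the two-element quantale (T'(Φ)({1,2},⊤) says {1,2} ⊆ Φ: true for {1}∨{2}, false for each). *)

theory Defs
  imports "HOL-Algebra.Complete_Lattice"
begin

section \<open>A universe of sets\<close>

text \<open>
  All object sets must live in one type that is closed under forming sets of
  presheaves, since otherwise \<open>\<P>\<close> is not an endofunctor. So "set" means: element of a fixed model of
  (second-order) set theory, where \<open>elts x\<close> is the collection of members of \<open>x\<close>. Infinity and
  foundation are not required. HOL sets over the type then play the role of classes.
\<close>

class zf_universe =
  fixes elts :: "'a \<Rightarrow> 'a set"
  assumes extensionality: "elts x = elts y \<Longrightarrow> x = y"
    and pairing: "\<exists>z. elts z = {x, y}"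
    and union: "\<exists>z. elts z = \<Union> (elts ` elts x)"
    and powerset: "\<exists>z. elts z = {y. elts y \<subseteq> elts x}"
    and separation: "\<exists>z. elts z = {y \<in> elts x. P y}"
    and replacement: "\<exists>z. elts z = f ` elts x"

definition small :: "'u::zf_universe set \<Rightarrow> bool" where
  "small S \<longleftrightarrow> (\<exists>x. elts x = S)"

definition vset :: "'u::zf_universe set \<Rightarrow> 'u" where
  "vset S = (THE x. elts x = S)"

definition vpair :: "'u::zf_universe \<Rightarrow> 'u \<Rightarrow> 'u" where
  "vpair x y = vset {vset {x}, vset {x, y}}"


section \<open>Quantaloids\<close>

record ('o, 'm) quantaloid_data =
  Ob :: "'o set"
  Hom :: "'o \<Rightarrow> 'o \<Rightarrow> 'm gorder"
  Comp :: "'m \<Rightarrow> 'm \<Rightarrow> 'm"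
  Ident :: "'o \<Rightarrow> 'm"

text \<open>\<open>Comp Q g f\<close> is \<open>g \<circ> f\<close>; an arrow determines its domain and codomain. The constant
  \<^const>\<open>sup_pres\<close> covers all suprema, including the empty one.\<close>

locale quantaloid =
  fixes Q :: "('o, 'm) quantaloid_data"
  assumes hom_complete: "\<lbrakk>X \<in> Ob Q; Y \<in> Ob Q\<rbrakk> \<Longrightarrow> complete_lattice (Hom Q X Y)"
    and hom_disjoint: "\<lbrakk>X \<in> Ob Q; Y \<in> Ob Q; X' \<in> Ob Q; Y' \<in> Ob Q;
          f \<in> carrier (Hom Q X Y); f \<in> carrier (Hom Q X' Y')\<rbrakk> \<Longrightarrow> X = X' \<and> Y = Y'"
    and ident_closed: "X \<in> Ob Q \<Longrightarrow> Ident Q X \<in> carrier (Hom Q X X)"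
    and comp_closed: "\<lbrakk>X \<in> Ob Q; Y \<in> Ob Q; Z \<in> Ob Q;
          f \<in> carrier (Hom Q X Y); g \<in> carrier (Hom Q Y Z)\<rbrakk> \<Longrightarrow> Comp Q g f \<in> carrier (Hom Q X Z)"
    and ident_left: "\<lbrakk>X \<in> Ob Q; Y \<in> Ob Q; f \<in> carrier (Hom Q X Y)\<rbrakk> \<Longrightarrow> Comp Q (Ident Q Y) f = f"
    and ident_right: "\<lbrakk>X \<in> Ob Q; Y \<in> Ob Q; f \<in> carrier (Hom Q X Y)\<rbrakk> \<Longrightarrow> Comp Q f (Ident Q X) = f"
    and comp_assoc: "\<lbrakk>X \<in> Ob Q; Y \<in> Ob Q; Z \<in> Ob Q; W \<in> Ob Q; f \<in> carrier (Hom Q X Y);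
          g \<in> carrier (Hom Q Y Z); h \<in> carrier (Hom Q Z W)\<rbrakk>
          \<Longrightarrow> Comp Q (Comp Q h g) f = Comp Q h (Comp Q g f)"
    and comp_sup_right: "\<lbrakk>X \<in> Ob Q; Y \<in> Ob Q; Z \<in> Ob Q; g \<in> carrier (Hom Q Y Z)\<rbrakk>
          \<Longrightarrow> sup_pres (Hom Q X Y) (Hom Q X Z) (\<lambda>f. Comp Q g f)"
    and comp_sup_left: "\<lbrakk>X \<in> Ob Q; Y \<in> Ob Q; Z \<in> Ob Q; f \<in> carrier (Hom Q X Y)\<rbrakk>
          \<Longrightarrow> sup_pres (Hom Q Y Z) (Hom Q X Z) (\<lambda>g. Comp Q g f)"

locale small_quantaloid = quantaloid Q for Q :: "('u::zf_universe, 'u) quantaloid_data" +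
  assumes small_Ob: "small (Ob Q)"
    and small_Hom: "\<lbrakk>X \<in> Ob Q; Y \<in> Ob Q\<rbrakk> \<Longrightarrow> small (carrier (Hom Q X Y))"

definition lax_functor ::
  "('o, 'm) quantaloid_data \<Rightarrow> ('o', 'm') quantaloid_data \<Rightarrow> ('o \<Rightarrow> 'o') \<Rightarrow> ('m \<Rightarrow> 'm') \<Rightarrow> bool" where
  "lax_functor D E F0 F1 \<longleftrightarrow>
     (\<forall>A\<in>Ob D. F0 A \<in> Ob E) \<and>
     (\<forall>A\<in>Ob D. \<forall>B\<in>Ob D. \<forall>\<Phi>\<in>carrier (Hom D A B). F1 \<Phi> \<in> carrier (Hom E (F0 A) (F0 B))) \<and>
     (\<forall>A\<in>Ob D. \<forall>B\<in>Ob D. \<forall>\<Phi>\<in>carrier (Hom D A B). \<forall>\<Psi>\<in>carrier (Hom D A B).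
        \<Phi> \<sqsubseteq>\<^bsub>Hom D A B\<^esub> \<Psi> \<longrightarrow> F1 \<Phi> \<sqsubseteq>\<^bsub>Hom E (F0 A) (F0 B)\<^esub> F1 \<Psi>) \<and>
     (\<forall>A\<in>Ob D. \<forall>B\<in>Ob D. \<forall>C\<in>Ob D. \<forall>\<Phi>\<in>carrier (Hom D A B). \<forall>\<Psi>\<in>carrier (Hom D B C).
        Comp E (F1 \<Psi>) (F1 \<Phi>) \<sqsubseteq>\<^bsub>Hom E (F0 A) (F0 C)\<^esub> F1 (Comp D \<Psi> \<Phi>)) \<and>
     (\<forall>A\<in>Ob D. Ident E (F0 A) \<sqsubseteq>\<^bsub>Hom E (F0 A) (F0 A)\<^esub> F1 (Ident D A))"

definition normal_functor ::
  "('o, 'm) quantaloid_data \<Rightarrow> ('o', 'm') quantaloid_data \<Rightarrow> ('o \<Rightarrow> 'o') \<Rightarrow> ('m \<Rightarrow> 'm') \<Rightarrow> bool" where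
  "normal_functor D E F0 F1 \<longleftrightarrow> (\<forall>A\<in>Ob D. F1 (Ident D A) = Ident E (F0 A))"

text \<open>
  "Lax" applies to all the structure that a Sup-functor preserves: composition, identities and also
  suprema of parallel arrows. Strict preservation of suprema would be too much to ask of the extension
  \<open>doctrine_extension\<close> below: over the two-element quantale, with \<open>\<T> = \<P>\<close>,
  \<open>\<Phi>\<^sub>1 = {1}\<close> and \<open>\<Phi>\<^sub>2 = {2}\<close> as distributors from the one-object category to the discrete \<open>{1, 2}\<close>,
  and \<open>s\<close> the top presheaf, \<open>\<T>'(\<Phi>)({1, 2}, s)\<close> is the truth value of \<open>{1, 2} \<subseteq> \<Phi>\<close>,
  which is true for \<open>\<Phi>\<^sub>1 \<or> \<Phi>\<^sub>2\<close> but false for both \<open>\<Phi>\<^sub>1\<close> and \<open>\<Phi>\<^sub>2\<close>.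
\<close>

definition lax_Sup_functor ::
  "('o, 'm) quantaloid_data \<Rightarrow> ('o', 'm') quantaloid_data \<Rightarrow> ('o \<Rightarrow> 'o') \<Rightarrow> ('m \<Rightarrow> 'm') \<Rightarrow> bool" where
  "lax_Sup_functor D E F0 F1 \<longleftrightarrow> lax_functor D E F0 F1 \<and>
     (\<forall>A\<in>Ob D. \<forall>B\<in>Ob D. \<forall>S\<subseteq>carrier (Hom D A B).
        \<Squnion>\<^bsub>Hom E (F0 A) (F0 B)\<^esub> (F1 ` S) \<sqsubseteq>\<^bsub>Hom E (F0 A) (F0 B)\<^esub> F1 (\<Squnion>\<^bsub>Hom D A B\<^esub> S))"


section \<open>Enriched categories, distributors and functors\<close>

record 'u qcat =
  obj :: "'u set"
  ty :: "'u \<Rightarrow> 'u"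
  hom :: "'u \<Rightarrow> 'u \<Rightarrow> 'u"

text \<open>\<open>hom A a' a\<close> is an arrow from \<open>ty A a\<close> to \<open>ty A a'\<close>. Here and below the components are
  extensional functions, so that equality is equality on the carriers.\<close>

definition is_qcat :: "('u::zf_universe, 'u) quantaloid_data \<Rightarrow> 'u qcat \<Rightarrow> bool" where
  "is_qcat Q A \<longleftrightarrow> small (obj A) \<and> ty A \<in> obj A \<rightarrow>\<^sub>E Ob Q \<and>
     hom A \<in> (\<Pi>\<^sub>E a'\<in>obj A. \<Pi>\<^sub>E a\<in>obj A. carrier (Hom Q (ty A a) (ty A a'))) \<and>
     (\<forall>a\<in>obj A. Ident Q (ty A a) \<sqsubseteq>\<^bsub>Hom Q (ty A a) (ty A a)\<^esub> hom A a a) \<and>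
     (\<forall>a\<in>obj A. \<forall>a'\<in>obj A. \<forall>a''\<in>obj A.
        Comp Q (hom A a'' a') (hom A a' a) \<sqsubseteq>\<^bsub>Hom Q (ty A a) (ty A a'')\<^esub> hom A a'' a)"

record 'u dist =
  dsrc :: "'u qcat"
  dtgt :: "'u qcat"
  dmat :: "'u \<Rightarrow> 'u \<Rightarrow> 'u"

definition distributors :: "('u::zf_universe, 'u) quantaloid_data \<Rightarrow> 'u qcat \<Rightarrow> 'u qcat \<Rightarrow> 'u dist set" where
  "distributors Q A B = {\<Phi>. dsrc \<Phi> = A \<and> dtgt \<Phi> = B \<and>
     dmat \<Phi> \<in> (\<Pi>\<^sub>E b\<in>obj B. \<Pi>\<^sub>E a\<in>obj A. carrier (Hom Q (ty A a) (ty B b))) \<and>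
     (\<forall>b\<in>obj B. \<forall>a\<in>obj A. \<forall>a'\<in>obj A.
        Comp Q (dmat \<Phi> b a') (hom A a' a) \<sqsubseteq>\<^bsub>Hom Q (ty A a) (ty B b)\<^esub> dmat \<Phi> b a) \<and>
     (\<forall>b\<in>obj B. \<forall>b'\<in>obj B. \<forall>a\<in>obj A.
        Comp Q (hom B b b') (dmat \<Phi> b' a) \<sqsubseteq>\<^bsub>Hom Q (ty A a) (ty B b)\<^esub> dmat \<Phi> b a)}"

definition dcomp :: "('u::zf_universe, 'u) quantaloid_data \<Rightarrow> 'u dist \<Rightarrow> 'u dist \<Rightarrow> 'u dist" where
  "dcomp Q \<Psi> \<Phi> = \<lparr>dsrc = dsrc \<Phi>, dtgt = dtgt \<Psi>,
     dmat = (\<lambda>c\<in>obj (dtgt \<Psi>). \<lambda>a\<in>obj (dsrc \<Phi>).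
       \<Squnion>\<^bsub>Hom Q (ty (dsrc \<Phi>) a) (ty (dtgt \<Psi>) c)\<^esub>
         ((\<lambda>b. Comp Q (dmat \<Psi> c b) (dmat \<Phi> b a)) ` obj (dtgt \<Phi>)))\<rparr>"

definition Dist :: "('u::zf_universe, 'u) quantaloid_data \<Rightarrow> ('u qcat, 'u dist) quantaloid_data" where
  "Dist Q = \<lparr>Ob = {A. is_qcat Q A},
     Hom = (\<lambda>A B. \<lparr>carrier = distributors Q A B, eq = (=),
       le = (\<lambda>\<Phi> \<Psi>. \<forall>b\<in>obj B. \<forall>a\<in>obj A. dmat \<Phi> b a \<sqsubseteq>\<^bsub>Hom Q (ty A a) (ty B b)\<^esub> dmat \<Psi> b a)\<rparr>),
     Comp = dcomp Q,
     Ident = (\<lambda>A. \<lparr>dsrc = A, dtgt = A, dmat = hom A\<rparr>)\<rparr>"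

text \<open>The lifting \<open>[\<Psi>, \<Phi>] : \<A> \<rightarrow> \<B>\<close> of \<open>\<Phi> : \<A> \<rightarrow> \<C>\<close> through \<open>\<Psi> : \<B> \<rightarrow> \<C>\<close>.\<close>

definition lift :: "('u::zf_universe, 'u) quantaloid_data \<Rightarrow> 'u dist \<Rightarrow> 'u dist \<Rightarrow> 'u dist" where
  "lift Q \<Psi> \<Phi> = (THE \<Xi>. greatest (Hom (Dist Q) (dsrc \<Phi>) (dsrc \<Psi>)) \<Xi>
     {\<Xi> \<in> distributors Q (dsrc \<Phi>) (dsrc \<Psi>).
        dcomp Q \<Psi> \<Xi> \<sqsubseteq>\<^bsub>Hom (Dist Q) (dsrc \<Phi>) (dtgt \<Phi>)\<^esub> \<Phi>})"

record 'u qfun =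
  fsrc :: "'u qcat"
  ftgt :: "'u qcat"
  fmap :: "'u \<Rightarrow> 'u"

definition functors :: "('u::zf_universe, 'u) quantaloid_data \<Rightarrow> 'u qcat \<Rightarrow> 'u qcat \<Rightarrow> 'u qfun set" where
  "functors Q A B = {F. fsrc F = A \<and> ftgt F = B \<and> fmap F \<in> obj A \<rightarrow>\<^sub>E obj B \<and>
     (\<forall>a\<in>obj A. ty B (fmap F a) = ty A a) \<and>
     (\<forall>a\<in>obj A. \<forall>a'\<in>obj A.
        hom A a' a \<sqsubseteq>\<^bsub>Hom Q (ty A a) (ty A a')\<^esub> hom B (fmap F a') (fmap F a))}"

definition fully_faithful :: "'u qfun \<Rightarrow> bool" where
  "fully_faithful F \<longleftrightarrow> (\<forall>a\<in>obj (fsrc F). \<forall>a'\<in>obj (fsrc F).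
     hom (fsrc F) a' a = hom (ftgt F) (fmap F a') (fmap F a))"

definition fid :: "'u qcat \<Rightarrow> 'u qfun" where
  "fid A = \<lparr>fsrc = A, ftgt = A, fmap = (\<lambda>a\<in>obj A. a)\<rparr>"

definition fcomp :: "'u qfun \<Rightarrow> 'u qfun \<Rightarrow> 'u qfun"  (infixr \<open>\<circ>\<^sub>f\<close> 70) where
  "G \<circ>\<^sub>f F = \<lparr>fsrc = fsrc F, ftgt = ftgt G, fmap = (\<lambda>a\<in>obj (fsrc F). fmap G (fmap F a))\<rparr>"

text \<open>The distributors \<open>\<B>(-,F-) : \<A> \<rightarrow> \<B>\<close> and \<open>\<B>(F-,-) : \<B> \<rightarrow> \<A>\<close>.\<close>

definition graph :: "'u qfun \<Rightarrow> 'u dist" where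
  "graph F = \<lparr>dsrc = fsrc F, dtgt = ftgt F,
     dmat = (\<lambda>b\<in>obj (ftgt F). \<lambda>a\<in>obj (fsrc F). hom (ftgt F) b (fmap F a))\<rparr>"

definition cograph :: "'u qfun \<Rightarrow> 'u dist" where
  "cograph F = \<lparr>dsrc = ftgt F, dtgt = fsrc F,
     dmat = (\<lambda>a\<in>obj (fsrc F). \<lambda>b\<in>obj (ftgt F). hom (ftgt F) (fmap F a) b)\<rparr>"

definition fle :: "('u::zf_universe, 'u) quantaloid_data \<Rightarrow> 'u qfun \<Rightarrow> 'u qfun \<Rightarrow> bool" where
  "fle Q F G \<longleftrightarrow> fsrc F = fsrc G \<and> ftgt F = ftgt G \<and>
     graph F \<sqsubseteq>\<^bsub>Hom (Dist Q) (fsrc F) (ftgt F)\<^esub> graph G"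

definition fiso :: "('u::zf_universe, 'u) quantaloid_data \<Rightarrow> 'u qfun \<Rightarrow> 'u qfun \<Rightarrow> bool" where
  "fiso Q F G \<longleftrightarrow> fle Q F G \<and> fle Q G F"

definition is_equivalence :: "('u::zf_universe, 'u) quantaloid_data \<Rightarrow> 'u qfun \<Rightarrow> bool" where
  "is_equivalence Q F \<longleftrightarrow> F \<in> functors Q (fsrc F) (ftgt F) \<and>
     (\<exists>G\<in>functors Q (ftgt F) (fsrc F).
        fiso Q (G \<circ>\<^sub>f F) (fid (fsrc F)) \<and> fiso Q (F \<circ>\<^sub>f G) (fid (ftgt F)))"


section \<open>Presheaves\<close>

definition pt :: "'u::zf_universe" where
  "pt = vset {}"

definition star :: "('u::zf_universe, 'u) quantaloid_data \<Rightarrow> 'u \<Rightarrow> 'u qcat" where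
  "star Q X = \<lparr>obj = {pt}, ty = (\<lambda>x\<in>{pt}. X), hom = (\<lambda>x\<in>{pt}. \<lambda>y\<in>{pt}. Ident Q X)\<rparr>"

definition presheaves_on :: "('u::zf_universe, 'u) quantaloid_data \<Rightarrow> 'u qcat \<Rightarrow> 'u dist set" where
  "presheaves_on Q A = (\<Union>X\<in>Ob Q. distributors Q (star Q X) A)"

definition presheaves :: "('u::zf_universe, 'u) quantaloid_data \<Rightarrow> 'u dist set" where
  "presheaves Q = (\<Union>A\<in>Ob (Dist Q). presheaves_on Q A)"

definition ptype :: "'u::zf_universe dist \<Rightarrow> 'u" where
  "ptype \<phi> = ty (dsrc \<phi>) pt"

definition representable :: "('u::zf_universe, 'u) quantaloid_data \<Rightarrow> 'u qcat \<Rightarrow> 'u \<Rightarrow> 'u dist" where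
  "representable Q A a = \<lparr>dsrc = star Q (ty A a), dtgt = A,
     dmat = (\<lambda>a'\<in>obj A. \<lambda>x\<in>{pt}. hom A a' a)\<rparr>"

text \<open>The objects of \<open>\<P>(\<A>)\<close> must be elements of the universe: a presheaf \<open>\<phi>\<close> on \<open>\<A>\<close> is stored as
  the set-theoretic pair of its type and the graph of \<open>a \<mapsto> \<phi>(a)\<close>. On the presheaves on a fixed \<open>\<A>\<close>
  this is injective, with inverse \<open>decode Q A\<close>.\<close>

definition code :: "'u::zf_universe dist \<Rightarrow> 'u" where
  "code \<phi> = vpair (ptype \<phi>) (vset ((\<lambda>a. vpair a (dmat \<phi> a pt)) ` obj (dtgt \<phi>)))"

definition decode :: "('u::zf_universe, 'u) quantaloid_data \<Rightarrow> 'u qcat \<Rightarrow> 'u \<Rightarrow> 'u dist" where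
  "decode Q A = inv_into (presheaves_on Q A) code"

text \<open>The full subcategory of \<open>\<P>(\<A>)\<close> on the presheaves in a class \<open>C\<close>.\<close>

definition presheaf_cat ::
  "('u::zf_universe, 'u) quantaloid_data \<Rightarrow> 'u dist set \<Rightarrow> 'u qcat \<Rightarrow> 'u qcat" where
  "presheaf_cat Q C A =
     (let S = code ` {\<phi> \<in> presheaves_on Q A. \<phi> \<in> C} in
      \<lparr>obj = S,
       ty = (\<lambda>x\<in>S. ptype (decode Q A x)),
       hom = (\<lambda>y\<in>S. \<lambda>x\<in>S. dmat (lift Q (decode Q A y) (decode Q A x)) pt pt)\<rparr>)"

definition P0 :: "('u::zf_universe, 'u) quantaloid_data \<Rightarrow> 'u qcat \<Rightarrow> 'u qcat" where
  "P0 Q A = presheaf_cat Q (presheaves Q) A"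

definition yoneda :: "('u::zf_universe, 'u) quantaloid_data \<Rightarrow> 'u qcat \<Rightarrow> 'u qfun" where
  "yoneda Q A = \<lparr>fsrc = A, ftgt = P0 Q A, fmap = (\<lambda>a\<in>obj A. code (representable Q A a))\<rparr>"


section \<open>Weighted colimits and saturated classes\<close>

text \<open>The distributor \<open>\<B>(c,-) : \<B> \<rightarrow> *\<^bsub>tc\<^esub>\<close>.\<close>

definition corepresentable :: "('u::zf_universe, 'u) quantaloid_data \<Rightarrow> 'u qcat \<Rightarrow> 'u \<Rightarrow> 'u dist" where
  "corepresentable Q B c = \<lparr>dsrc = B, dtgt = star Q (ty B c),
     dmat = (\<lambda>x\<in>{pt}. \<lambda>b\<in>obj B. hom B c b)\<rparr>"

definition is_colim ::
  "('u::zf_universe, 'u) quantaloid_data \<Rightarrow> 'u dist \<Rightarrow> 'u qfun \<Rightarrow> 'u \<Rightarrow> bool" where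
  "is_colim Q \<phi> F c \<longleftrightarrow> c \<in> obj (ftgt F) \<and> ty (ftgt F) c = ptype \<phi> \<and>
     corepresentable Q (ftgt F) c = lift Q \<phi> (cograph F)"

definition colim :: "('u::zf_universe, 'u) quantaloid_data \<Rightarrow> 'u dist \<Rightarrow> 'u qfun \<Rightarrow> 'u" where
  "colim Q \<phi> F = (SOME c. is_colim Q \<phi> F c)"

definition cocomplete :: "('u::zf_universe, 'u) quantaloid_data \<Rightarrow> 'u dist set \<Rightarrow> 'u qcat \<Rightarrow> bool" where
  "cocomplete Q C B \<longleftrightarrow> (\<forall>A\<in>Ob (Dist Q). \<forall>\<phi>\<in>presheaves_on Q A \<inter> C. \<forall>F\<in>functors Q A B.
     \<exists>c. is_colim Q \<phi> F c)"

definition cocontinuous :: "('u::zf_universe, 'u) quantaloid_data \<Rightarrow> 'u dist set \<Rightarrow> 'u qfun \<Rightarrow> bool" where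
  "cocontinuous Q C G \<longleftrightarrow> (\<forall>A\<in>Ob (Dist Q). \<forall>\<phi>\<in>presheaves_on Q A \<inter> C. \<forall>F\<in>functors Q A (fsrc G).
     \<forall>c. is_colim Q \<phi> F c \<longrightarrow> is_colim Q \<phi> (G \<circ>\<^sub>f F) (fmap G c))"

definition saturated :: "('u::zf_universe, 'u) quantaloid_data \<Rightarrow> 'u dist set \<Rightarrow> bool" where
  "saturated Q C \<longleftrightarrow> C \<subseteq> presheaves Q \<and>
     (\<forall>A\<in>Ob (Dist Q). \<forall>a\<in>obj A. representable Q A a \<in> C) \<and>
     (\<forall>A\<in>Ob (Dist Q). \<forall>B\<in>Ob (Dist Q). \<forall>\<phi>\<in>presheaves_on Q A \<inter> C. \<forall>G\<in>functors Q A (P0 Q B).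
        (\<forall>a\<in>obj A. decode Q B (fmap G a) \<in> C) \<longrightarrow> decode Q B (colim Q \<phi> G) \<in> C)"


section \<open>Full sub-KZ-doctrines of the presheaf doctrine\<close>

text \<open>As \<open>Cat(\<Q>)\<close> is only locally preordered, equations between functors, including the functoriality
  of a 2-functor, are required up to \<^const>\<open>fiso\<close>. Nothing need be said about 2-cells in the naturality
  of a transformation, because these are mere inequalities.\<close>

record 'u two_fun =
  map0 :: "'u qcat \<Rightarrow> 'u qcat"
  map1 :: "'u qfun \<Rightarrow> 'u qfun"

type_synonym 'u trans = "'u qcat \<Rightarrow> 'u qfun"

definition two_functor :: "('u::zf_universe, 'u) quantaloid_data \<Rightarrow> 'u two_fun \<Rightarrow> bool" where
  "two_functor Q T \<longleftrightarrow>
     (\<forall>A\<in>Ob (Dist Q). map0 T A \<in> Ob (Dist Q)) \<and>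
     (\<forall>A\<in>Ob (Dist Q). \<forall>B\<in>Ob (Dist Q). \<forall>F\<in>functors Q A B.
        map1 T F \<in> functors Q (map0 T A) (map0 T B)) \<and>
     (\<forall>A\<in>Ob (Dist Q). \<forall>B\<in>Ob (Dist Q). \<forall>F\<in>functors Q A B. \<forall>G\<in>functors Q A B.
        fle Q F G \<longrightarrow> fle Q (map1 T F) (map1 T G)) \<and>
     (\<forall>A\<in>Ob (Dist Q). fiso Q (map1 T (fid A)) (fid (map0 T A))) \<and>
     (\<forall>A\<in>Ob (Dist Q). \<forall>B\<in>Ob (Dist Q). \<forall>C\<in>Ob (Dist Q). \<forall>F\<in>functors Q A B. \<forall>G\<in>functors Q B C.
        fiso Q (map1 T (G \<circ>\<^sub>f F)) (map1 T G \<circ>\<^sub>f map1 T F))"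

definition two_natural ::
  "('u::zf_universe, 'u) quantaloid_data \<Rightarrow> 'u two_fun \<Rightarrow> 'u two_fun \<Rightarrow> 'u trans \<Rightarrow> bool" where
  "two_natural Q S T \<alpha> \<longleftrightarrow>
     (\<forall>A\<in>Ob (Dist Q). \<alpha> A \<in> functors Q (map0 S A) (map0 T A)) \<and>
     (\<forall>A\<in>Ob (Dist Q). \<forall>B\<in>Ob (Dist Q). \<forall>F\<in>functors Q A B.
        fiso Q (\<alpha> B \<circ>\<^sub>f map1 S F) (map1 T F \<circ>\<^sub>f \<alpha> A))"

definition id2 :: "'u two_fun" where
  "id2 = \<lparr>map0 = (\<lambda>A. A), map1 = (\<lambda>F. F)\<rparr>"

definition comp2 :: "'u two_fun \<Rightarrow> 'u two_fun \<Rightarrow> 'u two_fun" where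
  "comp2 S T = \<lparr>map0 = (\<lambda>A. map0 S (map0 T A)), map1 = (\<lambda>F. map1 S (map1 T F))\<rparr>"

definition P1 :: "('u::zf_universe, 'u) quantaloid_data \<Rightarrow> 'u qfun \<Rightarrow> 'u qfun" where
  "P1 Q F = \<lparr>fsrc = P0 Q (fsrc F), ftgt = P0 Q (ftgt F),
     fmap = (\<lambda>x\<in>obj (P0 Q (fsrc F)). code (dcomp Q (graph F) (decode Q (fsrc F) x)))\<rparr>"

definition presheaf_functor :: "('u::zf_universe, 'u) quantaloid_data \<Rightarrow> 'u two_fun" where
  "presheaf_functor Q = \<lparr>map0 = P0 Q, map1 = P1 Q\<rparr>"

definition presheaf_mult :: "('u::zf_universe, 'u) quantaloid_data \<Rightarrow> 'u trans" where
  "presheaf_mult Q A = \<lparr>fsrc = P0 Q (P0 Q A), ftgt = P0 Q A,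
     fmap = (\<lambda>x\<in>obj (P0 Q (P0 Q A)). colim Q (decode Q (P0 Q A) x) (fid (P0 Q A)))\<rparr>"

text \<open>The component at \<open>\<A>\<close> of \<open>\<epsilon> * \<epsilon>\<close> is \<open>\<P>(\<epsilon>\<^bsub>\<A>\<^esub>) \<circ> \<epsilon>\<^bsub>\<T>(\<A>)\<^esub>\<close>.\<close>

definition factorisation :: "('u::zf_universe, 'u) quantaloid_data \<Rightarrow> 'u two_fun \<Rightarrow> 'u trans
    \<Rightarrow> 'u trans \<Rightarrow> 'u trans \<Rightarrow> bool" where
  "factorisation Q T \<epsilon> \<mu> \<eta> \<longleftrightarrow>
     two_natural Q (comp2 T T) T \<mu> \<and> two_natural Q id2 T \<eta> \<and>
     (\<forall>A\<in>Ob (Dist Q).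
        fiso Q (presheaf_mult Q A \<circ>\<^sub>f (P1 Q (\<epsilon> A) \<circ>\<^sub>f \<epsilon> (map0 T A))) (\<epsilon> A \<circ>\<^sub>f \<mu> A) \<and>
        fiso Q (yoneda Q A) (\<epsilon> A \<circ>\<^sub>f \<eta> A))"

definition full_sub_KZ ::
  "('u::zf_universe, 'u) quantaloid_data \<Rightarrow> 'u two_fun \<Rightarrow> 'u trans \<Rightarrow> bool" where
  "full_sub_KZ Q T \<epsilon> \<longleftrightarrow> two_functor Q T \<and> two_natural Q T (presheaf_functor Q) \<epsilon> \<and>
     (\<forall>A\<in>Ob (Dist Q). fully_faithful (\<epsilon> A)) \<and> (\<exists>\<mu> \<eta>. factorisation Q T \<epsilon> \<mu> \<eta>)"

definition equivalent_doctrines :: "('u::zf_universe, 'u) quantaloid_data \<Rightarrow> 'u two_fun \<Rightarrow> 'u trans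
    \<Rightarrow> 'u two_fun \<Rightarrow> 'u trans \<Rightarrow> bool" where
  "equivalent_doctrines Q T \<epsilon> T' \<epsilon>' \<longleftrightarrow>
     (\<exists>\<delta>. two_natural Q T T' \<delta> \<and>
        (\<forall>A\<in>Ob (Dist Q). is_equivalence Q (\<delta> A) \<and> fiso Q (\<epsilon>' A \<circ>\<^sub>f \<delta> A) (\<epsilon> A)))"

definition is_algebra :: "('u::zf_universe, 'u) quantaloid_data \<Rightarrow> 'u two_fun \<Rightarrow> 'u trans \<Rightarrow> 'u trans
    \<Rightarrow> 'u qcat \<Rightarrow> 'u qfun \<Rightarrow> bool" where
  "is_algebra Q T \<mu> \<eta> B L \<longleftrightarrow> B \<in> Ob (Dist Q) \<and> L \<in> functors Q (map0 T B) B \<and>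
     fiso Q (L \<circ>\<^sub>f \<eta> B) (fid B) \<and> fiso Q (L \<circ>\<^sub>f \<mu> B) (L \<circ>\<^sub>f map1 T L)"

definition is_algebra_hom :: "('u::zf_universe, 'u) quantaloid_data \<Rightarrow> 'u two_fun
    \<Rightarrow> 'u qfun \<Rightarrow> 'u qfun \<Rightarrow> 'u qfun \<Rightarrow> bool" where
  "is_algebra_hom Q T L L' G \<longleftrightarrow> fiso Q (G \<circ>\<^sub>f L) (L' \<circ>\<^sub>f map1 T G)"


section \<open>The correspondence\<close>

definition class_functor :: "('u::zf_universe, 'u) quantaloid_data \<Rightarrow> 'u dist set \<Rightarrow> 'u two_fun" where
  "class_functor Q C = \<lparr>map0 = presheaf_cat Q C,
     map1 = (\<lambda>F. \<lparr>fsrc = presheaf_cat Q C (fsrc F), ftgt = presheaf_cat Q C (ftgt F),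
       fmap = (\<lambda>x\<in>obj (presheaf_cat Q C (fsrc F)).
                 code (dcomp Q (graph F) (decode Q (fsrc F) x)))\<rparr>)\<rparr>"

definition class_inclusion :: "('u::zf_universe, 'u) quantaloid_data \<Rightarrow> 'u dist set \<Rightarrow> 'u trans" where
  "class_inclusion Q C A = \<lparr>fsrc = presheaf_cat Q C A, ftgt = P0 Q A,
     fmap = (\<lambda>x\<in>obj (presheaf_cat Q C A). x)\<rparr>"

definition doctrine_class ::
  "('u::zf_universe, 'u) quantaloid_data \<Rightarrow> 'u two_fun \<Rightarrow> 'u trans \<Rightarrow> 'u dist set" where
  "doctrine_class Q T \<epsilon> = {decode Q A (fmap (\<epsilon> A) t) | A t. A \<in> Ob (Dist Q) \<and> t \<in> obj (map0 T A)}"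

text \<open>The action of \<open>\<T>'\<close> on distributors.\<close>

definition doctrine_extension :: "('u::zf_universe, 'u) quantaloid_data \<Rightarrow> 'u two_fun \<Rightarrow> 'u trans
    \<Rightarrow> 'u dist \<Rightarrow> 'u dist" where
  "doctrine_extension Q T \<epsilon> \<Phi> = \<lparr>dsrc = map0 T (dsrc \<Phi>), dtgt = map0 T (dtgt \<Phi>),
     dmat = (\<lambda>t\<in>obj (map0 T (dtgt \<Phi>)). \<lambda>s\<in>obj (map0 T (dsrc \<Phi>)).
       hom (P0 Q (dtgt \<Phi>)) (fmap (\<epsilon> (dtgt \<Phi>)) t)
         (code (dcomp Q \<Phi> (decode Q (dsrc \<Phi>) (fmap (\<epsilon> (dsrc \<Phi>)) s)))))\<rparr>"

end

theory Submission
  imports Defs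
begin

text \<open>
  Presheaf categories are skeletal, so equations up to isomorphism become equalities after composing
  with a fully faithful functor into some \<open>\<P>(\<A>)\<close>. Everything then rests on two facts about colimits:
  \<open>colim (\<P>(F)(\<phi>), G) = colim (\<phi>, G \<circ> F)\<close>, and \<open>\<P>(F)\<close> preserves colimits. For a full sub-KZ-doctrine
  the inequality \<open>\<T>(\<eta>) \<le> \<eta>\<T>\<close> makes an algebra \<open>L\<close> left adjoint to \<open>\<eta>\<close>, so that \<open>L (\<T>(F)(t))\<close> is the
  colimit of \<open>F\<close> weighted by \<open>\<epsilon>(t)\<close>; this identifies algebras with cocomplete categories and
  homomorphisms with cocontinuous functors. Conversely the class is recovered from its cocomplete
  categories: \<open>\<C>(\<A>)\<close> is \<open>\<C>\<close>-cocomplete with \<open>\<C>\<close>-cocontinuous inclusion into \<open>\<P>(\<A>)\<close>, so if it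
  is also \<open>\<D>\<close>-cocomplete with \<open>\<D>\<close>-cocontinuous inclusion, then every \<open>\<phi> \<in> \<D>\<close>, being the
  \<open>\<phi>\<close>-weighted colimit of the representables, lies in \<open>\<C>(\<A>)\<close>.
\<close>

section \<open>The universe\<close>

text \<open>Two features of the setting shape the work. First, liftings and colimits are given only
  by universal properties (through \<open>THE\<close> and \<open>SOME\<close>), and composites of
  distributors by joins. So arrows are rarely computed: two arrows are identified by comparing the
  arrows below or above them, and since composition preserves joins, each such comparison becomes an
  exchange of universal quantifiers. Second, a doctrine comes with \<mu> and \<eta> natural only up
  to isomorphism and without its KZ inequality. That inequality is obtained from
  \<open>T(A)(\<eta> a, t) = \<epsilon>(t)(a)\<close>, the Yoneda lemma carried over along
  \<epsilon>, which reduces it to composition in \<open>T(A)\<close>. The law for \<mu> is read as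
  saying that \<open>\<epsilon>(\<mu>(t))\<close> is the colimit of \<epsilon> weighted by
  \<open>\<epsilon>(t)\<close>; in this form it yields both the associativity of algebras and the
  saturation of the class of a doctrine. In the other direction, \<open>P(F)(\<phi>)\<close> is the
  \<phi>-weighted colimit of the representables at the objects \<open>F a\<close>, which is why a
  saturated class is stable under \<open>P(F)\<close>.\<close>

lemma elts_vset: "small S \<Longrightarrow> elts (vset S) = S"
  unfolding small_def vset_def by (rule theI') (metis extensionality)

lemma vset_inject: "small S \<Longrightarrow> small T \<Longrightarrow> vset S = vset T \<longleftrightarrow> S = T"
  by (metis elts_vset)

lemma small_elts: "small (elts x)"
  by (auto simp: small_def)

lemma small_subset: "small S \<Longrightarrow> T \<subseteq> S \<Longrightarrow> small T"
  unfolding small_def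
proof (elim exE)
  fix x assume "T \<subseteq> S" "elts x = S"
  then have "T = {y \<in> elts x. y \<in> T}" by auto
  then show "\<exists>x. elts x = T" using separation[of x "\<lambda>y. y \<in> T"] by simp
qed

lemma small_image: "small S \<Longrightarrow> small (f ` S)"
  for f :: "'u::zf_universe \<Rightarrow> 'u"
  unfolding small_def using replacement[where f = f] by metis

lemma small_two: "small {x, y}"
  unfolding small_def by (rule pairing)

lemma small_single: "small {x}"
  using small_two[of x x] by simp

lemma small_Union:
  fixes f :: "'u::zf_universe \<Rightarrow> 'u set"
  assumes "small S" "\<And>x. x \<in> S \<Longrightarrow> small (f x)"
  shows "small (\<Union>x\<in>S. f x)"
proof -
  have "\<exists>z. elts z = (\<Union>x\<in>S. elts (vset (f x)))"
    using union[of "vset ((\<lambda>x. vset (f x)) ` S)"] assms(1) by (simp add: elts_vset small_image)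
  then show ?thesis
    using assms(2) by (simp add: elts_vset small_def)
qed

text \<open>The codes of the subsets all lie in the powerset of the code of \<open>S\<close>. This
  bounds the graphs of presheaves in \<open>small_codes\<close>.\<close>

lemma small_subsets:
  assumes "small S"
  shows "small (vset ` {T. T \<subseteq> S})"
proof -
  obtain z where z: "elts z = {y. elts y \<subseteq> S}"
    using powerset[of "vset S"] assms by (auto simp: elts_vset)
  have "vset ` {T. T \<subseteq> S} \<subseteq> elts z"
    using assms by (auto simp: z elts_vset small_subset)
  then show ?thesis by (rule small_subset[OF small_elts])
qed

text \<open>\<open>vpair\<close> is the Kuratowski pair, so the claim reduces to comparing
  doubletons.\<close>

lemma vpair_inject: "vpair x y = vpair x' y' \<longleftrightarrow> x = x' \<and> y = y'"
  by (auto simp: vpair_def vset_inject small_two small_single doubleton_eq_iff)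

lemma small_vpairs:
  assumes "small S" "small T"
  shows "small {vpair x y | x y. x \<in> S \<and> y \<in> T}"
proof -
  have "{vpair x y | x y. x \<in> S \<and> y \<in> T} = (\<Union>x\<in>S. vpair x ` T)" by auto
  then show ?thesis using assms by (simp add: small_Union small_image)
qed

section \<open>Arrows of a quantaloid\<close>

context quantaloid
begin

definition arr :: "'o \<Rightarrow> 'o \<Rightarrow> 'm \<Rightarrow> bool" where
  "arr X Y f \<longleftrightarrow> X \<in> Ob Q \<and> Y \<in> Ob Q \<and> f \<in> carrier (Hom Q X Y)"

text \<open>The typing of both sides is part of the inequality, so a chain of steps carries its side
  conditions along; \<open>arr_le_arr\<close> recovers them.\<close>

definition arr_le :: "'m \<Rightarrow> 'o \<Rightarrow> 'o \<Rightarrow> 'm \<Rightarrow> bool"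
    (\<open>(_/ \<preceq>\<^bsub>_,_\<^esub> _)\<close> [51, 0, 0, 51] 50) where
  "f \<preceq>\<^bsub>X,Y\<^esub> g \<longleftrightarrow> arr X Y f \<and> arr X Y g \<and> f \<sqsubseteq>\<^bsub>Hom Q X Y\<^esub> g"

text \<open>Indexing by a family instead of a set of arrows makes distributivity of composition over
  joins a rewriting of the family, as in \<open>comp_join\<close> and
  \<open>join_comp\<close>.\<close>

definition join_of :: "'o \<Rightarrow> 'o \<Rightarrow> ('c \<Rightarrow> 'm) \<Rightarrow> 'c set \<Rightarrow> 'm" where
  "join_of X Y f I = \<Squnion>\<^bsub>Hom Q X Y\<^esub> (f ` I)"

abbreviation comp (infixl \<open>\<cdot>\<close> 70) where
  "g \<cdot> f \<equiv> Comp Q g f"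

lemma arr_le_arr: "f \<preceq>\<^bsub>X,Y\<^esub> g \<Longrightarrow> arr X Y f" "f \<preceq>\<^bsub>X,Y\<^esub> g \<Longrightarrow> arr X Y g"
  by (auto simp: arr_le_def)

lemma arr_Ob: "arr X Y f \<Longrightarrow> X \<in> Ob Q" "arr X Y f \<Longrightarrow> Y \<in> Ob Q"
  by (auto simp: arr_def)

lemma le_iff: "arr X Y f \<Longrightarrow> arr X Y g \<Longrightarrow> f \<sqsubseteq>\<^bsub>Hom Q X Y\<^esub> g \<longleftrightarrow> f \<preceq>\<^bsub>X,Y\<^esub> g"
  by (auto simp: arr_le_def)

lemma arr_le_refl: "arr X Y f \<Longrightarrow> f \<preceq>\<^bsub>X,Y\<^esub> f"
proof -
  assume f: "arr X Y f"
  then interpret complete_lattice "Hom Q X Y" by (simp add: arr_def hom_complete)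
  show ?thesis using f by (auto simp: arr_le_def arr_def)
qed

lemma arr_le_antisym: "f \<preceq>\<^bsub>X,Y\<^esub> g \<Longrightarrow> g \<preceq>\<^bsub>X,Y\<^esub> f \<Longrightarrow> f = g"
proof -
  assume f: "f \<preceq>\<^bsub>X,Y\<^esub> g" "g \<preceq>\<^bsub>X,Y\<^esub> f"
  then interpret complete_lattice "Hom Q X Y" by (simp add: arr_le_def arr_def hom_complete)
  show ?thesis using f by (auto simp: arr_le_def arr_def intro: le_antisym)
qed

lemma arr_le_trans [trans]: "f \<preceq>\<^bsub>X,Y\<^esub> g \<Longrightarrow> g \<preceq>\<^bsub>X,Y\<^esub> h \<Longrightarrow> f \<preceq>\<^bsub>X,Y\<^esub> h"
proof -
  assume f: "f \<preceq>\<^bsub>X,Y\<^esub> g" "g \<preceq>\<^bsub>X,Y\<^esub> h"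
  then interpret complete_lattice "Hom Q X Y" by (simp add: arr_le_def arr_def hom_complete)
  show ?thesis using f by (auto simp: arr_le_def arr_def intro: le_trans)
qed

text \<open>Indirect equality: liftings, and with them the homs of presheaf categories, are known
  only through the arrows below them.\<close>

lemma arr_eqI:
  assumes "arr X Y f" "arr X Y g" "\<And>h. arr X Y h \<Longrightarrow> h \<preceq>\<^bsub>X,Y\<^esub> f \<longleftrightarrow> h \<preceq>\<^bsub>X,Y\<^esub> g"
  shows "f = g"
  using assms by (meson arr_le_antisym arr_le_refl)

lemma comp_arr: "arr X Y f \<Longrightarrow> arr Y Z g \<Longrightarrow> arr X Z (g \<cdot> f)"
  by (auto simp: arr_def intro: comp_closed)

lemma ident_arr: "X \<in> Ob Q \<Longrightarrow> arr X X (Ident Q X)"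
  by (simp add: arr_def ident_closed)

lemma comp_ident: "arr X Y f \<Longrightarrow> Ident Q Y \<cdot> f = f" "arr X Y f \<Longrightarrow> f \<cdot> Ident Q X = f"
  by (auto simp: arr_def ident_left ident_right)

lemma assoc: "arr X Y f \<Longrightarrow> arr Y Z g \<Longrightarrow> arr Z W h \<Longrightarrow> h \<cdot> g \<cdot> f = h \<cdot> (g \<cdot> f)"
  unfolding arr_def using comp_assoc by blast

lemma join_arr: "X \<in> Ob Q \<Longrightarrow> Y \<in> Ob Q \<Longrightarrow> (\<And>i. i \<in> I \<Longrightarrow> arr X Y (f i)) \<Longrightarrow> arr X Y (join_of X Y f I)"
proof -
  assume f: "X \<in> Ob Q" "Y \<in> Ob Q" "\<And>i. i \<in> I \<Longrightarrow> arr X Y (f i)"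
  then interpret complete_lattice "Hom Q X Y" by (simp add: hom_complete)
  have "f ` I \<subseteq> carrier (Hom Q X Y)" using f(3) by (auto simp: arr_def)
  then show ?thesis using f by (simp add: arr_def join_of_def)
qed

lemma join_upper: "(\<And>i. i \<in> I \<Longrightarrow> arr X Y (f i)) \<Longrightarrow> i \<in> I \<Longrightarrow> f i \<preceq>\<^bsub>X,Y\<^esub> join_of X Y f I"
proof -
  assume f: "\<And>i. i \<in> I \<Longrightarrow> arr X Y (f i)" "i \<in> I"
  then have o: "X \<in> Ob Q" "Y \<in> Ob Q" by (auto dest: arr_Ob)
  then interpret complete_lattice "Hom Q X Y" by (simp add: hom_complete)
  have "f ` I \<subseteq> carrier (Hom Q X Y)" using f(1) by (auto simp: arr_def)
  then show ?thesis using f join_arr[OF o f(1)] sup_upper unfolding arr_le_def join_of_def by auto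
qed

lemma join_least: "arr X Y g \<Longrightarrow> (\<And>i. i \<in> I \<Longrightarrow> f i \<preceq>\<^bsub>X,Y\<^esub> g) \<Longrightarrow> join_of X Y f I \<preceq>\<^bsub>X,Y\<^esub> g"
proof -
  assume g: "arr X Y g" and f: "\<And>i. i \<in> I \<Longrightarrow> f i \<preceq>\<^bsub>X,Y\<^esub> g"
  then have o: "X \<in> Ob Q" "Y \<in> Ob Q" by (auto dest: arr_Ob)
  then interpret complete_lattice "Hom Q X Y" by (simp add: hom_complete)
  have fa: "\<And>i. i \<in> I \<Longrightarrow> arr X Y (f i)" using f by (auto dest: arr_le_arr)
  then have "f ` I \<subseteq> carrier (Hom Q X Y)" by (auto simp: arr_def)
  then have "\<Squnion>\<^bsub>Hom Q X Y\<^esub> (f ` I) \<sqsubseteq>\<^bsub>Hom Q X Y\<^esub> g"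
    using f g by (intro sup_least) (auto simp: arr_le_def arr_def)
  then show ?thesis using join_arr[OF o fa] g unfolding arr_le_def join_of_def by auto
qed

lemma join_le_iff:
  assumes "\<And>i. i \<in> I \<Longrightarrow> arr X Y (f i)" "arr X Y g"
  shows "join_of X Y f I \<preceq>\<^bsub>X,Y\<^esub> g \<longleftrightarrow> (\<forall>i\<in>I. f i \<preceq>\<^bsub>X,Y\<^esub> g)"
  using assms join_upper[of I X Y f, OF assms(1)] by (meson arr_le_trans join_least)

lemma comp_join:
  assumes "\<And>i. i \<in> I \<Longrightarrow> arr X Y (f i)" "arr Y Z g" "X \<in> Ob Q"
  shows "g \<cdot> join_of X Y f I = join_of X Z (\<lambda>i. g \<cdot> f i) I"
proof -
  have "f ` I \<subseteq> carrier (Hom Q X Y)" using assms(1) by (auto simp: arr_def)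
  moreover have "sup_pres (Hom Q X Y) (Hom Q X Z) (\<lambda>f. Comp Q g f)"
    using assms by (intro comp_sup_right) (auto simp: arr_def)
  ultimately show ?thesis by (simp add: sup_pres_def join_of_def image_image)
qed

lemma join_comp:
  assumes "\<And>i. i \<in> I \<Longrightarrow> arr Y Z (g i)" "arr X Y f" "Z \<in> Ob Q"
  shows "join_of Y Z g I \<cdot> f = join_of X Z (\<lambda>i. g i \<cdot> f) I"
proof -
  have "g ` I \<subseteq> carrier (Hom Q Y Z)" using assms(1) by (auto simp: arr_def)
  moreover have "sup_pres (Hom Q Y Z) (Hom Q X Z) (\<lambda>g. Comp Q g f)"
    using assms by (intro comp_sup_left) (auto simp: arr_def)
  ultimately show ?thesis by (simp add: sup_pres_def join_of_def image_image)
qed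

lemma join_cong: "I = J \<Longrightarrow> (\<And>i. i \<in> J \<Longrightarrow> f i = g i) \<Longrightarrow> join_of X Y f I = join_of X Y g J"
  by (simp add: join_of_def cong: image_cong)

text \<open>Expresses an inequality as a join. Monotonicity of composition is not an axiom of
  \<open>quantaloid\<close>; it follows from preservation of this binary join.\<close>

lemma join_pair: "arr X Y f \<Longrightarrow> f \<preceq>\<^bsub>X,Y\<^esub> g \<Longrightarrow> join_of X Y id {f, g} = g"
  by (rule arr_le_antisym, rule join_least)
    (auto intro: arr_le_refl join_upper[where f = id, simplified] dest: arr_le_arr)

lemma comp_mono_right:
  assumes f: "f \<preceq>\<^bsub>X,Y\<^esub> f'" and g: "arr Y Z g"
  shows "g \<cdot> f \<preceq>\<^bsub>X,Z\<^esub> g \<cdot> f'"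
proof -
  note a = arr_le_arr[OF f]
  have "g \<cdot> f' = join_of X Z (\<lambda>i. g \<cdot> id i) {f, f'}"
    using comp_join[of "{f, f'}" X Y id Z g] a g join_pair[OF a(1) f] by (auto dest: arr_Ob)
  then show ?thesis
    using join_upper[of "{f, f'}" X Z "\<lambda>i. g \<cdot> id i" f] a g by (auto intro: comp_arr)
qed

lemma comp_mono_left:
  assumes g: "g \<preceq>\<^bsub>Y,Z\<^esub> g'" and f: "arr X Y f"
  shows "g \<cdot> f \<preceq>\<^bsub>X,Z\<^esub> g' \<cdot> f"
proof -
  note a = arr_le_arr[OF g]
  have "g' \<cdot> f = join_of X Z (\<lambda>i. id i \<cdot> f) {g, g'}"
    using join_comp[of "{g, g'}" Y Z id X f] a f join_pair[OF a(1) g] by (auto dest: arr_Ob)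
  then show ?thesis
    using join_upper[of "{g, g'}" X Z "\<lambda>i. id i \<cdot> f" g] a f by (auto intro: comp_arr)
qed

text \<open>This and \<open>comp_join_le_iff\<close> turn an inequality about a composite with a
  join into a universally quantified one, the basic move of all later calculations with
  distributors.\<close>

lemma join_comp_le_iff:
  assumes f: "\<And>i. i \<in> I \<Longrightarrow> arr X Y (f i)" and h: "arr W X h" and g: "arr W Y g"
  shows "join_of X Y f I \<cdot> h \<preceq>\<^bsub>W,Y\<^esub> g \<longleftrightarrow> (\<forall>i\<in>I. f i \<cdot> h \<preceq>\<^bsub>W,Y\<^esub> g)"
proof -
  have "join_of X Y f I \<cdot> h = join_of W Y (\<lambda>i. f i \<cdot> h) I"
    using f h arr_Ob(2)[OF g] by (rule join_comp)
  then show ?thesis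
    using join_le_iff[of I W Y "\<lambda>i. f i \<cdot> h" g] comp_arr[OF h f] g by simp
qed

lemma comp_join_le_iff:
  assumes f: "\<And>i. i \<in> I \<Longrightarrow> arr X Y (f i)" and h: "arr Y Z h" and g: "arr X Z g"
  shows "h \<cdot> join_of X Y f I \<preceq>\<^bsub>X,Z\<^esub> g \<longleftrightarrow> (\<forall>i\<in>I. h \<cdot> f i \<preceq>\<^bsub>X,Z\<^esub> g)"
proof -
  have "h \<cdot> join_of X Y f I = join_of X Z (\<lambda>i. h \<cdot> f i) I"
    using f h arr_Ob(1)[OF g] by (rule comp_join)
  then show ?thesis
    using join_le_iff[of I X Z "\<lambda>i. h \<cdot> f i" g] comp_arr[OF f h] g by simp
qed

end

section \<open>Distributors\<close>

lemma Ob_Dist: "Ob (Dist Q) = {A. is_qcat Q A}"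
  by (simp add: Dist_def)

context small_quantaloid
begin

lemma qcat_hom:
  assumes "is_qcat Q A" "a \<in> obj A" "a' \<in> obj A"
  shows "arr (ty A a) (ty A a') (hom A a' a)"
  using assms unfolding is_qcat_def arr_def by (simp add: PiE_iff)

lemma qcat_ty: "is_qcat Q A \<Longrightarrow> a \<in> obj A \<Longrightarrow> ty A a \<in> Ob Q"
  unfolding is_qcat_def by auto

lemma qcat_ident: "is_qcat Q A \<Longrightarrow> a \<in> obj A \<Longrightarrow> Ident Q (ty A a) \<preceq>\<^bsub>ty A a, ty A a\<^esub> hom A a a"
  using qcat_hom[of A a a] unfolding is_qcat_def arr_le_def by (auto intro!: ident_arr)

lemma qcat_comp:
  assumes "is_qcat Q A" "a \<in> obj A" "a' \<in> obj A" "a'' \<in> obj A"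
  shows "hom A a'' a' \<cdot> hom A a' a \<preceq>\<^bsub>ty A a, ty A a''\<^esub> hom A a'' a"
  using qcat_hom[OF assms(1,2,3)] qcat_hom[OF assms(1,3,4)] qcat_hom[OF assms(1,2,4)] assms
  unfolding is_qcat_def arr_le_def by (auto intro: comp_arr)

lemma qcatI:
  assumes "small (obj A)" "ty A \<in> extensional (obj A)"
    "hom A = (\<lambda>a'\<in>obj A. \<lambda>a\<in>obj A. h a' a)"
    "\<And>a. a \<in> obj A \<Longrightarrow> ty A a \<in> Ob Q"
    "\<And>a a'. a \<in> obj A \<Longrightarrow> a' \<in> obj A \<Longrightarrow> arr (ty A a) (ty A a') (h a' a)"
    "\<And>a. a \<in> obj A \<Longrightarrow> Ident Q (ty A a) \<preceq>\<^bsub>ty A a, ty A a\<^esub> h a a"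
    "\<And>a a' a''. a \<in> obj A \<Longrightarrow> a' \<in> obj A \<Longrightarrow> a'' \<in> obj A \<Longrightarrow>
      h a'' a' \<cdot> h a' a \<preceq>\<^bsub>ty A a, ty A a''\<^esub> h a'' a"
  shows "is_qcat Q A"
  using assms unfolding is_qcat_def by (auto simp: PiE_def arr_le_def arr_def)

text \<open>Includes that both ends are Q-categories, so that a single hypothesis supplies every
  typing fact. \<open>is_functor\<close> and \<open>is_psh\<close> are built in the same
  way.\<close>

definition is_dist :: "'u qcat \<Rightarrow> 'u qcat \<Rightarrow> 'u dist \<Rightarrow> bool" where
  "is_dist A B \<Phi> \<longleftrightarrow> is_qcat Q A \<and> is_qcat Q B \<and> \<Phi> \<in> distributors Q A B"

lemma dist_qcat: "is_dist A B \<Phi> \<Longrightarrow> is_qcat Q A" "is_dist A B \<Phi> \<Longrightarrow> is_qcat Q B"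
  by (auto simp: is_dist_def)

lemma dist_src: "is_dist A B \<Phi> \<Longrightarrow> dsrc \<Phi> = A" "is_dist A B \<Phi> \<Longrightarrow> dtgt \<Phi> = B"
  by (auto simp: is_dist_def distributors_def)

lemma dist_arr:
  assumes "is_dist A B \<Phi>" "a \<in> obj A" "b \<in> obj B"
  shows "arr (ty A a) (ty B b) (dmat \<Phi> b a)"
  using assms qcat_ty unfolding is_dist_def arr_def distributors_def by (auto simp: PiE_iff)

lemma dist_right:
  assumes "is_dist A B \<Phi>" "a \<in> obj A" "a' \<in> obj A" "b \<in> obj B"
  shows "dmat \<Phi> b a' \<cdot> hom A a' a \<preceq>\<^bsub>ty A a, ty B b\<^esub> dmat \<Phi> b a"
  using assms dist_arr[OF assms(1)] qcat_hom[OF dist_qcat(1)[OF assms(1)]]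
  by (simp add: le_iff[symmetric] comp_arr[of _ "ty A a'"]) (simp add: is_dist_def distributors_def)

lemma dist_left:
  assumes "is_dist A B \<Phi>" "a \<in> obj A" "b \<in> obj B" "b' \<in> obj B"
  shows "hom B b b' \<cdot> dmat \<Phi> b' a \<preceq>\<^bsub>ty A a, ty B b\<^esub> dmat \<Phi> b a"
  using assms dist_arr[OF assms(1)] qcat_hom[OF dist_qcat(2)[OF assms(1)]]
  by (simp add: le_iff[symmetric] comp_arr[of _ "ty B b'"]) (simp add: is_dist_def distributors_def)

lemma distI:
  assumes "is_qcat Q A" "is_qcat Q B" "dsrc \<Phi> = A" "dtgt \<Phi> = B"
    "dmat \<Phi> = (\<lambda>b\<in>obj B. \<lambda>a\<in>obj A. M b a)"
    "\<And>a b. a \<in> obj A \<Longrightarrow> b \<in> obj B \<Longrightarrow> arr (ty A a) (ty B b) (M b a)"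
    "\<And>a a' b. a \<in> obj A \<Longrightarrow> a' \<in> obj A \<Longrightarrow> b \<in> obj B \<Longrightarrow>
      M b a' \<cdot> hom A a' a \<preceq>\<^bsub>ty A a, ty B b\<^esub> M b a"
    "\<And>a b b'. a \<in> obj A \<Longrightarrow> b \<in> obj B \<Longrightarrow> b' \<in> obj B \<Longrightarrow>
      hom B b b' \<cdot> M b' a \<preceq>\<^bsub>ty A a, ty B b\<^esub> M b a"
  shows "is_dist A B \<Phi>"
  using assms unfolding is_dist_def distributors_def by (auto simp: arr_le_def arr_def)

lemma dist_eqI:
  assumes "is_dist A B \<Phi>" "is_dist A B \<Psi>"
    "\<And>a b. a \<in> obj A \<Longrightarrow> b \<in> obj B \<Longrightarrow> dmat \<Phi> b a = dmat \<Psi> b a"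
  shows "\<Phi> = \<Psi>"
proof -
  \<comment> \<open>A matrix is extensional in both arguments, so it equals its own restriction and
    is determined by its entries on the carriers.\<close>
  have e: "\<Xi> \<in> distributors Q A B \<Longrightarrow> dmat \<Xi> = (\<lambda>b\<in>obj B. \<lambda>a\<in>obj A. dmat \<Xi> b a)" for \<Xi>
    unfolding distributors_def
    by (auto simp: fun_eq_iff restrict_def PiE_iff extensional_def)
  have "dmat \<Phi> = dmat \<Psi>"
    using e[of \<Phi>] e[of \<Psi>] assms unfolding is_dist_def
    by (metis (no_types, lifting) restrict_ext)
  then show ?thesis using dist_src[OF assms(1)] dist_src[OF assms(2)] by (cases \<Phi>, cases \<Psi>) auto
qed

lemma dist_le_iff:
  assumes "is_dist A B \<Phi>" "is_dist A B \<Psi>"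
  shows "\<Phi> \<sqsubseteq>\<^bsub>Hom (Dist Q) A B\<^esub> \<Psi> \<longleftrightarrow>
    (\<forall>b\<in>obj B. \<forall>a\<in>obj A. dmat \<Phi> b a \<preceq>\<^bsub>ty A a, ty B b\<^esub> dmat \<Psi> b a)"
  using dist_arr[OF assms(1)] dist_arr[OF assms(2)] by (simp add: Dist_def le_iff)

lemma dcomp_dmat:
  assumes "is_dist A B \<Phi>" "is_dist B C \<Psi>" "a \<in> obj A" "c \<in> obj C"
  shows "dmat (dcomp Q \<Psi> \<Phi>) c a = join_of (ty A a) (ty C c) (\<lambda>b. dmat \<Psi> c b \<cdot> dmat \<Phi> b a) (obj B)"
  using assms by (simp add: dcomp_def dist_src[OF assms(1)] dist_src[OF assms(2)] join_of_def)

lemma dcomp_dist: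
  assumes F: "is_dist A B \<Phi>" and G: "is_dist B C \<Psi>"
  shows "is_dist A C (dcomp Q \<Psi> \<Phi>)"
proof (rule distI)
  note s = dist_src[OF F] dist_src[OF G] dist_qcat[OF F] dist_qcat[OF G]
  note ar = dist_arr[OF F] dist_arr[OF G] qcat_hom[OF s(5)] qcat_hom[OF s(8)]
  note ty = qcat_ty[OF s(5)] qcat_ty[OF s(8)]
  let ?M = "\<lambda>c a. join_of (ty A a) (ty C c) (\<lambda>b. dmat \<Psi> c b \<cdot> dmat \<Phi> b a) (obj B)"
  show "is_qcat Q A" "is_qcat Q C" "dsrc (dcomp Q \<Psi> \<Phi>) = A" "dtgt (dcomp Q \<Psi> \<Phi>) = C"
    using s by (auto simp: dcomp_def)
  show "dmat (dcomp Q \<Psi> \<Phi>) = (\<lambda>c\<in>obj C. \<lambda>a\<in>obj A. ?M c a)"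
    using s by (auto simp: dcomp_def join_of_def)
  have c: "arr (ty A a) (ty C c) (dmat \<Psi> c b \<cdot> dmat \<Phi> b a)"
    if "a \<in> obj A" "b \<in> obj B" "c \<in> obj C" for a b c
    using that by (auto intro: comp_arr ar)
  show M: "arr (ty A a) (ty C c) (?M c a)" if "a \<in> obj A" "c \<in> obj C" for a c
    using that ty c by (auto intro: join_arr)
  have u: "dmat \<Psi> c b \<cdot> dmat \<Phi> b a \<preceq>\<^bsub>ty A a,ty C c\<^esub> ?M c a"
    if "a \<in> obj A" "b \<in> obj B" "c \<in> obj C" for a b c
    using join_upper[of "obj B" _ _ "\<lambda>b. dmat \<Psi> c b \<cdot> dmat \<Phi> b a", OF c] that by auto
  show "?M c a' \<cdot> hom A a' a \<preceq>\<^bsub>ty A a,ty C c\<^esub> ?M c a"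
    if "a \<in> obj A" "a' \<in> obj A" "c \<in> obj C" for a a' c
  proof -
    have "?M c a' \<cdot> hom A a' a = join_of (ty A a) (ty C c) (\<lambda>b. (dmat \<Psi> c b \<cdot> dmat \<Phi> b a') \<cdot> hom A a' a) (obj B)"
      using that c ar ty by (intro join_comp) auto
    also have "\<dots> \<preceq>\<^bsub>ty A a,ty C c\<^esub> ?M c a"
    proof (rule join_least[OF M[OF that(1,3)]])
      fix b assume b: "b \<in> obj B"
      have "dmat \<Psi> c b \<cdot> dmat \<Phi> b a' \<cdot> hom A a' a = dmat \<Psi> c b \<cdot> (dmat \<Phi> b a' \<cdot> hom A a' a)"
        using that b ar by (intro assoc) auto
      also have "\<dots> \<preceq>\<^bsub>ty A a,ty C c\<^esub> dmat \<Psi> c b \<cdot> dmat \<Phi> b a"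
        using that b ar dist_right[OF F] by (intro comp_mono_right) auto
      also note u[OF that(1) b that(3)]
      finally show "dmat \<Psi> c b \<cdot> dmat \<Phi> b a' \<cdot> hom A a' a \<preceq>\<^bsub>ty A a,ty C c\<^esub> ?M c a" .
    qed
    finally show ?thesis .
  qed
  show "hom C c c' \<cdot> ?M c' a \<preceq>\<^bsub>ty A a,ty C c\<^esub> ?M c a"
    if "a \<in> obj A" "c \<in> obj C" "c' \<in> obj C" for a c c'
  proof -
    have "hom C c c' \<cdot> ?M c' a = join_of (ty A a) (ty C c) (\<lambda>b. hom C c c' \<cdot> (dmat \<Psi> c' b \<cdot> dmat \<Phi> b a)) (obj B)"
      using that c ar ty by (intro comp_join) auto
    also have "\<dots> \<preceq>\<^bsub>ty A a,ty C c\<^esub> ?M c a"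
    proof (rule join_least[OF M[OF that(1,2)]])
      fix b assume b: "b \<in> obj B"
      have "hom C c c' \<cdot> (dmat \<Psi> c' b \<cdot> dmat \<Phi> b a) = (hom C c c' \<cdot> dmat \<Psi> c' b) \<cdot> dmat \<Phi> b a"
        using that b ar by (intro assoc[symmetric]) auto
      also have "\<dots> \<preceq>\<^bsub>ty A a,ty C c\<^esub> dmat \<Psi> c b \<cdot> dmat \<Phi> b a"
        using that b ar dist_left[OF G] by (intro comp_mono_left) auto
      also note u[OF that(1) b that(2)]
      finally show "hom C c c' \<cdot> (dmat \<Psi> c' b \<cdot> dmat \<Phi> b a) \<preceq>\<^bsub>ty A a,ty C c\<^esub> ?M c a" .
    qed
    finally show ?thesis .
  qed
qed

lemma dcomp_le_iff:
  assumes F: "is_dist A B \<Phi>" and G: "is_dist B C \<Psi>" and H: "is_dist A C \<Xi>"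
  shows "dcomp Q \<Psi> \<Phi> \<sqsubseteq>\<^bsub>Hom (Dist Q) A C\<^esub> \<Xi> \<longleftrightarrow>
    (\<forall>c\<in>obj C. \<forall>a\<in>obj A. \<forall>b\<in>obj B. dmat \<Psi> c b \<cdot> dmat \<Phi> b a \<preceq>\<^bsub>ty A a, ty C c\<^esub> dmat \<Xi> c a)"
proof -
  note ar = dist_arr[OF F] dist_arr[OF G] dist_arr[OF H]
  have "join_of (ty A a) (ty C c) (\<lambda>b. dmat \<Psi> c b \<cdot> dmat \<Phi> b a) (obj B) \<preceq>\<^bsub>ty A a, ty C c\<^esub> dmat \<Xi> c a \<longleftrightarrow>
    (\<forall>b\<in>obj B. dmat \<Psi> c b \<cdot> dmat \<Phi> b a \<preceq>\<^bsub>ty A a, ty C c\<^esub> dmat \<Xi> c a)"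
    if "a \<in> obj A" "c \<in> obj C" for a c
    using that by (intro join_le_iff) (auto intro: comp_arr ar)
  then show ?thesis
    by (simp add: dist_le_iff[OF dcomp_dist[OF F G] H] dcomp_dmat[OF F G])
qed

text \<open>The lifting is computed entrywise: at \<open>(b, a)\<close> it is the join of all
  \<open>h\<close> that satisfy the required inequality, and this join satisfies it too because
  composition preserves joins. The second conclusion is the residuation law; later arguments use
  these two facts in place of the definition by \<open>THE\<close>.\<close>

lemma
  assumes P: "is_dist B C \<Psi>" and F: "is_dist A C \<Phi>"
  shows lift_dist: "is_dist A B (lift Q \<Psi> \<Phi>)"
    and le_lift_iff: "\<And>a b h. \<lbrakk>a \<in> obj A; b \<in> obj B; arr (ty A a) (ty B b) h\<rbrakk> \<Longrightarrow>
      h \<preceq>\<^bsub>ty A a, ty B b\<^esub> dmat (lift Q \<Psi> \<Phi>) b a \<longleftrightarrow>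
      (\<forall>c\<in>obj C. dmat \<Psi> c b \<cdot> h \<preceq>\<^bsub>ty A a, ty C c\<^esub> dmat \<Phi> c a)"
proof -
  note s = dist_src[OF F] dist_src[OF P] dist_qcat[OF F] dist_qcat[OF P]
  note ar = dist_arr[OF F] dist_arr[OF P] qcat_hom[OF s(5)] qcat_hom[OF s(7)]
  note ty = qcat_ty[OF s(5)] qcat_ty[OF s(6)] qcat_ty[OF s(7)]
  let ?S = "\<lambda>b a. {h. arr (ty A a) (ty B b) h \<and> (\<forall>c\<in>obj C. dmat \<Psi> c b \<cdot> h \<preceq>\<^bsub>ty A a, ty C c\<^esub> dmat \<Phi> c a)}"
  define L where "L b a = join_of (ty A a) (ty B b) (\<lambda>h. h) (?S b a)" for b a
  have La: "arr (ty A a) (ty B b) (L b a)" if "a \<in> obj A" "b \<in> obj B" for a b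
    unfolding L_def using that ty by (intro join_arr) auto
  have Lu: "h \<preceq>\<^bsub>ty A a, ty B b\<^esub> L b a"
    if "arr (ty A a) (ty B b) h" "\<And>c. c \<in> obj C \<Longrightarrow> dmat \<Psi> c b \<cdot> h \<preceq>\<^bsub>ty A a, ty C c\<^esub> dmat \<Phi> c a" for h a b
    unfolding L_def using that by (intro join_upper) auto
  have Ll: "dmat \<Psi> c b \<cdot> L b a \<preceq>\<^bsub>ty A a, ty C c\<^esub> dmat \<Phi> c a"
    if "a \<in> obj A" "b \<in> obj B" "c \<in> obj C" for a b c
  proof -
    have "dmat \<Psi> c b \<cdot> L b a = join_of (ty A a) (ty C c) (\<lambda>h. dmat \<Psi> c b \<cdot> h) (?S b a)"
      unfolding L_def using that ar ty by (intro comp_join) auto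
    also have "\<dots> \<preceq>\<^bsub>ty A a, ty C c\<^esub> dmat \<Phi> c a"
      using that ar by (intro join_least) auto
    finally show ?thesis .
  qed
  have Liff: "h \<preceq>\<^bsub>ty A a, ty B b\<^esub> L b a \<longleftrightarrow>
      (\<forall>c\<in>obj C. dmat \<Psi> c b \<cdot> h \<preceq>\<^bsub>ty A a, ty C c\<^esub> dmat \<Phi> c a)"
    if "a \<in> obj A" "b \<in> obj B" "arr (ty A a) (ty B b) h" for a b h
  proof
    assume "h \<preceq>\<^bsub>ty A a, ty B b\<^esub> L b a"
    then show "\<forall>c\<in>obj C. dmat \<Psi> c b \<cdot> h \<preceq>\<^bsub>ty A a, ty C c\<^esub> dmat \<Phi> c a"
      using that ar Ll by (meson comp_mono_right arr_le_trans)
  qed (use that Lu in auto)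
  define \<Lambda> where "\<Lambda> = \<lparr>dsrc = A, dtgt = B, dmat = (\<lambda>b\<in>obj B. \<lambda>a\<in>obj A. L b a)\<rparr>"
  have d: "is_dist A B \<Lambda>"
  proof (rule distI[where M = L])
    fix a a' b assume i: "a \<in> obj A" "a' \<in> obj A" "b \<in> obj B"
    show "L b a' \<cdot> hom A a' a \<preceq>\<^bsub>ty A a,ty B b\<^esub> L b a"
    proof (rule Lu)
      show "arr (ty A a) (ty B b) (L b a' \<cdot> hom A a' a)"
        using i by (auto intro: comp_arr ar La)
      fix c assume c: "c \<in> obj C"
      have "dmat \<Psi> c b \<cdot> (L b a' \<cdot> hom A a' a) = (dmat \<Psi> c b \<cdot> L b a') \<cdot> hom A a' a"
        using i ar La c by (intro assoc[symmetric]) auto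
      also have "\<dots> \<preceq>\<^bsub>ty A a, ty C c\<^esub> dmat \<Phi> c a' \<cdot> hom A a' a"
        by (rule comp_mono_left[OF Ll[OF i(2,3) c] ar(3)[OF i(1,2)]])
      also have "\<dots> \<preceq>\<^bsub>ty A a, ty C c\<^esub> dmat \<Phi> c a"
        using i c by (intro dist_right[OF F]) auto
      finally show "dmat \<Psi> c b \<cdot> (L b a' \<cdot> hom A a' a) \<preceq>\<^bsub>ty A a, ty C c\<^esub> dmat \<Phi> c a" .
    qed
  next
    fix a b b' assume i: "a \<in> obj A" "b \<in> obj B" "b' \<in> obj B"
    show "hom B b b' \<cdot> L b' a \<preceq>\<^bsub>ty A a,ty B b\<^esub> L b a"
    proof (rule Lu)
      show "arr (ty A a) (ty B b) (hom B b b' \<cdot> L b' a)"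
        using i by (auto intro: comp_arr ar La)
      fix c assume c: "c \<in> obj C"
      have "dmat \<Psi> c b \<cdot> (hom B b b' \<cdot> L b' a) = (dmat \<Psi> c b \<cdot> hom B b b') \<cdot> L b' a"
        using i ar La c by (intro assoc[symmetric]) auto
      also have "\<dots> \<preceq>\<^bsub>ty A a, ty C c\<^esub> dmat \<Psi> c b' \<cdot> L b' a"
        by (rule comp_mono_left[OF dist_right[OF P i(3,2) c] La[OF i(1,3)]])
      also have "\<dots> \<preceq>\<^bsub>ty A a, ty C c\<^esub> dmat \<Phi> c a"
        using i c by (intro Ll) auto
      finally show "dmat \<Psi> c b \<cdot> (hom B b b' \<cdot> L b' a) \<preceq>\<^bsub>ty A a, ty C c\<^esub> dmat \<Phi> c a" .
    qed
  qed (use s La in \<open>auto simp: \<Lambda>_def\<close>)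
  \<comment> \<open>The universal property of the entrywise residual, from which it is the greatest
    solution.\<close>
  have le: "dcomp Q \<Psi> \<Xi> \<sqsubseteq>\<^bsub>Hom (Dist Q) A C\<^esub> \<Phi> \<longleftrightarrow> \<Xi> \<sqsubseteq>\<^bsub>Hom (Dist Q) A B\<^esub> \<Lambda>"
    if "is_dist A B \<Xi>" for \<Xi>
  proof -
    have "dmat \<Xi> b a \<preceq>\<^bsub>ty A a, ty B b\<^esub> dmat \<Lambda> b a \<longleftrightarrow>
      (\<forall>c\<in>obj C. dmat \<Psi> c b \<cdot> dmat \<Xi> b a \<preceq>\<^bsub>ty A a, ty C c\<^esub> dmat \<Phi> c a)"
      if "a \<in> obj A" "b \<in> obj B" for a b
      using that Liff[OF that] dist_arr[OF \<open>is_dist A B \<Xi>\<close> that] by (simp add: \<Lambda>_def)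
    then show ?thesis
      by (auto simp: dcomp_le_iff[OF that P F] dist_le_iff[OF that d])
  qed
  let ?G = "{\<Xi> \<in> distributors Q A B. dcomp Q \<Psi> \<Xi> \<sqsubseteq>\<^bsub>Hom (Dist Q) A C\<^esub> \<Phi>}"
  have "greatest (Hom (Dist Q) A B) \<Lambda> ?G"
    unfolding greatest_def
  proof (intro conjI ballI)
    show "\<Lambda> \<in> ?G" 
      using d le[OF d] by (auto simp: is_dist_def dist_le_iff[OF d d] intro: arr_le_refl dist_arr[OF d])
  qed (use s le in \<open>auto simp: Dist_def is_dist_def\<close>)
  \<comment> \<open>Uniqueness, as demanded by the \<open>THE\<close> in \<open>lift\<close>, comes
    from antisymmetry in every entry.\<close>
  moreover have "\<Xi> = \<Lambda>" if g: "greatest (Hom (Dist Q) A B) \<Xi> ?G" for \<Xi>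
  proof -
    have x: "is_dist A B \<Xi>" using g s by (auto simp: greatest_def is_dist_def)
    then have "\<Xi> \<sqsubseteq>\<^bsub>Hom (Dist Q) A B\<^esub> \<Lambda>" "\<Lambda> \<sqsubseteq>\<^bsub>Hom (Dist Q) A B\<^esub> \<Xi>"
      using g calculation by (auto simp: greatest_def)
    then show ?thesis
      unfolding dist_le_iff[OF x d] dist_le_iff[OF d x]
      by (intro dist_eqI[OF x d]) (meson arr_le_antisym)
  qed
  ultimately have "lift Q \<Psi> \<Phi> = \<Lambda>"
    unfolding lift_def s by blast
  then show "is_dist A B (lift Q \<Psi> \<Phi>)"
    and "\<And>a b h. \<lbrakk>a \<in> obj A; b \<in> obj B; arr (ty A a) (ty B b) h\<rbrakk> \<Longrightarrow>
      h \<preceq>\<^bsub>ty A a, ty B b\<^esub> dmat (lift Q \<Psi> \<Phi>) b a \<longleftrightarrow>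
      (\<forall>c\<in>obj C. dmat \<Psi> c b \<cdot> h \<preceq>\<^bsub>ty A a, ty C c\<^esub> dmat \<Phi> c a)"
    using d Liff by (auto simp: \<Lambda>_def)
qed

section \<open>Functors and presheaves\<close>

definition is_functor :: "'u qcat \<Rightarrow> 'u qcat \<Rightarrow> 'u qfun \<Rightarrow> bool" where
  "is_functor A B F \<longleftrightarrow> is_qcat Q A \<and> is_qcat Q B \<and> F \<in> functors Q A B"

lemma functor_qcat: "is_functor A B F \<Longrightarrow> is_qcat Q A" "is_functor A B F \<Longrightarrow> is_qcat Q B"
  by (auto simp: is_functor_def)

lemma functor_src: "is_functor A B F \<Longrightarrow> fsrc F = A" "is_functor A B F \<Longrightarrow> ftgt F = B"
  by (auto simp: is_functor_def functors_def)

lemma functor_obj: "is_functor A B F \<Longrightarrow> a \<in> obj A \<Longrightarrow> fmap F a \<in> obj B"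
  by (auto simp: is_functor_def functors_def)

lemma functor_ty: "is_functor A B F \<Longrightarrow> a \<in> obj A \<Longrightarrow> ty B (fmap F a) = ty A a"
  by (auto simp: is_functor_def functors_def)

lemma functor_hom_arr:
  assumes "is_functor A B F" "a \<in> obj A" "a' \<in> obj A"
  shows "arr (ty A a) (ty A a') (hom B (fmap F a') (fmap F a))"
  using qcat_hom[OF functor_qcat(2)[OF assms(1)] functor_obj[OF assms(1,2)] functor_obj[OF assms(1,3)]]
    functor_ty[OF assms(1)] assms(2,3) by simp

lemma functor_hom:
  assumes "is_functor A B F" "a \<in> obj A" "a' \<in> obj A"
  shows "hom A a' a \<preceq>\<^bsub>ty A a, ty A a'\<^esub> hom B (fmap F a') (fmap F a)"
  using functor_hom_arr[OF assms] qcat_hom[OF functor_qcat(1)[OF assms(1)] assms(2,3)] assms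
  by (simp add: arr_le_def is_functor_def functors_def)

lemma functorI:
  assumes "is_qcat Q A" "is_qcat Q B" "fsrc F = A" "ftgt F = B" "fmap F \<in> extensional (obj A)"
    "\<And>a. a \<in> obj A \<Longrightarrow> fmap F a \<in> obj B"
    "\<And>a. a \<in> obj A \<Longrightarrow> ty B (fmap F a) = ty A a"
    "\<And>a a'. a \<in> obj A \<Longrightarrow> a' \<in> obj A \<Longrightarrow>
      hom A a' a \<preceq>\<^bsub>ty A a, ty A a'\<^esub> hom B (fmap F a') (fmap F a)"
  shows "is_functor A B F"
  using assms unfolding is_functor_def functors_def by (auto simp: PiE_iff arr_le_def)

lemma functor_eqI:
  assumes "is_functor A B F" "is_functor A B G" "\<And>a. a \<in> obj A \<Longrightarrow> fmap F a = fmap G a"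
  shows "F = G"
proof -
  have "fmap F = fmap G"
    using assms unfolding is_functor_def functors_def
    by (auto intro!: extensionalityI[where A = "obj A"] simp: PiE_iff)
  then show ?thesis using functor_src[OF assms(1)] functor_src[OF assms(2)] by (cases F, cases G) auto
qed

lemma fid_functor: "is_qcat Q A \<Longrightarrow> is_functor A A (fid A)"
  by (rule functorI) (auto simp: fid_def intro: arr_le_refl qcat_hom)

lemma fid_map: "a \<in> obj A \<Longrightarrow> fmap (fid A) a = a"
  by (simp add: fid_def)

lemma fcomp_map: "is_functor A B F \<Longrightarrow> a \<in> obj A \<Longrightarrow> fmap (G \<circ>\<^sub>f F) a = fmap G (fmap F a)"
  using functor_src[of A B F] by (simp add: fcomp_def)

lemma fcomp_functor:
  assumes F: "is_functor A B F" and G: "is_functor B C G"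
  shows "is_functor A C (G \<circ>\<^sub>f F)"
proof (rule functorI)
  show "fmap (G \<circ>\<^sub>f F) \<in> extensional (obj A)"
    using functor_src[OF F] by (simp add: fcomp_def)
  show "hom A a' a \<preceq>\<^bsub>ty A a, ty A a'\<^esub> hom C (fmap (G \<circ>\<^sub>f F) a') (fmap (G \<circ>\<^sub>f F) a)"
    if i: "a \<in> obj A" "a' \<in> obj A" for a a'
    using arr_le_trans[OF functor_hom[OF F i]] functor_hom[OF G functor_obj[OF F i(1)] functor_obj[OF F i(2)]] i
    by (simp add: functor_ty[OF F] fcomp_map[OF F])
qed (use functor_src[OF F] functor_src[OF G] functor_qcat[OF F] functor_qcat[OF G] functor_obj[OF F]
    functor_obj[OF G] functor_ty[OF F] functor_ty[OF G] in \<open>auto simp: fcomp_def\<close>)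

section \<open>The underlying preorder of a Q-category\<close>

definition obj_le :: "'u qcat \<Rightarrow> 'u \<Rightarrow> 'u \<Rightarrow> bool" where
  "obj_le A a a' \<longleftrightarrow> is_qcat Q A \<and> a \<in> obj A \<and> a' \<in> obj A \<and> ty A a' = ty A a \<and>
    Ident Q (ty A a) \<preceq>\<^bsub>ty A a, ty A a\<^esub> hom A a a'"

lemma obj_le_refl: "is_qcat Q A \<Longrightarrow> a \<in> obj A \<Longrightarrow> obj_le A a a"
  by (simp add: obj_le_def qcat_ident)

text \<open>Insert the identity on the right, enlarge it to \<open>hom A a a'\<close>, and
  compose.\<close>

lemma obj_le_hom_right:
  assumes l: "obj_le A a a'" and x: "x \<in> obj A"
  shows "hom A x a \<preceq>\<^bsub>ty A a, ty A x\<^esub> hom A x a'"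
proof -
  have a: "is_qcat Q A" "a \<in> obj A" "a' \<in> obj A" "ty A a' = ty A a"
    "Ident Q (ty A a) \<preceq>\<^bsub>ty A a, ty A a\<^esub> hom A a a'"
    using l by (auto simp: obj_le_def)
  have "hom A x a = hom A x a \<cdot> Ident Q (ty A a)"
    using comp_ident(2)[OF qcat_hom[OF a(1,2) x]] by simp
  also have "\<dots> \<preceq>\<^bsub>ty A a, ty A x\<^esub> hom A x a \<cdot> hom A a a'"
    by (rule comp_mono_right[OF a(5) qcat_hom[OF a(1,2) x]])
  also have "\<dots> \<preceq>\<^bsub>ty A a, ty A x\<^esub> hom A x a'"
    using qcat_comp[OF a(1,3,2) x] a(4) by simp
  finally show ?thesis .
qed

lemma obj_le_hom_left:
  assumes l: "obj_le A a a'" and x: "x \<in> obj A"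
  shows "hom A a' x \<preceq>\<^bsub>ty A x, ty A a\<^esub> hom A a x"
proof -
  have a: "is_qcat Q A" "a \<in> obj A" "a' \<in> obj A" "ty A a' = ty A a"
    "Ident Q (ty A a) \<preceq>\<^bsub>ty A a, ty A a\<^esub> hom A a a'"
    using l by (auto simp: obj_le_def)
  have h: "arr (ty A x) (ty A a) (hom A a' x)" using qcat_hom[OF a(1) x a(3)] a(4) by simp
  have "hom A a' x = Ident Q (ty A a) \<cdot> hom A a' x"
    using comp_ident(1)[OF h] by simp
  also have "\<dots> \<preceq>\<^bsub>ty A x, ty A a\<^esub> hom A a a' \<cdot> hom A a' x"
    by (rule comp_mono_left[OF a(5) h])
  also have "\<dots> \<preceq>\<^bsub>ty A x, ty A a\<^esub> hom A a x"
    using qcat_comp[OF a(1) x a(3,2)] .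
  finally show ?thesis .
qed

text \<open>From right to left, put \<open>x = a\<close> and use the identity below
  \<open>hom A a a\<close>.\<close>

lemma obj_le_iff_hom:
  assumes "is_qcat Q A" "a \<in> obj A" "a' \<in> obj A" "ty A a' = ty A a"
  shows "obj_le A a a' \<longleftrightarrow> (\<forall>x\<in>obj A. hom A x a \<preceq>\<^bsub>ty A a, ty A x\<^esub> hom A x a')"
  using obj_le_hom_right[of A a a'] arr_le_trans[OF qcat_ident[OF assms(1,2)]] assms by (auto simp: obj_le_def)

lemma obj_le_trans [trans]: "obj_le A a b \<Longrightarrow> obj_le A b c \<Longrightarrow> obj_le A a c"
  using arr_le_trans[of "Ident Q (ty A a)" "ty A a" "ty A a" "hom A a b" "hom A a c"] obj_le_hom_right[of A b c a]
  by (auto simp: obj_le_def)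

definition obj_iso :: "'u qcat \<Rightarrow> 'u \<Rightarrow> 'u \<Rightarrow> bool" where
  "obj_iso A a a' \<longleftrightarrow> obj_le A a a' \<and> obj_le A a' a"

lemma obj_iso_refl: "is_qcat Q A \<Longrightarrow> a \<in> obj A \<Longrightarrow> obj_iso A a a"
  by (simp add: obj_iso_def obj_le_refl)

lemma obj_iso_sym: "obj_iso A a a' \<Longrightarrow> obj_iso A a' a"
  by (auto simp: obj_iso_def)

lemma obj_iso_trans: "obj_iso A a b \<Longrightarrow> obj_iso A b c \<Longrightarrow> obj_iso A a c"
  by (auto simp: obj_iso_def intro: obj_le_trans)

lemma obj_iso_obj: "obj_iso A a a' \<Longrightarrow> a \<in> obj A" "obj_iso A a a' \<Longrightarrow> a' \<in> obj A"
  "obj_iso A a a' \<Longrightarrow> ty A a' = ty A a"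
  unfolding obj_iso_def obj_le_def by blast+

lemma obj_iso_hom_left: "obj_iso A a a' \<Longrightarrow> x \<in> obj A \<Longrightarrow> hom A a x = hom A a' x"
  using obj_le_hom_left[of A a a' x] obj_le_hom_left[of A a' a x] obj_iso_obj(3)[of A a a']
  by (metis arr_le_antisym obj_iso_def)

lemma obj_iso_hom_right: "obj_iso A a a' \<Longrightarrow> x \<in> obj A \<Longrightarrow> hom A x a = hom A x a'"
  using obj_le_hom_right[of A a a' x] obj_le_hom_right[of A a' a x] obj_iso_obj(3)[of A a a']
  by (metis arr_le_antisym obj_iso_def)

text \<open>At \<open>x = a\<close> and \<open>x = a'\<close> the hypothesis turns the two
  reflexivity inequalities into the two comparisons that are sought.\<close>

lemma obj_isoI_left:
  assumes "is_qcat Q A" "a \<in> obj A" "a' \<in> obj A" "ty A a' = ty A a"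
    "\<And>x. x \<in> obj A \<Longrightarrow> hom A a x = hom A a' x"
  shows "obj_iso A a a'"
  using qcat_ident[OF assms(1,2)] qcat_ident[OF assms(1,3)] assms by (simp add: obj_iso_def obj_le_def)

lemma functor_obj_le: "is_functor A B F \<Longrightarrow> obj_le A a a' \<Longrightarrow> obj_le B (fmap F a) (fmap F a')"
  using functor_qcat(2)[of A B F] functor_obj[of A B F] functor_ty[of A B F]
    arr_le_trans[of "Ident Q (ty A a)" "ty A a" "ty A a" "hom A a a'"] functor_hom[of A B F a' a]
  by (auto simp: obj_le_def)

lemma functor_obj_iso: "is_functor A B F \<Longrightarrow> obj_iso A a a' \<Longrightarrow> obj_iso B (fmap F a) (fmap F a')"
  by (simp add: obj_iso_def functor_obj_le)

section \<open>Graphs and cographs of functors\<close>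

lemma graph_dist: "is_functor A B F \<Longrightarrow> is_dist A B (graph F)"
proof (rule distI[where M = "\<lambda>b a. hom B b (fmap F a)"])
  assume F: "is_functor A B F"
  note q = functor_qcat[OF F] and s = functor_src[OF F] and o = functor_obj[OF F] and t = functor_ty[OF F]
  show "is_qcat Q A" "is_qcat Q B" "dsrc (graph F) = A" "dtgt (graph F) = B"
    "dmat (graph F) = (\<lambda>b\<in>obj B. \<lambda>a\<in>obj A. hom B b (fmap F a))"
    using q s by (auto simp: graph_def)
  show h: "arr (ty A a) (ty B b) (hom B b (fmap F a))" if "a \<in> obj A" "b \<in> obj B" for a b
    using qcat_hom[OF q(2) o[OF that(1)] that(2)] t[OF that(1)] by simp
  show "hom B b (fmap F a') \<cdot> hom A a' a \<preceq>\<^bsub>ty A a,ty B b\<^esub> hom B b (fmap F a)"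
    if i: "a \<in> obj A" "a' \<in> obj A" "b \<in> obj B" for a a' b
    using arr_le_trans[OF comp_mono_right[OF functor_hom[OF F i(1,2)] h[OF i(2,3)]]]
      qcat_comp[OF q(2) o[OF i(1)] o[OF i(2)] i(3)] t[OF i(1)] by simp
  show "hom B b b' \<cdot> hom B b' (fmap F a) \<preceq>\<^bsub>ty A a,ty B b\<^esub> hom B b (fmap F a)"
    if i: "a \<in> obj A" "b \<in> obj B" "b' \<in> obj B" for a b b'
    using qcat_comp[OF q(2) o[OF i(1)] i(3,2)] t[OF i(1)] by simp
qed

lemma graph_dmat: "is_functor A B F \<Longrightarrow> a \<in> obj A \<Longrightarrow> b \<in> obj B \<Longrightarrow> dmat (graph F) b a = hom B b (fmap F a)"
  using functor_src[of A B F] by (simp add: graph_def)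

lemma cograph_dist: "is_functor A B F \<Longrightarrow> is_dist B A (cograph F)"
proof (rule distI[where M = "\<lambda>a b. hom B (fmap F a) b"])
  assume F: "is_functor A B F"
  note q = functor_qcat[OF F] and s = functor_src[OF F] and o = functor_obj[OF F] and t = functor_ty[OF F]
  show "is_qcat Q A" "is_qcat Q B" "dsrc (cograph F) = B" "dtgt (cograph F) = A"
    "dmat (cograph F) = (\<lambda>a\<in>obj A. \<lambda>b\<in>obj B. hom B (fmap F a) b)"
    using q s by (auto simp: cograph_def)
  show h: "arr (ty B b) (ty A a) (hom B (fmap F a) b)" if "b \<in> obj B" "a \<in> obj A" for a b
    using qcat_hom[OF q(2) that(1) o[OF that(2)]] t[OF that(2)] by simp
  show "hom B (fmap F a) b' \<cdot> hom B b' b \<preceq>\<^bsub>ty B b,ty A a\<^esub> hom B (fmap F a) b"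
    if i: "b \<in> obj B" "b' \<in> obj B" "a \<in> obj A" for a b b'
    using qcat_comp[OF q(2) i(1,2) o[OF i(3)]] t[OF i(3)] by simp
  show "hom A a a' \<cdot> hom B (fmap F a') b \<preceq>\<^bsub>ty B b,ty A a\<^esub> hom B (fmap F a) b"
    if i: "b \<in> obj B" "a \<in> obj A" "a' \<in> obj A" for a a' b
    using arr_le_trans[OF comp_mono_left[OF functor_hom[OF F i(3,2)] h[OF i(1,3)]]]
      qcat_comp[OF q(2) i(1) o[OF i(3)] o[OF i(2)]] t[OF i(2)] by simp
qed

lemma cograph_dmat: "is_functor A B F \<Longrightarrow> a \<in> obj A \<Longrightarrow> b \<in> obj B \<Longrightarrow> dmat (cograph F) a b = hom B (fmap F a) b"
  using functor_src[of A B F] by (simp add: cograph_def)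

text \<open>Comparing the columns \<open>B(-, F a)\<close> and \<open>B(-, G a)\<close> of the
  graphs is comparing the objects, by \<open>obj_le_iff_hom\<close>. With it, every equation of
  functors up to isomorphism is checked at single objects.\<close>

lemma fle_iff:
  assumes F: "is_functor A B F" and G: "is_functor A B G"
  shows "fle Q F G \<longleftrightarrow> (\<forall>a\<in>obj A. obj_le B (fmap F a) (fmap G a))"
  using functor_src[OF F] functor_src[OF G] functor_qcat[OF F] functor_obj[OF F] functor_obj[OF G]
    functor_ty[OF F] functor_ty[OF G]
  by (auto simp: fle_def dist_le_iff[OF graph_dist[OF F] graph_dist[OF G]] obj_le_iff_hom
      graph_dmat[OF F] graph_dmat[OF G])

lemma fiso_iff:
  assumes F: "is_functor A B F" and G: "is_functor A B G"
  shows "fiso Q F G \<longleftrightarrow> (\<forall>a\<in>obj A. obj_iso B (fmap F a) (fmap G a))"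
  by (auto simp: fiso_def fle_iff[OF F G] fle_iff[OF G F] obj_iso_def)

section \<open>One-object categories and presheaves\<close>

lemma star_simps: "obj (star Q X) = {pt}" "ty (star Q X) pt = X" "hom (star Q X) pt pt = Ident Q X"
  by (simp_all add: star_def)

lemma star_qcat:
  assumes "X \<in> Ob Q"
  shows "is_qcat Q (star Q X)"
  by (rule qcatI[where h = "\<lambda>_ _. Ident Q X"])
    (use assms ident_arr[OF assms] comp_ident[OF ident_arr[OF assms]] in
     \<open>auto simp: star_def small_single intro: arr_le_refl\<close>)

definition is_psh :: "'u qcat \<Rightarrow> 'u dist \<Rightarrow> bool" where
  "is_psh A \<phi> \<longleftrightarrow> is_qcat Q A \<and> \<phi> \<in> presheaves_on Q A"

lemma psh_qcat: "is_psh A \<phi> \<Longrightarrow> is_qcat Q A"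
  by (simp add: is_psh_def)

lemma is_psh_iff: "is_psh A \<phi> \<longleftrightarrow> ptype \<phi> \<in> Ob Q \<and> is_dist (star Q (ptype \<phi>)) A \<phi>"
proof -
  have "ptype \<phi> = X" if "\<phi> \<in> distributors Q (star Q X) A" for X
    using that by (simp add: distributors_def ptype_def star_simps)
  then show ?thesis
    unfolding is_psh_def is_dist_def presheaves_on_def using star_qcat by auto
qed

lemma psh_dist: "is_psh A \<phi> \<Longrightarrow> is_dist (star Q (ptype \<phi>)) A \<phi>"
  by (simp add: is_psh_iff)

lemma psh_Ob: "is_psh A \<phi> \<Longrightarrow> ptype \<phi> \<in> Ob Q"
  by (simp add: is_psh_iff)

lemma psh_arr: "is_psh A \<phi> \<Longrightarrow> a \<in> obj A \<Longrightarrow> arr (ptype \<phi>) (ty A a) (dmat \<phi> a pt)"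
  using dist_arr[OF psh_dist, of A \<phi> pt a] by (simp add: star_simps)

lemma psh_hom: "is_psh A \<phi> \<Longrightarrow> a \<in> obj A \<Longrightarrow> a' \<in> obj A \<Longrightarrow>
    hom A a a' \<cdot> dmat \<phi> a' pt \<preceq>\<^bsub>ptype \<phi>, ty A a\<^esub> dmat \<phi> a pt"
  using dist_left[OF psh_dist, of A \<phi> pt a a'] by (simp add: star_simps)

lemma psh_tgt: "is_psh A \<phi> \<Longrightarrow> dtgt \<phi> = A" "is_psh A \<phi> \<Longrightarrow> dsrc \<phi> = star Q (ptype \<phi>)"
  using dist_src[OF psh_dist, of A \<phi>] by auto

lemma psh_eqI:
  assumes "is_psh A \<phi>" "is_psh A \<psi>" "ptype \<phi> = ptype \<psi>"
    "\<And>a. a \<in> obj A \<Longrightarrow> dmat \<phi> a pt = dmat \<psi> a pt"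
  shows "\<phi> = \<psi>"
  using assms(3,4) psh_dist[OF assms(2)]
  by (intro dist_eqI[OF psh_dist[OF assms(1)], of \<psi>]) (auto simp: star_simps)

text \<open>The only hom of the one-object source is an identity, so the right action is a unit law
  and only the left action remains to be checked.\<close>

lemma pshI:
  assumes "is_qcat Q A" "X \<in> Ob Q" "\<And>a. a \<in> obj A \<Longrightarrow> arr X (ty A a) (p a)"
    "\<And>a a'. a \<in> obj A \<Longrightarrow> a' \<in> obj A \<Longrightarrow> hom A a a' \<cdot> p a' \<preceq>\<^bsub>X, ty A a\<^esub> p a"
  shows "is_psh A \<lparr>dsrc = star Q X, dtgt = A, dmat = (\<lambda>a\<in>obj A. \<lambda>x\<in>{pt}. p a)\<rparr>"
proof -
  have "is_dist (star Q X) A \<lparr>dsrc = star Q X, dtgt = A, dmat = (\<lambda>a\<in>obj A. \<lambda>x\<in>{pt}. p a)\<rparr>"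
    using assms by (intro distI[where M = "\<lambda>a x. p a"])
      (auto simp: star_simps comp_ident(2)[OF assms(3)] intro: star_qcat arr_le_refl)
  then show ?thesis using assms(2) by (simp add: is_psh_iff ptype_def star_simps)
qed

lemma psh_dcomp:
  assumes p: "is_psh A \<phi>" and F: "is_dist A B \<Phi>"
  shows "is_psh B (dcomp Q \<Phi> \<phi>)" "ptype (dcomp Q \<Phi> \<phi>) = ptype \<phi>"
    "\<And>b. b \<in> obj B \<Longrightarrow> dmat (dcomp Q \<Phi> \<phi>) b pt =
      join_of (ptype \<phi>) (ty B b) (\<lambda>a. dmat \<Phi> b a \<cdot> dmat \<phi> a pt) (obj A)"
proof -
  show t: "ptype (dcomp Q \<Phi> \<phi>) = ptype \<phi>"
    by (simp add: ptype_def dcomp_def)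
  show "is_psh B (dcomp Q \<Phi> \<phi>)"
    using dcomp_dist[OF psh_dist[OF p] F] psh_Ob[OF p] by (simp add: is_psh_iff t)
  show "\<And>b. b \<in> obj B \<Longrightarrow> dmat (dcomp Q \<Phi> \<phi>) b pt =
      join_of (ptype \<phi>) (ty B b) (\<lambda>a. dmat \<Phi> b a \<cdot> dmat \<phi> a pt) (obj A)"
    using dcomp_dmat[OF psh_dist[OF p] F, of pt] by (simp add: star_simps)
qed

section \<open>Coding of presheaves in the universe\<close>

lemma code_inject:
  assumes "is_psh A \<phi>" "is_psh A \<psi>" "code \<phi> = code \<psi>"
  shows "\<phi> = \<psi>"
proof -
  let ?g = "\<lambda>\<chi>. (\<lambda>a. vpair a (dmat \<chi> a pt)) ` obj A"
  have sm: "small (?g \<chi>)" for \<chi>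
    using psh_qcat[OF assms(1)] by (auto simp: is_qcat_def intro: small_image)
  have e: "ptype \<phi> = ptype \<psi>" "?g \<phi> = ?g \<psi>"
    using assms(3) vset_inject[OF sm sm, of \<phi> \<psi>]
    by (simp_all add: code_def vpair_inject psh_tgt[OF assms(1)] psh_tgt[OF assms(2)])
  have "dmat \<phi> a pt = dmat \<psi> a pt" if "a \<in> obj A" for a
  proof -
    have "vpair a (dmat \<phi> a pt) \<in> ?g \<psi>" using e(2) that by blast
    then show ?thesis by (auto simp: vpair_inject)
  qed
  then show ?thesis by (rule psh_eqI[OF assms(1,2) e(1)])
qed

lemma decode_code: "is_psh A \<phi> \<Longrightarrow> decode Q A (code \<phi>) = \<phi>"
  unfolding decode_def
  by (rule inv_into_f_f) (auto simp: inj_on_def is_psh_def intro: code_inject)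

text \<open>All values of presheaves lie in one set, the union of all homs of \<open>Q\<close>; so
  their graphs are subsets of the fixed set \<open>?P\<close> and their codes are pairs in
  \<open>?R\<close>. Here the smallness of \<open>Q\<close> enters.\<close>

lemma small_codes:
  assumes "is_qcat Q A"
  shows "small (code ` presheaves_on Q A)"
proof -
  let ?M = "\<Union>X\<in>Ob Q. \<Union>Y\<in>Ob Q. carrier (Hom Q X Y)"
  let ?P = "{vpair a f | a f. a \<in> obj A \<and> f \<in> ?M}"
  let ?R = "{vpair X g | X g. X \<in> Ob Q \<and> g \<in> vset ` {T. T \<subseteq> ?P}}"
  have "small ?R"
    using assms by (intro small_vpairs small_subsets small_Union small_Ob small_Hom) (auto simp: is_qcat_def)
  moreover have "code \<phi> \<in> ?R" if "is_psh A \<phi>" for \<phi>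
    using psh_arr[OF that] psh_Ob[OF that] unfolding code_def arr_def psh_tgt[OF that]
    by (auto simp: vpair_inject) blast
  ultimately show ?thesis
    using assms by (auto simp: is_psh_def intro: small_subset)
qed

section \<open>Presheaf categories and weighted colimits\<close>

abbreviation val :: "'u qcat \<Rightarrow> 'u \<Rightarrow> 'u \<Rightarrow> 'u" where
  "val A x a \<equiv> dmat (decode Q A x) a pt"

abbreviation ptp :: "'u qcat \<Rightarrow> 'u \<Rightarrow> 'u" where
  "ptp A x \<equiv> ptype (decode Q A x)"

lemma P0_obj_iff: "is_qcat Q A \<Longrightarrow> x \<in> obj (P0 Q A) \<longleftrightarrow> (\<exists>\<phi>. is_psh A \<phi> \<and> x = code \<phi>)"
proof -
  assume A: "is_qcat Q A"
  then have "{\<phi> \<in> presheaves_on Q A. \<phi> \<in> presheaves Q} = presheaves_on Q A"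
    by (auto simp: presheaves_def Ob_Dist)
  then show ?thesis using A by (auto simp: P0_def presheaf_cat_def Let_def is_psh_def)
qed

lemma code_obj: "is_psh A \<phi> \<Longrightarrow> code \<phi> \<in> obj (P0 Q A)"
  using P0_obj_iff psh_qcat by blast

lemma
  assumes "is_qcat Q A" "x \<in> obj (P0 Q A)"
  shows decode_psh: "is_psh A (decode Q A x)" and code_decode: "code (decode Q A x) = x"
  using assms by (auto simp: P0_obj_iff decode_code)

lemma pc_obj_iff: "is_qcat Q A \<Longrightarrow> x \<in> obj (presheaf_cat Q C A) \<longleftrightarrow> x \<in> obj (P0 Q A) \<and> decode Q A x \<in> C"
proof -
  assume A: "is_qcat Q A"
  have "x \<in> obj (presheaf_cat Q C A) \<longleftrightarrow> (\<exists>\<phi>. is_psh A \<phi> \<and> \<phi> \<in> C \<and> x = code \<phi>)"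
    using A by (auto simp: presheaf_cat_def Let_def is_psh_def)
  then show ?thesis using P0_obj_iff[OF A] decode_code by metis
qed

lemma pc_ty: "x \<in> obj (presheaf_cat Q C A) \<Longrightarrow> ty (presheaf_cat Q C A) x = ptp A x"
  by (simp add: presheaf_cat_def Let_def)

lemma P0_ty: "x \<in> obj (P0 Q A) \<Longrightarrow> ty (P0 Q A) x = ptp A x"
  unfolding P0_def by (rule pc_ty)

lemma pc_hom:
  assumes "is_qcat Q A" "x \<in> obj (presheaf_cat Q C A)" "y \<in> obj (presheaf_cat Q C A)"
  shows "hom (presheaf_cat Q C A) y x = hom (P0 Q A) y x"
proof -
  have "x \<in> obj (P0 Q A)" "y \<in> obj (P0 Q A)" using assms by (auto simp: pc_obj_iff)
  then show ?thesis using assms by (simp add: presheaf_cat_def Let_def P0_def)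
qed

lemma P0_eqI:
  assumes "is_qcat Q A" "x \<in> obj (P0 Q A)" "y \<in> obj (P0 Q A)" "ptp A x = ptp A y"
    "\<And>a. a \<in> obj A \<Longrightarrow> val A x a = val A y a"
  shows "x = y"
proof -
  have "decode Q A x = decode Q A y"
    by (rule psh_eqI[OF decode_psh[OF assms(1,2)] decode_psh[OF assms(1,3)] assms(4,5)])
  then show ?thesis using assms code_decode by metis
qed

text \<open>This is \<open>le_lift_iff\<close> at the single object of the one-object category.
  Arguments about homs of presheaf categories go through this description, in which liftings no
  longer occur.\<close>

lemma
  assumes A: "is_qcat Q A" and x: "x \<in> obj (P0 Q A)" and y: "y \<in> obj (P0 Q A)"
  shows P0_hom_arr: "arr (ptp A x) (ptp A y) (hom (P0 Q A) y x)"
    and P0_le_hom: "\<And>h. arr (ptp A x) (ptp A y) h \<Longrightarrow>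
      h \<preceq>\<^bsub>ptp A x, ptp A y\<^esub> hom (P0 Q A) y x \<longleftrightarrow>
      (\<forall>a\<in>obj A. val A y a \<cdot> h \<preceq>\<^bsub>ptp A x, ty A a\<^esub> val A x a)"
proof -
  have e: "hom (P0 Q A) y x = dmat (lift Q (decode Q A y) (decode Q A x)) pt pt"
    using x y by (simp add: presheaf_cat_def Let_def P0_def)
  note px = psh_dist[OF decode_psh[OF A x]] and py = psh_dist[OF decode_psh[OF A y]]
  show "arr (ptp A x) (ptp A y) (hom (P0 Q A) y x)"
    using dist_arr[OF lift_dist[OF py px], of pt pt] by (simp add: e star_simps)
  show "\<And>h. arr (ptp A x) (ptp A y) h \<Longrightarrow>
      h \<preceq>\<^bsub>ptp A x, ptp A y\<^esub> hom (P0 Q A) y x \<longleftrightarrow>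
      (\<forall>a\<in>obj A. val A y a \<cdot> h \<preceq>\<^bsub>ptp A x, ty A a\<^esub> val A x a)"
    using le_lift_iff[OF py px, of pt pt] by (simp add: e star_simps)
qed

lemma val_arr: "is_qcat Q A \<Longrightarrow> x \<in> obj (P0 Q A) \<Longrightarrow> a \<in> obj A \<Longrightarrow> arr (ptp A x) (ty A a) (val A x a)"
  using psh_arr[OF decode_psh] .

lemma ptp_Ob: "is_qcat Q A \<Longrightarrow> x \<in> obj (P0 Q A) \<Longrightarrow> ptp A x \<in> Ob Q"
  using psh_Ob[OF decode_psh] .

lemma val_comp_hom:
  assumes "is_qcat Q A" "x \<in> obj (P0 Q A)" "y \<in> obj (P0 Q A)" "a \<in> obj A"
  shows "val A y a \<cdot> hom (P0 Q A) y x \<preceq>\<^bsub>ptp A x, ty A a\<^esub> val A x a"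
  using P0_le_hom[OF assms(1-3)] P0_hom_arr[OF assms(1-3)] arr_le_refl assms(4) by blast

text \<open>Stated for an arbitrary class \<open>C\<close>, so that it covers \<open>P0 Q A\<close>
  and all its full subcategories together.\<close>

lemma pc_qcat:
  assumes A: "is_qcat Q A"
  shows "is_qcat Q (presheaf_cat Q C A)"
proof (rule qcatI[where h = "hom (P0 Q A)"])
  let ?P = "presheaf_cat Q C A"
  have o: "x \<in> obj (P0 Q A)" if "x \<in> obj ?P" for x using that A by (simp add: pc_obj_iff)
  show "small (obj ?P)"
    by (rule small_subset[OF small_codes[OF A]]) (auto simp: presheaf_cat_def Let_def)
  show "ty ?P \<in> extensional (obj ?P)" by (simp add: presheaf_cat_def Let_def)
  have "hom ?P = (\<lambda>a'\<in>obj ?P. \<lambda>a\<in>obj ?P. hom ?P a' a)"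
    by (simp add: presheaf_cat_def Let_def fun_eq_iff)
  also have "\<dots> = (\<lambda>a'\<in>obj ?P. \<lambda>a\<in>obj ?P. hom (P0 Q A) a' a)"
    using pc_hom[OF A] by (auto simp: fun_eq_iff)
  finally show "hom ?P = \<dots>" .
  show "ty ?P x \<in> Ob Q" if "x \<in> obj ?P" for x
    using that o ptp_Ob[OF A] by (simp add: pc_ty)
  show "arr (ty ?P x) (ty ?P y) (hom (P0 Q A) y x)" if "x \<in> obj ?P" "y \<in> obj ?P" for x y
    using that o P0_hom_arr[OF A] by (simp add: pc_ty)
  show "Ident Q (ty ?P x) \<preceq>\<^bsub>ty ?P x,ty ?P x\<^esub> hom (P0 Q A) x x" if x: "x \<in> obj ?P" for x
    using val_arr[OF A o[OF x]] 
    by (simp add: pc_ty[OF x] P0_le_hom[OF A] o[OF x] ident_arr ptp_Ob[OF A] arr_le_refl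
        comp_ident(2)[OF val_arr[OF A o[OF x]]])
  show "hom (P0 Q A) z y \<cdot> hom (P0 Q A) y x \<preceq>\<^bsub>ty ?P x,ty ?P z\<^esub> hom (P0 Q A) z x"
    if i: "x \<in> obj ?P" "y \<in> obj ?P" "z \<in> obj ?P" for x y z
  proof -
    note o3 = o[OF i(1)] o[OF i(2)] o[OF i(3)]
    note h = P0_hom_arr[OF A o3(1,2)] P0_hom_arr[OF A o3(2,3)]
    have "val A z a \<cdot> (hom (P0 Q A) z y \<cdot> hom (P0 Q A) y x) \<preceq>\<^bsub>ptp A x, ty A a\<^esub> val A x a"
      if a: "a \<in> obj A" for a
    proof -
      have "val A z a \<cdot> (hom (P0 Q A) z y \<cdot> hom (P0 Q A) y x) = val A z a \<cdot> hom (P0 Q A) z y \<cdot> hom (P0 Q A) y x"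
        using assoc[OF h val_arr[OF A o3(3) a]] by simp
      also have "\<dots> \<preceq>\<^bsub>ptp A x, ty A a\<^esub> val A y a \<cdot> hom (P0 Q A) y x"
        by (rule comp_mono_left[OF val_comp_hom[OF A o3(2,3) a] h(1)])
      also have "\<dots> \<preceq>\<^bsub>ptp A x, ty A a\<^esub> val A x a"
        by (rule val_comp_hom[OF A o3(1,2) a])
      finally show ?thesis .
    qed
    then show ?thesis
      using P0_le_hom[OF A o3(1,3) comp_arr[OF h]] i by (simp add: pc_ty)
  qed
qed

lemma P0_qcat: "is_qcat Q A \<Longrightarrow> is_qcat Q (P0 Q A)"
  unfolding P0_def by (rule pc_qcat)

text \<open>This is \<open>P0_le_hom\<close> with an identity for \<open>h\<close>.\<close>

lemma P0_obj_le_iff: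
  assumes A: "is_qcat Q A" and x: "x \<in> obj (P0 Q A)" and y: "y \<in> obj (P0 Q A)" and t: "ptp A x = ptp A y"
  shows "obj_le (P0 Q A) x y \<longleftrightarrow> (\<forall>a\<in>obj A. val A x a \<preceq>\<^bsub>ptp A x, ty A a\<^esub> val A y a)"
  using P0_le_hom[OF A y x, of "Ident Q (ptp A x)"] val_arr[OF A x] ident_arr[OF ptp_Ob[OF A x]] x y t P0_qcat[OF A]
  by (auto simp: obj_le_def P0_ty comp_ident(2)[OF val_arr[OF A x], unfolded t])

lemma pc_obj_le:
  assumes "is_qcat Q A" "x \<in> obj (presheaf_cat Q C A)" "y \<in> obj (presheaf_cat Q C A)"
  shows "obj_le (presheaf_cat Q C A) x y \<longleftrightarrow> obj_le (P0 Q A) x y"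
  using assms pc_qcat[OF assms(1)] P0_qcat[OF assms(1)]
  by (simp add: obj_le_def pc_hom pc_ty P0_ty pc_obj_iff)

text \<open>The order of \<open>P0 Q A\<close> is entrywise, the homs of \<open>Q\<close> are
  antisymmetric, and a code determines its presheaf.\<close>

lemma P0_iso_eq:
  assumes A: "is_qcat Q A" and i: "obj_iso (P0 Q A) x y"
  shows "x = y"
proof -
  have o: "x \<in> obj (P0 Q A)" "y \<in> obj (P0 Q A)" using i by (auto simp: obj_iso_obj)
  then have t: "ptp A x = ptp A y" using obj_iso_obj(3)[OF i] by (simp add: P0_ty)
  show ?thesis
    using i P0_obj_le_iff[OF A o t] P0_obj_le_iff[OF A o(2,1) t[symmetric]] t
    by (intro P0_eqI[OF A o t]) (metis arr_le_antisym obj_iso_def)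
qed

lemma pc_iso_eq:
  assumes A: "is_qcat Q A" and i: "obj_iso (presheaf_cat Q C A) x y"
  shows "x = y"
  using i pc_obj_le[OF A] obj_iso_obj(1,2)[OF i] P0_iso_eq[OF A] unfolding obj_iso_def by blast

text \<open>The equality of distributors in \<open>is_colim\<close> is tested on the arrows below
  its entries, which \<open>le_lift_iff\<close> describes; \<open>arr_eqI\<close> leads back to
  equality. From here on colimits are treated without liftings.\<close>

lemma is_colim_iff:
  assumes p: "is_psh A \<phi>" and F: "is_functor A B F"
  shows "is_colim Q \<phi> F c \<longleftrightarrow> c \<in> obj B \<and> ty B c = ptype \<phi> \<and>
    (\<forall>b\<in>obj B. \<forall>h. arr (ty B b) (ptype \<phi>) h \<longrightarrow>
      (h \<preceq>\<^bsub>ty B b, ptype \<phi>\<^esub> hom B c b \<longleftrightarrow>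
       (\<forall>a\<in>obj A. dmat \<phi> a pt \<cdot> h \<preceq>\<^bsub>ty B b, ty A a\<^esub> hom B (fmap F a) b)))"
proof (cases "c \<in> obj B \<and> ty B c = ptype \<phi>")
  case False
  then show ?thesis using functor_src[OF F] by (auto simp: is_colim_def)
next
  case c: True
  note B = functor_qcat(2)[OF F]
  note d = psh_dist[OF p] cograph_dist[OF F]
  note l = lift_dist[OF d]
  have r: "is_dist B (star Q (ptype \<phi>)) (corepresentable Q B c)"
    using c B star_qcat[OF psh_Ob[OF p]] qcat_hom[OF B _ conjunct1[OF c]] qcat_comp[OF B _ _ conjunct1[OF c]]
    by (intro distI[where M = "\<lambda>x b. hom B c b"])
      (auto simp: corepresentable_def star_simps 
        comp_ident(1)[OF qcat_hom[OF B _ conjunct1[OF c]], unfolded conjunct2[OF c]] intro: arr_le_refl)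
  have "corepresentable Q B c = lift Q \<phi> (cograph F) \<longleftrightarrow>
    (\<forall>b\<in>obj B. hom B c b = dmat (lift Q \<phi> (cograph F)) pt b)"
  proof -
    have "dmat (corepresentable Q B c) pt b = hom B c b" if "b \<in> obj B" for b
      using that by (simp add: corepresentable_def)
    then show ?thesis using dist_eqI[OF r l] by (metis singletonD star_simps(1))
  qed
  moreover have "hom B c b = dmat (lift Q \<phi> (cograph F)) pt b \<longleftrightarrow> (\<forall>h. arr (ty B b) (ptype \<phi>) h \<longrightarrow>
      (h \<preceq>\<^bsub>ty B b, ptype \<phi>\<^esub> hom B c b \<longleftrightarrow>
       (\<forall>a\<in>obj A. dmat \<phi> a pt \<cdot> h \<preceq>\<^bsub>ty B b, ty A a\<^esub> hom B (fmap F a) b)))" (is "?l \<longleftrightarrow> ?r")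
    if b: "b \<in> obj B" for b
  proof -
    have iff: "h \<preceq>\<^bsub>ty B b, ptype \<phi>\<^esub> dmat (lift Q \<phi> (cograph F)) pt b \<longleftrightarrow>
       (\<forall>a\<in>obj A. dmat \<phi> a pt \<cdot> h \<preceq>\<^bsub>ty B b, ty A a\<^esub> hom B (fmap F a) b)"
      if "arr (ty B b) (ptype \<phi>) h" for h
      using le_lift_iff[OF d b, of pt h] that b by (simp add: star_simps cograph_dmat[OF F])
    have a: "arr (ty B b) (ptype \<phi>) (hom B c b)" "arr (ty B b) (ptype \<phi>) (dmat (lift Q \<phi> (cograph F)) pt b)"
      using qcat_hom[OF B b, of c] dist_arr[OF l b, of pt] c by (auto simp: star_simps)
    show ?thesis
    proof
      assume ?l then show ?r using iff by metis
    next
      assume ?r then show ?l using iff by (intro arr_eqI[OF a]) blast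
    qed
  qed
  ultimately show ?thesis using functor_src[OF F] c by (auto simp: is_colim_def)
qed

lemma
  assumes p: "is_psh A \<phi>" and F: "is_functor A B F" and c: "is_colim Q \<phi> F c"
  shows colim_obj: "c \<in> obj B" and colim_ty: "ty B c = ptype \<phi>"
    and colim_le_iff: "\<And>b h. b \<in> obj B \<Longrightarrow> arr (ty B b) (ptype \<phi>) h \<Longrightarrow>
      h \<preceq>\<^bsub>ty B b, ptype \<phi>\<^esub> hom B c b \<longleftrightarrow>
       (\<forall>a\<in>obj A. dmat \<phi> a pt \<cdot> h \<preceq>\<^bsub>ty B b, ty A a\<^esub> hom B (fmap F a) b)"
  using c by (auto simp: is_colim_iff[OF p F])

lemma colim_unique:
  assumes p: "is_psh A \<phi>" and F: "is_functor A B F" and c: "is_colim Q \<phi> F c" "is_colim Q \<phi> F c'"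
  shows "obj_iso B c c'"
proof (rule obj_isoI_left)
  note B = functor_qcat(2)[OF F]
  note co = colim_obj[OF p F c(1)] colim_obj[OF p F c(2)] colim_ty[OF p F c(1)] colim_ty[OF p F c(2)]
  show "is_qcat Q B" "c \<in> obj B" "c' \<in> obj B" "ty B c' = ty B c"
    using B co by auto
  fix b assume b: "b \<in> obj B"
  show "hom B c b = hom B c' b"
    by (rule arr_eqI[of "ty B b" "ptype \<phi>"])
      (use qcat_hom[OF B b, of c] qcat_hom[OF B b, of c'] co in \<open>auto simp: colim_le_iff[OF p F c(1) b] colim_le_iff[OF p F c(2) b]\<close>)
qed

lemma colim_iso:
  assumes p: "is_psh A \<phi>" and F: "is_functor A B F" and c: "is_colim Q \<phi> F c" and i: "obj_iso B c c'"
  shows "is_colim Q \<phi> F c'"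
  using c obj_iso_hom_left[OF i] obj_iso_obj[OF i] by (auto simp: is_colim_iff[OF p F])

text \<open>The condition on \<open>fmap J b\<close> as a colimit, tested only at objects in the
  image of \<open>J\<close>, is word for word the condition on \<open>b\<close>, because
  \<open>J\<close> preserves homs.\<close>

lemma colim_reflect:
  assumes p: "is_psh A \<phi>" and F: "is_functor A B F" and J: "is_functor B D J" and ff: "fully_faithful J"
    and b: "b \<in> obj B" and c: "is_colim Q \<phi> (J \<circ>\<^sub>f F) (fmap J b)"
  shows "is_colim Q \<phi> F b"
proof -
  have h: "hom D (fmap J y) (fmap J x) = hom B y x" if "x \<in> obj B" "y \<in> obj B" for x y
    using ff that functor_src[OF J] by (simp add: fully_faithful_def)
  note JF = fcomp_functor[OF F J]
  show ?thesis
    using c b functor_obj[OF J] functor_obj[OF F] h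
    by (auto simp: is_colim_iff[OF p JF] is_colim_iff[OF p F] fcomp_map[OF F] functor_ty[OF J])
      (metis functor_ty[OF J])+
qed

lemma functor_ptp:
  assumes "is_functor A (P0 Q B) G" "a \<in> obj A"
  shows "ptp B (fmap G a) = ty A a"
  using functor_ty[OF assms] functor_obj[OF assms] P0_ty by simp

text \<open>For the pointwise join \<open>J\<close>, that \<open>J b\<close> composed with
  \<open>h\<close> lies below \<open>y(b)\<close> for all \<open>b\<close> unfolds to
  \<open>G(a)(b) \<cdot> \<phi>(a) \<cdot> h\<close> below \<open>y(b)\<close> for all
  \<open>a\<close> and \<open>b\<close>; collecting over \<open>b\<close> first gives
  \<open>\<phi>(a) \<cdot> h\<close> below \<open>P(B)(G a, y)\<close>, the colimit condition. The
  second conclusion says that the \<open>SOME\<close> in \<open>colim\<close> has a witness.\<close>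

lemma
  assumes p: "is_psh A \<phi>" and G: "is_functor A (P0 Q B) G" and B: "is_qcat Q B"
  shows P0_colim_iff: "is_colim Q \<phi> G c \<longleftrightarrow> c \<in> obj (P0 Q B) \<and> ptp B c = ptype \<phi> \<and>
      (\<forall>b\<in>obj B. val B c b = join_of (ptype \<phi>) (ty B b) (\<lambda>a. val B (fmap G a) b \<cdot> dmat \<phi> a pt) (obj A))"
    and P0_colim: "is_colim Q \<phi> G (colim Q \<phi> G)"
proof -
  define J where "J b = join_of (ptype \<phi>) (ty B b) (\<lambda>a. val B (fmap G a) b \<cdot> dmat \<phi> a pt) (obj A)" for b
  note P = P0_qcat[OF B] and A = psh_qcat[OF p]
  note Go = functor_obj[OF G] and Gt = functor_ptp[OF G]
  note pa = psh_arr[OF p]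
  have va: "arr (ty A a) (ty B b) (val B (fmap G a) b)" if "a \<in> obj A" "b \<in> obj B" for a b
    using val_arr[OF B Go[OF that(1)] that(2)] Gt[OF that(1)] by simp
  have ca: "arr (ptype \<phi>) (ty B b) (val B (fmap G a) b \<cdot> dmat \<phi> a pt)" if "a \<in> obj A" "b \<in> obj B" for a b
    using that by (intro comp_arr[OF pa va])
  have Ja: "arr (ptype \<phi>) (ty B b) (J b)" if "b \<in> obj B" for b
    unfolding J_def using that psh_Ob[OF p] qcat_ty[OF B] ca by (intro join_arr) auto
  have Ju: "val B (fmap G a) b \<cdot> dmat \<phi> a pt \<preceq>\<^bsub>ptype \<phi>, ty B b\<^esub> J b" if "a \<in> obj A" "b \<in> obj B" for a b
    unfolding J_def using that join_upper[of "obj A" _ _ "\<lambda>a. val B (fmap G a) b \<cdot> dmat \<phi> a pt", OF ca] by auto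
  have "hom B b b' \<cdot> J b' \<preceq>\<^bsub>ptype \<phi>, ty B b\<^esub> J b" if b: "b \<in> obj B" "b' \<in> obj B" for b b'
  proof -
    have "hom B b b' \<cdot> (val B (fmap G a) b' \<cdot> dmat \<phi> a pt) \<preceq>\<^bsub>ptype \<phi>, ty B b\<^esub> J b" if a: "a \<in> obj A" for a
    proof -
      have "hom B b b' \<cdot> (val B (fmap G a) b' \<cdot> dmat \<phi> a pt) = hom B b b' \<cdot> val B (fmap G a) b' \<cdot> dmat \<phi> a pt"
        using assoc[OF pa va qcat_hom[OF B b(2,1)]] a b by simp
      also have "\<dots> \<preceq>\<^bsub>ptype \<phi>, ty B b\<^esub> val B (fmap G a) b \<cdot> dmat \<phi> a pt"
        using psh_hom[OF decode_psh[OF B Go[OF a]] b] Gt[OF a] by (intro comp_mono_left[OF _ pa[OF a]]) simp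
      also note Ju[OF a b(1)]
      finally show ?thesis .
    qed
    then show ?thesis
      unfolding J_def[of b']
      by (intro iffD2[OF comp_join_le_iff[OF ca[OF _ b(2)] qcat_hom[OF B b(2,1)] Ja[OF b(1)]]]) auto
  qed
  then have px: "is_psh B \<lparr>dsrc = star Q (ptype \<phi>), dtgt = B, dmat = (\<lambda>b\<in>obj B. \<lambda>x\<in>{pt}. J b)\<rparr>"
    using B psh_Ob[OF p] Ja by (intro pshI) auto
  define x where "x = code \<lparr>dsrc = star Q (ptype \<phi>), dtgt = B, dmat = (\<lambda>b\<in>obj B. \<lambda>x\<in>{pt}. J b)\<rparr>"
  have x: "x \<in> obj (P0 Q B)" "ptp B x = ptype \<phi>" "\<forall>b\<in>obj B. val B x b = J b"
    using code_obj[OF px] unfolding x_def decode_code[OF px]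
    by (simp_all add: ptype_def[of "\<lparr>dsrc = _, dtgt = _, dmat = _\<rparr>"] star_simps)
  have char: "is_colim Q \<phi> G c"
    if c: "c \<in> obj (P0 Q B)" "ptp B c = ptype \<phi>" "\<forall>b\<in>obj B. val B c b = J b" for c
    unfolding is_colim_iff[OF p G]
  proof (intro conjI ballI allI impI)
    show "c \<in> obj (P0 Q B)" "ty (P0 Q B) c = ptype \<phi>" using c by (auto simp: P0_ty)
    fix y h assume y: "y \<in> obj (P0 Q B)" and "arr (ty (P0 Q B) y) (ptype \<phi>) h"
    then have h: "arr (ptp B y) (ptype \<phi>) h" by (simp add: P0_ty)
    note yv = val_arr[OF B y]
    have "h \<preceq>\<^bsub>ptp B y,ptype \<phi>\<^esub> hom (P0 Q B) c y \<longleftrightarrow> (\<forall>b\<in>obj B. J b \<cdot> h \<preceq>\<^bsub>ptp B y, ty B b\<^esub> val B y b)"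
      using P0_le_hom[OF B y c(1)] h c by simp
    also have "\<dots> \<longleftrightarrow> (\<forall>b\<in>obj B. \<forall>a\<in>obj A. val B (fmap G a) b \<cdot> dmat \<phi> a pt \<cdot> h \<preceq>\<^bsub>ptp B y, ty B b\<^esub> val B y b)"
      unfolding J_def using join_comp_le_iff[OF ca h yv, where I = "obj A"] by auto
    also have "\<dots> \<longleftrightarrow> (\<forall>a\<in>obj A. \<forall>b\<in>obj B. val B (fmap G a) b \<cdot> (dmat \<phi> a pt \<cdot> h) \<preceq>\<^bsub>ptp B y, ty B b\<^esub> val B y b)"
      using assoc[OF h pa va] by auto
    also have "\<dots> \<longleftrightarrow> (\<forall>a\<in>obj A. dmat \<phi> a pt \<cdot> h \<preceq>\<^bsub>ptp B y, ty A a\<^esub> hom (P0 Q B) (fmap G a) y)"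
      using P0_le_hom[OF B y Go] comp_arr[OF h pa] Gt by auto
    finally show "h \<preceq>\<^bsub>ty (P0 Q B) y,ptype \<phi>\<^esub> hom (P0 Q B) c y \<longleftrightarrow>
        (\<forall>a\<in>obj A. dmat \<phi> a pt \<cdot> h \<preceq>\<^bsub>ty (P0 Q B) y,ty A a\<^esub> hom (P0 Q B) (fmap G a) y)"
      using y by (simp add: P0_ty)
  qed
  \<comment> \<open>Colimits are unique up to isomorphism, hence unique here, since
    \<open>P0 Q B\<close> is skeletal. This gives the converse of \<open>char\<close>.\<close>
  have uniq: "c = x" if "is_colim Q \<phi> G c" for c
    using colim_unique[OF p G that char[OF x]] P0_iso_eq[OF B] by blast
  show "is_colim Q \<phi> G c \<longleftrightarrow> c \<in> obj (P0 Q B) \<and> ptp B c = ptype \<phi> \<and>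
      (\<forall>b\<in>obj B. val B c b = join_of (ptype \<phi>) (ty B b) (\<lambda>a. val B (fmap G a) b \<cdot> dmat \<phi> a pt) (obj A))"
    using char uniq x unfolding J_def by blast
  show "is_colim Q \<phi> G (colim Q \<phi> G)"
    unfolding colim_def using char[OF x] by (rule someI)
qed

text \<open>In a skeletal category the choice made by \<open>SOME\<close> is a definite value, so
  \<open>colim\<close> may be replaced by any colimit at hand.\<close>

lemma P0_colim_eq:
  assumes p: "is_psh A \<phi>" and G: "is_functor A (P0 Q B) G" and B: "is_qcat Q B" and c: "is_colim Q \<phi> G c"
  shows "colim Q \<phi> G = c"
  using colim_unique[OF p G P0_colim[OF p G B] c] P0_iso_eq[OF B] by blast

section \<open>The action of distributors on presheaves\<close>

abbreviation act :: "'u qcat \<Rightarrow> 'u dist \<Rightarrow> 'u \<Rightarrow> 'u" where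
  "act A \<Phi> x \<equiv> code (dcomp Q \<Phi> (decode Q A x))"

text \<open>The action is studied for all distributors and not just for graphs: \<open>P1\<close> is
  the action of a graph, while the extension of a doctrine to distributors needs the general
  case.\<close>

lemma
  assumes F: "is_dist A B \<Phi>" and x: "x \<in> obj (P0 Q A)"
  shows act_obj: "act A \<Phi> x \<in> obj (P0 Q B)" and act_ptp: "ptp B (act A \<Phi> x) = ptp A x"
    and act_val: "\<And>b. b \<in> obj B \<Longrightarrow>
      val B (act A \<Phi> x) b = join_of (ptp A x) (ty B b) (\<lambda>a. dmat \<Phi> b a \<cdot> val A x a) (obj A)"
  using psh_dcomp[OF decode_psh[OF dist_qcat(1)[OF F] x] F] by (auto intro: code_obj simp: decode_code)

lemma act_comp_arr:
  assumes F: "is_dist A B \<Phi>" and x: "x \<in> obj (P0 Q A)" and i: "a \<in> obj A" "b \<in> obj B"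
  shows "arr (ptp A x) (ty B b) (dmat \<Phi> b a \<cdot> val A x a)"
  using comp_arr[OF val_arr[OF dist_qcat(1)[OF F] x i(1)] dist_arr[OF F i]] .

lemma act_upper:
  assumes F: "is_dist A B \<Phi>" and x: "x \<in> obj (P0 Q A)" and i: "a \<in> obj A" "b \<in> obj B"
  shows "dmat \<Phi> b a \<cdot> val A x a \<preceq>\<^bsub>ptp A x, ty B b\<^esub> val B (act A \<Phi> x) b"
  using join_upper[of "obj A" _ _ "\<lambda>a. dmat \<Phi> b a \<cdot> val A x a", OF act_comp_arr[OF F x _ i(2)] i(1)] i
  by (simp add: act_val[OF F x])

lemma act_comp_le_iff:
  assumes F: "is_dist A B \<Phi>" and x: "x \<in> obj (P0 Q A)" and b: "b \<in> obj B"
    and h: "arr X (ptp A x) h" and g: "arr X (ty B b) g"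
  shows "val B (act A \<Phi> x) b \<cdot> h \<preceq>\<^bsub>X, ty B b\<^esub> g \<longleftrightarrow>
    (\<forall>a\<in>obj A. dmat \<Phi> b a \<cdot> (val A x a \<cdot> h) \<preceq>\<^bsub>X, ty B b\<^esub> g)"
  using join_comp_le_iff[OF act_comp_arr[OF F x _ b] h g, where I = "obj A"]
    assoc[OF h val_arr[OF dist_qcat(1)[OF F] x] dist_arr[OF F _ b]]
  by (simp add: act_val[OF F x b])

lemma act_le_iff:
  assumes F: "is_dist A B \<Phi>" and x: "x \<in> obj (P0 Q A)" and b: "b \<in> obj B"
    and g: "arr (ptp A x) (ty B b) g"
  shows "val B (act A \<Phi> x) b \<preceq>\<^bsub>ptp A x, ty B b\<^esub> g \<longleftrightarrow>
    (\<forall>a\<in>obj A. dmat \<Phi> b a \<cdot> val A x a \<preceq>\<^bsub>ptp A x, ty B b\<^esub> g)"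
  using join_le_iff[OF act_comp_arr[OF F x _ b] g, where I = "obj A"] by (simp add: act_val[OF F x b])

text \<open>The reason is \<open>\<Phi>(b,a) \<cdot> (y(a) \<cdot> P(A)(y,x))\<close> below
  \<open>\<Phi>(b,a) \<cdot> x(a)\<close>, an instance of \<open>val_comp_hom\<close>. So tensoring
  with a distributor is functorial on presheaves.\<close>

lemma act_hom:
  assumes F: "is_dist A B \<Phi>" and x: "x \<in> obj (P0 Q A)" and y: "y \<in> obj (P0 Q A)"
  shows "hom (P0 Q A) y x \<preceq>\<^bsub>ptp A x, ptp A y\<^esub> hom (P0 Q B) (act A \<Phi> y) (act A \<Phi> x)"
proof -
  note A = dist_qcat(1)[OF F] and B = dist_qcat(2)[OF F]
  let ?h = "hom (P0 Q A) y x"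
  note h = P0_hom_arr[OF A x y]
  have "dmat \<Phi> b a \<cdot> (val A y a \<cdot> ?h) \<preceq>\<^bsub>ptp A x, ty B b\<^esub> val B (act A \<Phi> x) b" if "a \<in> obj A" "b \<in> obj B" for a b
    using arr_le_trans[OF comp_mono_right[OF val_comp_hom[OF A x y that(1)] dist_arr[OF F that]] act_upper[OF F x that]] .
  then show ?thesis
    using P0_le_hom[OF B act_obj[OF F x] act_obj[OF F y]] h val_arr[OF B act_obj[OF F x]]
      act_comp_le_iff[OF F y _ h]
    by (simp add: act_ptp[OF F x] act_ptp[OF F y])
qed

lemma act_dist_mono:
  assumes F: "is_dist A B \<Phi>" and G: "is_dist A B \<Psi>" and x: "x \<in> obj (P0 Q A)"
    and le: "\<And>a b. a \<in> obj A \<Longrightarrow> b \<in> obj B \<Longrightarrow> dmat \<Phi> b a \<preceq>\<^bsub>ty A a, ty B b\<^esub> dmat \<Psi> b a"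
  shows "obj_le (P0 Q B) (act A \<Phi> x) (act A \<Psi> x)"
proof -
  note A = dist_qcat(1)[OF F] and B = dist_qcat(2)[OF F]
  have "val B (act A \<Phi> x) b \<preceq>\<^bsub>ptp A x, ty B b\<^esub> val B (act A \<Psi> x) b" if b: "b \<in> obj B" for b
  proof -
    have "arr (ptp A x) (ty B b) (val B (act A \<Psi> x) b)"
      using val_arr[OF B act_obj[OF G x] b] act_ptp[OF G x] by simp
    moreover have "dmat \<Phi> b a \<cdot> val A x a \<preceq>\<^bsub>ptp A x, ty B b\<^esub> val B (act A \<Psi> x) b" if a: "a \<in> obj A" for a
      using arr_le_trans[OF comp_mono_left[OF le[OF a b] val_arr[OF A x a]] act_upper[OF G x a b]] .
    ultimately show ?thesis using act_le_iff[OF F x b] by blast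
  qed
  then show ?thesis
    using P0_obj_le_iff[OF B act_obj[OF F x] act_obj[OF G x]] by (simp add: act_ptp[OF F x] act_ptp[OF G x])
qed

text \<open>Both sides have the same upper bounds: a bound \<open>g\<close> must dominate
  \<open>\<Psi>(c,b) \<cdot> (\<Phi>(b,a) \<cdot> x(a))\<close> for all \<open>a\<close> and
  \<open>b\<close>, in either order of the quantifiers.\<close>

lemma act_dcomp:
  assumes F: "is_dist A B \<Phi>" and G: "is_dist B C \<Psi>" and x: "x \<in> obj (P0 Q A)"
  shows "act A (dcomp Q \<Psi> \<Phi>) x = act B \<Psi> (act A \<Phi> x)"
proof -
  note A = dist_qcat(1)[OF F] and B = dist_qcat(2)[OF F] and C = dist_qcat(2)[OF G]
  note GF = dcomp_dist[OF F G] and y = act_obj[OF F x]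
  note t = act_ptp[OF F x]
  let ?L = "act A (dcomp Q \<Psi> \<Phi>) x" and ?R = "act B \<Psi> (act A \<Phi> x)"
  have "val C ?L c = val C ?R c" if c: "c \<in> obj C" for c
  proof -
    have cong: "val C ?L c \<preceq>\<^bsub>ptp A x, ty C c\<^esub> g \<longleftrightarrow> val C ?R c \<preceq>\<^bsub>ptp A x, ty C c\<^esub> g"
      if g: "arr (ptp A x) (ty C c) g" for g
    proof -
      have GFa: "dmat (dcomp Q \<Psi> \<Phi>) c a \<cdot> val A x a \<preceq>\<^bsub>ptp A x, ty C c\<^esub> g \<longleftrightarrow>
        (\<forall>b\<in>obj B. dmat \<Psi> c b \<cdot> (dmat \<Phi> b a \<cdot> val A x a) \<preceq>\<^bsub>ptp A x, ty C c\<^esub> g)" if a: "a \<in> obj A" for a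
        using join_comp_le_iff[OF comp_arr[OF dist_arr[OF F a] dist_arr[OF G _ c]] val_arr[OF A x a] g, where I = "obj B"]
          assoc[OF val_arr[OF A x a] dist_arr[OF F a] dist_arr[OF G _ c]] a c
        by (simp add: dcomp_dmat[OF F G])
      have "val C ?L c \<preceq>\<^bsub>ptp A x, ty C c\<^esub> g \<longleftrightarrow> (\<forall>a\<in>obj A. \<forall>b\<in>obj B.
          dmat \<Psi> c b \<cdot> (dmat \<Phi> b a \<cdot> val A x a) \<preceq>\<^bsub>ptp A x, ty C c\<^esub> g)"
        using act_le_iff[OF GF x c g] GFa by blast
      also have "\<dots> \<longleftrightarrow> (\<forall>b\<in>obj B. dmat \<Psi> c b \<cdot> val B (act A \<Phi> x) b \<preceq>\<^bsub>ptp A x, ty C c\<^esub> g)"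
        using comp_join_le_iff[OF act_comp_arr[OF F x] dist_arr[OF G _ c] g, where I = "obj A"]
        by (auto simp: act_val[OF F x])
      also have "\<dots> \<longleftrightarrow> val C ?R c \<preceq>\<^bsub>ptp A x, ty C c\<^esub> g"
        using act_le_iff[OF G y c] g t by simp
      finally show ?thesis .
    qed
    have "arr (ptp A x) (ty C c) (val C ?L c)" "arr (ptp A x) (ty C c) (val C ?R c)"
      using val_arr[OF C act_obj[OF GF x] c] val_arr[OF C act_obj[OF G y] c] t
      by (auto simp: act_ptp[OF GF x] act_ptp[OF G y])
    then show ?thesis using cong by (meson arr_le_antisym arr_le_refl)
  qed
  moreover have "ptp C ?L = ptp C ?R"
    unfolding act_ptp[OF GF x] act_ptp[OF G y] t ..
  ultimately show ?thesis
    by (intro P0_eqI[OF C act_obj[OF GF x] act_obj[OF G y]])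
qed

text \<open>The hypothesis speaks of entries so that it fits both the graph of \<open>fid A\<close>
  and the identity of \<open>Dist Q\<close>, which are different terms.\<close>

lemma act_ident:
  assumes A: "is_qcat Q A" and x: "x \<in> obj (P0 Q A)" and F: "is_dist A A \<Phi>"
    and h: "\<And>a a'. a \<in> obj A \<Longrightarrow> a' \<in> obj A \<Longrightarrow> dmat \<Phi> a' a = hom A a' a"
  shows "act A \<Phi> x = x"
proof (rule P0_eqI[OF A act_obj[OF F x] x act_ptp[OF F x]])
  fix a assume a: "a \<in> obj A"
  show "val A (act A \<Phi> x) a = val A x a"
  proof (rule arr_le_antisym)
    show "val A (act A \<Phi> x) a \<preceq>\<^bsub>ptp A x, ty A a\<^esub> val A x a"
      using act_le_iff[OF F x a val_arr[OF A x a]] psh_hom[OF decode_psh[OF A x] a] a h by simp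
    have "val A x a = Ident Q (ty A a) \<cdot> val A x a"
      using comp_ident(1)[OF val_arr[OF A x a]] by simp
    also have "\<dots> \<preceq>\<^bsub>ptp A x, ty A a\<^esub> dmat \<Phi> a a \<cdot> val A x a"
      using comp_mono_left[OF qcat_ident[OF A a] val_arr[OF A x a]] a h by simp
    also note act_upper[OF F x a a]
    finally show "val A x a \<preceq>\<^bsub>ptp A x, ty A a\<^esub> val A (act A \<Phi> x) a" .
  qed
qed

text \<open>The join over \<open>b\<close> of \<open>C(c, G b) \<cdot> B(b, F a)\<close> is attained
  at \<open>b = F a\<close>.\<close>

lemma graph_fcomp:
  assumes F: "is_functor A B F" and G: "is_functor B C G"
  shows "graph (G \<circ>\<^sub>f F) = dcomp Q (graph G) (graph F)"
proof (rule dist_eqI[OF graph_dist[OF fcomp_functor[OF F G]] dcomp_dist[OF graph_dist[OF F] graph_dist[OF G]]])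
  fix a c assume a: "a \<in> obj A" and c: "c \<in> obj C"
  note B = functor_qcat(1)[OF G] and C = functor_qcat(2)[OF G]
  note Fa = functor_obj[OF F a] and ta = functor_ty[OF F a]
  have ar: "arr (ty A a) (ty B b) (hom B b (fmap F a))" "arr (ty B b) (ty C c) (hom C c (fmap G b))" if "b \<in> obj B" for b
    using qcat_hom[OF B Fa that] qcat_hom[OF C functor_obj[OF G that] c] ta functor_ty[OF G that] by auto
  have g: "arr (ty A a) (ty C c) (hom C c (fmap G (fmap F a)))" using ar(2)[OF Fa] ta by simp
  have "hom C c (fmap G (fmap F a)) = join_of (ty A a) (ty C c) (\<lambda>b. hom C c (fmap G b) \<cdot> hom B b (fmap F a)) (obj B)"
    (is "_ = ?J")
  proof (rule arr_le_antisym)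
    have "hom C c (fmap G (fmap F a)) = hom C c (fmap G (fmap F a)) \<cdot> Ident Q (ty A a)"
      using comp_ident(2)[OF g] by simp
    also have "\<dots> \<preceq>\<^bsub>ty A a, ty C c\<^esub> hom C c (fmap G (fmap F a)) \<cdot> hom B (fmap F a) (fmap F a)"
      using comp_mono_right[OF qcat_ident[OF B Fa] ar(2)[OF Fa]] ta by simp
    also have "\<dots> \<preceq>\<^bsub>ty A a, ty C c\<^esub> ?J"
      using join_upper[of "obj B" _ _ "\<lambda>b. hom C c (fmap G b) \<cdot> hom B b (fmap F a)", OF comp_arr[OF ar] Fa] .
    finally show "hom C c (fmap G (fmap F a)) \<preceq>\<^bsub>ty A a, ty C c\<^esub> ?J" .
    have "hom C c (fmap G b) \<cdot> hom B b (fmap F a) \<preceq>\<^bsub>ty A a, ty C c\<^esub> hom C c (fmap G (fmap F a))" if b: "b \<in> obj B" for b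
      using dist_right[OF graph_dist[OF G] Fa b c] graph_dmat[OF G] b Fa c ta by simp
    then show "?J \<preceq>\<^bsub>ty A a, ty C c\<^esub> hom C c (fmap G (fmap F a))"
      by (intro join_least[OF g])
  qed
  then show "dmat (graph (G \<circ>\<^sub>f F)) c a = dmat (dcomp Q (graph G) (graph F)) c a"
    using a c by (simp add: dcomp_dmat[OF graph_dist[OF F] graph_dist[OF G]] graph_dmat[OF fcomp_functor[OF F G]]
        fcomp_map[OF F] graph_dmat[OF F] graph_dmat[OF G] cong: join_cong)
qed

lemma P1_map: "is_functor A B F \<Longrightarrow> x \<in> obj (P0 Q A) \<Longrightarrow> fmap (P1 Q F) x = act A (graph F) x"
  using functor_src[of A B F] by (simp add: P1_def)

lemma P1_functor:
  assumes F: "is_functor A B F"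
  shows "is_functor (P0 Q A) (P0 Q B) (P1 Q F)"
proof (rule functorI)
  note d = graph_dist[OF F] and s = functor_src[OF F]
  show "is_qcat Q (P0 Q A)" "is_qcat Q (P0 Q B)" using functor_qcat[OF F] by (auto intro: P0_qcat)
  show "fsrc (P1 Q F) = P0 Q A" "ftgt (P1 Q F) = P0 Q B" "fmap (P1 Q F) \<in> extensional (obj (P0 Q A))"
    using s by (auto simp: P1_def)
  show "fmap (P1 Q F) x \<in> obj (P0 Q B)" "ty (P0 Q B) (fmap (P1 Q F) x) = ty (P0 Q A) x" if "x \<in> obj (P0 Q A)" for x
    using act_obj[OF d that] act_ptp[OF d that] that by (auto simp: P1_map[OF F] P0_ty)
  show "hom (P0 Q A) y x \<preceq>\<^bsub>ty (P0 Q A) x,ty (P0 Q A) y\<^esub> hom (P0 Q B) (fmap (P1 Q F) y) (fmap (P1 Q F) x)"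
    if "x \<in> obj (P0 Q A)" "y \<in> obj (P0 Q A)" for x y
    using act_hom[OF d that] that by (simp add: P0_ty P1_map[OF F])
qed

lemma P1_ptp: "is_functor A B F \<Longrightarrow> x \<in> obj (P0 Q A) \<Longrightarrow> ptp B (fmap (P1 Q F) x) = ptp A x"
  using act_ptp[OF graph_dist] by (simp add: P1_map)

text \<open>The calculation behind \<open>colim_P1\<close> and \<open>adjoint_colim\<close>.
  Unfolding the join in \<open>P(F)(x)\<close>, the left side bounds
  \<open>B(b, F a) \<cdot> (x(a) \<cdot> h)\<close> by \<open>D(G b, d)\<close> for all
  \<open>b\<close>. The case \<open>b = F a\<close> together with the identity gives the right side;
  composing the right side with \<open>B(b, F a)\<close> gives all other cases.\<close>

lemma P1_comp_le_iff:
  assumes F: "is_functor A B F" and G: "is_functor B D G" and x: "x \<in> obj (P0 Q A)"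
    and d: "d \<in> obj D" and h: "arr (ty D d) (ptp A x) h"
  shows "(\<forall>b\<in>obj B. val B (fmap (P1 Q F) x) b \<cdot> h \<preceq>\<^bsub>ty D d, ty B b\<^esub> hom D (fmap G b) d) \<longleftrightarrow>
    (\<forall>a\<in>obj A. val A x a \<cdot> h \<preceq>\<^bsub>ty D d, ty A a\<^esub> hom D (fmap G (fmap F a)) d)"
proof -
  note A = functor_qcat(1)[OF F] and B = functor_qcat(2)[OF F]
  note Fo = functor_obj[OF F] and Ft = functor_ty[OF F]
  have v: "arr (ty D d) (ty A a) (val A x a \<cdot> h)" if "a \<in> obj A" for a
    using comp_arr[OF h val_arr[OF A x that]] .
  have Gd: "arr (ty D d) (ty B b) (hom D (fmap G b) d)" if "b \<in> obj B" for b
    using dist_arr[OF cograph_dist[OF G] d that] cograph_dmat[OF G that d] by simp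
  have "(\<forall>b\<in>obj B. val B (fmap (P1 Q F) x) b \<cdot> h \<preceq>\<^bsub>ty D d, ty B b\<^esub> hom D (fmap G b) d) \<longleftrightarrow>
    (\<forall>a\<in>obj A. \<forall>b\<in>obj B. hom B b (fmap F a) \<cdot> (val A x a \<cdot> h) \<preceq>\<^bsub>ty D d, ty B b\<^esub> hom D (fmap G b) d)"
    using act_comp_le_iff[OF graph_dist[OF F] x _ h Gd] by (auto simp: P1_map[OF F x] graph_dmat[OF F])
  also have "\<dots> \<longleftrightarrow> (\<forall>a\<in>obj A. val A x a \<cdot> h \<preceq>\<^bsub>ty D d, ty A a\<^esub> hom D (fmap G (fmap F a)) d)"
  proof (rule ball_cong[OF refl])
    fix a assume a: "a \<in> obj A"
    have ta: "arr (ty A a) (ty A a) (hom B (fmap F a) (fmap F a))"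
      using functor_hom_arr[OF F a a] .
    show "(\<forall>b\<in>obj B. hom B b (fmap F a) \<cdot> (val A x a \<cdot> h) \<preceq>\<^bsub>ty D d, ty B b\<^esub> hom D (fmap G b) d) \<longleftrightarrow>
      val A x a \<cdot> h \<preceq>\<^bsub>ty D d, ty A a\<^esub> hom D (fmap G (fmap F a)) d" (is "?l \<longleftrightarrow> ?r")
    proof
      assume ?l
      then have l: "hom B (fmap F a) (fmap F a) \<cdot> (val A x a \<cdot> h) \<preceq>\<^bsub>ty D d, ty A a\<^esub> hom D (fmap G (fmap F a)) d"
        using Fo[OF a] Ft[OF a] by force
      have "val A x a \<cdot> h = Ident Q (ty A a) \<cdot> (val A x a \<cdot> h)"
        using comp_ident(1)[OF v[OF a]] by simp
      also have "\<dots> \<preceq>\<^bsub>ty D d, ty A a\<^esub> hom B (fmap F a) (fmap F a) \<cdot> (val A x a \<cdot> h)"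
        using comp_mono_left[OF qcat_ident[OF B Fo[OF a]], of "ty D d" "val A x a \<cdot> h"] Ft[OF a] v[OF a] by simp
      also note l
      finally show ?r .
    next
      assume r: ?r
      show ?l
      proof
        fix b assume b: "b \<in> obj B"
        have "arr (ty A a) (ty B b) (hom B b (fmap F a))" using qcat_hom[OF B Fo[OF a] b] Ft[OF a] by simp
        then have "hom B b (fmap F a) \<cdot> (val A x a \<cdot> h) \<preceq>\<^bsub>ty D d, ty B b\<^esub> hom B b (fmap F a) \<cdot> hom D (fmap G (fmap F a)) d"
          by (rule comp_mono_right[OF r])
        also have "\<dots> \<preceq>\<^bsub>ty D d, ty B b\<^esub> hom D (fmap G b) d"
          using dist_left[OF cograph_dist[OF G] d b Fo[OF a]] cograph_dmat[OF G] d b Fo[OF a] by simp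
        finally show "hom B b (fmap F a) \<cdot> (val A x a \<cdot> h) \<preceq>\<^bsub>ty D d, ty B b\<^esub> hom D (fmap G b) d" .
      qed
    qed
  qed
  finally show ?thesis .
qed

lemma colim_P1:
  assumes F: "is_functor A B F" and G: "is_functor B D G" and x: "x \<in> obj (P0 Q A)"
  shows "is_colim Q (decode Q B (fmap (P1 Q F) x)) G d \<longleftrightarrow> is_colim Q (decode Q A x) (G \<circ>\<^sub>f F) d"
proof -
  note A = functor_qcat(1)[OF F] and B = functor_qcat(2)[OF F]
  note p = decode_psh[OF A x] decode_psh[OF B functor_obj[OF P1_functor[OF F] x]]
  show ?thesis
    using P1_comp_le_iff[OF F G x]
    by (auto simp: is_colim_iff[OF p(1) fcomp_functor[OF F G]] is_colim_iff[OF p(2) G] P1_ptp[OF F x] fcomp_map[OF F])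
qed

text \<open>An interchange of joins: tensoring with the graph of \<open>F\<close> is a join over the
  objects of \<open>B\<close>, the colimit is one over the objects of \<open>A\<close>.\<close>

lemma P1_colim:
  assumes p: "is_psh A \<phi>" and G: "is_functor A (P0 Q B) G" and F: "is_functor B D F" and c: "is_colim Q \<phi> G c"
  shows "is_colim Q \<phi> (P1 Q F \<circ>\<^sub>f G) (fmap (P1 Q F) c)"
proof -
  note B = functor_qcat(1)[OF F] and D = functor_qcat(2)[OF F]
  note PF = P1_functor[OF F]
  note FG = fcomp_functor[OF G PF]
  note co = colim_obj[OF p G c]
  note ct = c[unfolded P0_colim_iff[OF p G B]]
  let ?Fc = "fmap (P1 Q F) c"
  note Go = functor_obj[OF G] and Gt = functor_ptp[OF G]
  have va: "arr (ty A a) (ty B b) (val B (fmap G a) b)" if "a \<in> obj A" "b \<in> obj B" for a b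
    using val_arr[OF B Go[OF that(1)] that(2)] Gt[OF that(1)] by simp
  have "val D ?Fc d = join_of (ptype \<phi>) (ty D d) (\<lambda>a. val D (fmap (P1 Q F \<circ>\<^sub>f G) a) d \<cdot> dmat \<phi> a pt) (obj A)" (is "_ = ?J")
    if d: "d \<in> obj D" for d
  proof -
    have Fb: "arr (ty B b) (ty D d) (hom D d (fmap F b))" if "b \<in> obj B" for b
      using dist_arr[OF graph_dist[OF F] that d] graph_dmat[OF F that d] by simp
    have vd: "arr (ty A a) (ty D d) (val D (fmap (P1 Q F \<circ>\<^sub>f G) a) d)" if a: "a \<in> obj A" for a
      using val_arr[OF D functor_obj[OF FG a] d] functor_ptp[OF FG a] by simp
    note ja = comp_arr[OF psh_arr[OF p] vd]
    have aJ: "arr (ptype \<phi>) (ty D d) ?J" using psh_Ob[OF p] qcat_ty[OF D d] ja by (intro join_arr) auto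
    have aF: "arr (ptype \<phi>) (ty D d) (val D ?Fc d)"
      using val_arr[OF D functor_obj[OF PF co] d] P1_ptp[OF F co] ct by simp
    \<comment> \<open>The two arrows are compared through their upper bounds
      \<open>g\<close>.\<close>
    have "val D ?Fc d \<preceq>\<^bsub>ptype \<phi>, ty D d\<^esub> g \<longleftrightarrow> ?J \<preceq>\<^bsub>ptype \<phi>, ty D d\<^esub> g" if g: "arr (ptype \<phi>) (ty D d) g" for g
    proof -
      have "val D ?Fc d \<preceq>\<^bsub>ptype \<phi>, ty D d\<^esub> g \<longleftrightarrow> (\<forall>b\<in>obj B. hom D d (fmap F b) \<cdot> val B c b \<preceq>\<^bsub>ptype \<phi>, ty D d\<^esub> g)"
        using act_le_iff[OF graph_dist[OF F] co d] g ct d by (simp add: P1_map[OF F co] graph_dmat[OF F])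
      also have "\<dots> \<longleftrightarrow> (\<forall>b\<in>obj B. \<forall>a\<in>obj A. hom D d (fmap F b) \<cdot> (val B (fmap G a) b \<cdot> dmat \<phi> a pt) \<preceq>\<^bsub>ptype \<phi>, ty D d\<^esub> g)"
        using comp_join_le_iff[OF comp_arr[OF psh_arr[OF p] va] Fb g, where I = "obj A"] ct by auto
      also have "\<dots> \<longleftrightarrow> (\<forall>a\<in>obj A. val D (fmap (P1 Q F \<circ>\<^sub>f G) a) d \<cdot> dmat \<phi> a pt \<preceq>\<^bsub>ptype \<phi>, ty D d\<^esub> g)"
        using act_comp_le_iff[OF graph_dist[OF F] Go d _ g] psh_arr[OF p] Gt d
        by (auto simp: fcomp_map[OF G] P1_map[OF F Go] graph_dmat[OF F])
      also have "\<dots> \<longleftrightarrow> ?J \<preceq>\<^bsub>ptype \<phi>, ty D d\<^esub> g"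
        using join_le_iff[OF ja g, where I = "obj A"] by simp
      finally show ?thesis .
    qed
    then show ?thesis using aJ aF by (meson arr_le_antisym arr_le_refl)
  qed
  then show ?thesis
    unfolding P0_colim_iff[OF p FG D] using functor_obj[OF PF co] P1_ptp[OF F co] ct by simp
qed

section \<open>The Yoneda embedding and the multiplication\<close>

lemma
  assumes A: "is_qcat Q A" and a: "a \<in> obj A"
  shows representable_psh: "is_psh A (representable Q A a)"
    and yoneda_map: "fmap (yoneda Q A) a = code (representable Q A a)"
    and yoneda_obj: "fmap (yoneda Q A) a \<in> obj (P0 Q A)"
    and yoneda_ptp: "ptp A (fmap (yoneda Q A) a) = ty A a"
    and yoneda_val: "\<And>a'. a' \<in> obj A \<Longrightarrow> val A (fmap (yoneda Q A) a) a' = hom A a' a"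
proof -
  show p: "is_psh A (representable Q A a)"
    unfolding representable_def using A a qcat_ty qcat_hom qcat_comp by (intro pshI) auto
  have t: "ptype (representable Q A a) = ty A a" by (simp add: ptype_def representable_def star_simps)
  show m: "fmap (yoneda Q A) a = code (representable Q A a)" using a by (simp add: yoneda_def)
  show "fmap (yoneda Q A) a \<in> obj (P0 Q A)" "ptp A (fmap (yoneda Q A) a) = ty A a"
    "\<And>a'. a' \<in> obj A \<Longrightarrow> val A (fmap (yoneda Q A) a) a' = hom A a' a"
    using code_obj[OF p] by (auto simp: m decode_code[OF p] t) (simp add: representable_def)
qed

text \<open>In one direction evaluate at \<open>a' = a\<close> and insert the identity; in the other
  use the action of \<open>A\<close> on the presheaf.\<close>

lemma yoneda_lemma:
  assumes A: "is_qcat Q A" and a: "a \<in> obj A" and x: "x \<in> obj (P0 Q A)"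
  shows "hom (P0 Q A) (fmap (yoneda Q A) a) x = val A x a"
proof (rule arr_eqI)
  note yo = yoneda_obj[OF A a]
  show "arr (ptp A x) (ty A a) (hom (P0 Q A) (fmap (yoneda Q A) a) x)"
    using P0_hom_arr[OF A x yo] yoneda_ptp[OF A a] by simp
  show v: "arr (ptp A x) (ty A a) (val A x a)" by (rule val_arr[OF A x a])
  fix h assume h: "arr (ptp A x) (ty A a) h"
  have "h \<preceq>\<^bsub>ptp A x, ty A a\<^esub> hom (P0 Q A) (fmap (yoneda Q A) a) x \<longleftrightarrow>
      (\<forall>a'\<in>obj A. hom A a' a \<cdot> h \<preceq>\<^bsub>ptp A x, ty A a'\<^esub> val A x a')"
    using P0_le_hom[OF A x yo] h yoneda_ptp[OF A a] yoneda_val[OF A a] by simp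
  also have "\<dots> \<longleftrightarrow> h \<preceq>\<^bsub>ptp A x, ty A a\<^esub> val A x a"
  proof
    assume "\<forall>a'\<in>obj A. hom A a' a \<cdot> h \<preceq>\<^bsub>ptp A x, ty A a'\<^esub> val A x a'"
    then have "hom A a a \<cdot> h \<preceq>\<^bsub>ptp A x, ty A a\<^esub> val A x a" using a by blast
    then show "h \<preceq>\<^bsub>ptp A x, ty A a\<^esub> val A x a"
      using arr_le_trans[OF comp_mono_left[OF qcat_ident[OF A a] h]] comp_ident(1)[OF h] by simp
  next
    assume "h \<preceq>\<^bsub>ptp A x, ty A a\<^esub> val A x a"
    then show "\<forall>a'\<in>obj A. hom A a' a \<cdot> h \<preceq>\<^bsub>ptp A x, ty A a'\<^esub> val A x a'"
      using arr_le_trans[OF comp_mono_right psh_hom[OF decode_psh[OF A x] _ a]] qcat_hom[OF A a] by blast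
  qed
  finally show "h \<preceq>\<^bsub>ptp A x, ty A a\<^esub> hom (P0 Q A) (fmap (yoneda Q A) a) x \<longleftrightarrow> h \<preceq>\<^bsub>ptp A x, ty A a\<^esub> val A x a" .
qed

lemma yoneda_hom:
  "is_qcat Q A \<Longrightarrow> a \<in> obj A \<Longrightarrow> a' \<in> obj A \<Longrightarrow> hom (P0 Q A) (fmap (yoneda Q A) a') (fmap (yoneda Q A) a) = hom A a' a"
  by (simp add: yoneda_lemma yoneda_obj yoneda_val)

lemma yoneda_functor:
  assumes A: "is_qcat Q A"
  shows "is_functor A (P0 Q A) (yoneda Q A)"
  by (rule functorI)
    (use A in \<open>auto simp: P0_ty yoneda_obj yoneda_ptp yoneda_hom intro: P0_qcat arr_le_refl qcat_hom,
      auto simp: yoneda_def\<close>)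

text \<open>The join over \<open>a'\<close> of \<open>B(b, F a') \<cdot> A(a', a)\<close> is
  attained at \<open>a' = a\<close>.\<close>

lemma yoneda_natural:
  assumes F: "is_functor A B F" and a: "a \<in> obj A"
  shows "fmap (P1 Q F) (fmap (yoneda Q A) a) = fmap (yoneda Q B) (fmap F a)"
proof -
  note A = functor_qcat(1)[OF F] and B = functor_qcat(2)[OF F]
  note y = yoneda_obj[OF A a] and Fa = functor_obj[OF F a]
  have t: "ptp B (fmap (P1 Q F) (fmap (yoneda Q A) a)) = ty A a"
    using P1_ptp[OF F y] yoneda_ptp[OF A a] by simp
  show ?thesis
  proof (rule P0_eqI[OF B functor_obj[OF P1_functor[OF F] y] yoneda_obj[OF B Fa]])
    show "ptp B (fmap (P1 Q F) (fmap (yoneda Q A) a)) = ptp B (fmap (yoneda Q B) (fmap F a))"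
      using t yoneda_ptp[OF B Fa] functor_ty[OF F a] by simp
    fix b assume b: "b \<in> obj B"
    have g: "arr (ty A a) (ty B b) (hom B b (fmap F a))" using qcat_hom[OF B Fa b] functor_ty[OF F a] by simp
    have "val B (fmap (P1 Q F) (fmap (yoneda Q A) a)) b = hom B b (fmap F a)"
    proof (rule arr_le_antisym)
      have "hom B b (fmap F a') \<cdot> hom A a' a \<preceq>\<^bsub>ty A a, ty B b\<^esub> hom B b (fmap F a)" if "a' \<in> obj A" for a'
        using dist_right[OF graph_dist[OF F] a that b] graph_dmat[OF F] a that b by simp
      then show "val B (fmap (P1 Q F) (fmap (yoneda Q A) a)) b \<preceq>\<^bsub>ty A a, ty B b\<^esub> hom B b (fmap F a)"
        using act_le_iff[OF graph_dist[OF F] y b] g b a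
        by (simp add: P1_map[OF F y] yoneda_ptp[OF A a] graph_dmat[OF F] yoneda_val[OF A a])
      have "hom B b (fmap F a) = hom B b (fmap F a) \<cdot> Ident Q (ty A a)" using comp_ident(2)[OF g] by simp
      also have "\<dots> \<preceq>\<^bsub>ty A a, ty B b\<^esub> hom B b (fmap F a) \<cdot> hom A a a"
        by (rule comp_mono_right[OF qcat_ident[OF A a] g])
      also have "\<dots> \<preceq>\<^bsub>ty A a, ty B b\<^esub> val B (fmap (P1 Q F) (fmap (yoneda Q A) a)) b"
        using act_upper[OF graph_dist[OF F] y a b] a b
        by (simp add: P1_map[OF F y] yoneda_ptp[OF A a] graph_dmat[OF F] yoneda_val[OF A a])
      finally show "hom B b (fmap F a) \<preceq>\<^bsub>ty A a, ty B b\<^esub> val B (fmap (P1 Q F) (fmap (yoneda Q A) a)) b" .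
    qed
    then show "val B (fmap (P1 Q F) (fmap (yoneda Q A) a)) b = val B (fmap (yoneda Q B) (fmap F a)) b"
      using yoneda_val[OF B Fa b] by simp
  qed
qed

lemma P1_mono:
  assumes F: "is_functor A B F" and G: "is_functor A B G" and le: "fle Q F G" and x: "x \<in> obj (P0 Q A)"
  shows "obj_le (P0 Q B) (fmap (P1 Q F) x) (fmap (P1 Q G) x)"
proof -
  note d = graph_dist[OF F] graph_dist[OF G]
  have "graph F \<sqsubseteq>\<^bsub>Hom (Dist Q) A B\<^esub> graph G"
    using le functor_src[OF F] by (auto simp: fle_def)
  then show ?thesis
    unfolding P1_map[OF F x] P1_map[OF G x] dist_le_iff[OF d]
    by (intro act_dist_mono[OF d x]) blast
qed

lemma P1_fid: "is_qcat Q A \<Longrightarrow> x \<in> obj (P0 Q A) \<Longrightarrow> fmap (P1 Q (fid A)) x = x"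
  using act_ident[OF _ _ graph_dist[OF fid_functor]] graph_dmat[OF fid_functor]
  by (simp add: P1_map[OF fid_functor] fid_map)

lemma P1_fcomp:
  assumes F: "is_functor A B F" and G: "is_functor B C G" and x: "x \<in> obj (P0 Q A)"
  shows "fmap (P1 Q (G \<circ>\<^sub>f F)) x = fmap (P1 Q G) (fmap (P1 Q F) x)"
  using act_dcomp[OF graph_dist[OF F] graph_dist[OF G] x] functor_obj[OF P1_functor[OF F] x]
  by (simp add: P1_map[OF F x] P1_map[OF G] P1_map[OF fcomp_functor[OF F G] x] graph_fcomp[OF F G])

text \<open>The value formula required of the colimit is the unit law for the graph of
  \<open>fid A\<close>, whose entries are also the values of the representables.\<close>

lemma colim_yoneda:
  assumes p: "is_psh A \<phi>"
  shows "is_colim Q \<phi> (yoneda Q A) (code \<phi>)"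
proof -
  note A = psh_qcat[OF p]
  have "act A (graph (fid A)) (code \<phi>) = code \<phi>"
    using P1_fid[OF A code_obj[OF p]] P1_map[OF fid_functor[OF A] code_obj[OF p]] by simp
  then have v: "val A (code \<phi>) a = join_of (ptype \<phi>) (ty A a) (\<lambda>a'. hom A a a' \<cdot> dmat \<phi> a' pt) (obj A)" if "a \<in> obj A" for a
    using act_val[OF graph_dist[OF fid_functor[OF A]] code_obj[OF p] that, unfolded decode_code[OF p]] that
    by (simp add: decode_code[OF p] graph_dmat[OF fid_functor[OF A]] fid_map cong: join_cong)
  have "join_of (ptype \<phi>) (ty A a) (\<lambda>a'. hom A a a' \<cdot> dmat \<phi> a' pt) (obj A) =
     join_of (ptype \<phi>) (ty A a) (\<lambda>a'. val A (fmap (yoneda Q A) a') a \<cdot> dmat \<phi> a' pt) (obj A)" if "a \<in> obj A" for a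
    using that by (intro join_cong) (auto simp: yoneda_val[OF A])
  then show ?thesis
    unfolding P0_colim_iff[OF p yoneda_functor[OF A] A] using v code_obj[OF p] by (simp add: decode_code[OF p])
qed

lemma mult_map:
  "is_qcat Q A \<Longrightarrow> x \<in> obj (P0 Q (P0 Q A)) \<Longrightarrow>
    fmap (presheaf_mult Q A) x = colim Q (decode Q (P0 Q A) x) (fid (P0 Q A))"
  by (simp add: presheaf_mult_def)

text \<open>The multiplication is a colimit of the identity functor, and \<open>colim_P1\<close>
  moves \<open>G\<close> from the weight into the diagram. This is how laws about the multiplication
  become statements about colimits.\<close>

lemma mult_colim:
  assumes G: "is_functor A (P0 Q B) G" and B: "is_qcat Q B" and x: "x \<in> obj (P0 Q A)"
  shows "is_colim Q (decode Q A x) G (fmap (presheaf_mult Q B) (fmap (P1 Q G) x))"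
proof -
  note A = functor_qcat(1)[OF G] and P = P0_qcat[OF B]
  note y = functor_obj[OF P1_functor[OF G] x]
  have e: "fid (P0 Q B) \<circ>\<^sub>f G = G"
    using functor_obj[OF G] by (intro functor_eqI[OF fcomp_functor[OF G fid_functor[OF P]] G]) (simp add: fcomp_map[OF G] fid_map)
  show ?thesis
    using colim_P1[OF G fid_functor[OF P] x] P0_colim[OF decode_psh[OF P y] fid_functor[OF P] B]
    by (simp add: mult_map[OF B y] e)
qed

section \<open>Algebras of a full sub-KZ-doctrine\<close>

lemma ff_obj_le:
  assumes J: "is_functor B D J" and ff: "fully_faithful J" and o: "x \<in> obj B" "y \<in> obj B"
    and l: "obj_le D (fmap J x) (fmap J y)"
  shows "obj_le B x y"
  using l ff o functor_src[OF J] functor_qcat[OF J] functor_ty[OF J]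
  by (simp add: obj_le_def fully_faithful_def)

lemma ff_obj_iso:
  assumes "is_functor B D J" "fully_faithful J" "x \<in> obj B" "y \<in> obj B" "obj_iso D (fmap J x) (fmap J y)"
  shows "obj_iso B x y"
  using assms ff_obj_le[of B D J] by (simp add: obj_iso_def)

section \<open>2-functors and 2-natural transformations at single objects\<close>

lemma fiso_obj:
  assumes "fiso Q F G" "is_functor A B F" "is_functor A B G" "a \<in> obj A"
  shows "obj_iso B (fmap F a) (fmap G a)"
  using assms by (simp add: fiso_iff)

lemma
  assumes T: "two_functor Q T"
  shows two_functor_qcat: "is_qcat Q A \<Longrightarrow> is_qcat Q (map0 T A)"
    and two_functor_functor: "is_functor A B F \<Longrightarrow> is_functor (map0 T A) (map0 T B) (map1 T F)"
    and two_functor_mono: "is_functor A B F \<Longrightarrow> is_functor A B G \<Longrightarrow> fle Q F G \<Longrightarrow> fle Q (map1 T F) (map1 T G)"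
    and two_functor_fid: "is_qcat Q A \<Longrightarrow> fiso Q (map1 T (fid A)) (fid (map0 T A))"
    and two_functor_fcomp: "is_functor A B F \<Longrightarrow> is_functor B C G \<Longrightarrow>
      fiso Q (map1 T (G \<circ>\<^sub>f F)) (map1 T G \<circ>\<^sub>f map1 T F)"
  using T by (simp_all add: two_functor_def is_functor_def Ob_Dist) blast+

lemma two_functor_fiso:
  "two_functor Q T \<Longrightarrow> is_functor A B F \<Longrightarrow> is_functor A B G \<Longrightarrow> fiso Q F G \<Longrightarrow> fiso Q (map1 T F) (map1 T G)"
  by (simp add: fiso_def two_functor_mono)

lemma two_natural_functor:
  "two_natural Q S T \<alpha> \<Longrightarrow> two_functor Q T \<Longrightarrow> two_functor Q S \<Longrightarrow> is_qcat Q A \<Longrightarrow> is_functor (map0 S A) (map0 T A) (\<alpha> A)"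
  by (simp add: two_natural_def is_functor_def two_functor_qcat Ob_Dist)

lemma two_natural_obj:
  assumes n: "two_natural Q S T \<alpha>" and T: "two_functor Q T" and S: "two_functor Q S"
    and F: "is_functor A B F" and a: "a \<in> obj (map0 S A)"
  shows "obj_iso (map0 T B) (fmap (\<alpha> B) (fmap (map1 S F) a)) (fmap (map1 T F) (fmap (\<alpha> A) a))"
proof -
  note al = two_natural_functor[OF n T S functor_qcat(1)[OF F]] two_natural_functor[OF n T S functor_qcat(2)[OF F]]
  note SF = two_functor_functor[OF S F] and TF = two_functor_functor[OF T F]
  have "fiso Q (\<alpha> B \<circ>\<^sub>f map1 S F) (map1 T F \<circ>\<^sub>f \<alpha> A)"
    using n F by (auto simp: two_natural_def is_functor_def Ob_Dist)
  from fiso_obj[OF this fcomp_functor[OF SF al(2)] fcomp_functor[OF al(1) TF] a]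
  show ?thesis using a by (simp add: fcomp_map[OF SF] fcomp_map[OF al(1)])
qed

lemma two_naturalI:
  assumes T: "two_functor Q T" and S: "two_functor Q S"
    and al: "\<And>A. is_qcat Q A \<Longrightarrow> is_functor (map0 S A) (map0 T A) (\<alpha> A)"
    and n: "\<And>A B F a. is_functor A B F \<Longrightarrow> a \<in> obj (map0 S A) \<Longrightarrow>
      obj_iso (map0 T B) (fmap (\<alpha> B) (fmap (map1 S F) a)) (fmap (map1 T F) (fmap (\<alpha> A) a))"
  shows "two_natural Q S T \<alpha>"
proof -
  have "fiso Q (\<alpha> B \<circ>\<^sub>f map1 S F) (map1 T F \<circ>\<^sub>f \<alpha> A)" if F: "is_functor A B F" for A B F
  proof -
    note SF = two_functor_functor[OF S F] and TF = two_functor_functor[OF T F]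
    note aB = al[OF functor_qcat(2)[OF F]] and aA = al[OF functor_qcat(1)[OF F]]
    show ?thesis
      unfolding fiso_iff[OF fcomp_functor[OF SF aB] fcomp_functor[OF aA TF]]
      using n[OF F] by (simp add: fcomp_map[OF SF] fcomp_map[OF aA])
  qed
  then show ?thesis using al by (auto simp: two_natural_def is_functor_def Ob_Dist)
qed

text \<open>Functoriality is assumed on the nose, as it holds for \<open>presheaf_functor\<close>,
  \<open>id2\<close> and the doctrines of classes. A composite with an abstract \<open>T\<close> is
  functorial only up to isomorphism and is treated in \<open>comp2_two_functor\<close>.\<close>

lemma two_functorI:
  assumes q: "\<And>A. is_qcat Q A \<Longrightarrow> is_qcat Q (map0 T A)"
    and f: "\<And>A B F. is_functor A B F \<Longrightarrow> is_functor (map0 T A) (map0 T B) (map1 T F)"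
    and m: "\<And>A B F G t. is_functor A B F \<Longrightarrow> is_functor A B G \<Longrightarrow> fle Q F G \<Longrightarrow> t \<in> obj (map0 T A) \<Longrightarrow>
      obj_le (map0 T B) (fmap (map1 T F) t) (fmap (map1 T G) t)"
    and i: "\<And>A t. is_qcat Q A \<Longrightarrow> t \<in> obj (map0 T A) \<Longrightarrow> fmap (map1 T (fid A)) t = t"
    and c: "\<And>A B C F G t. is_functor A B F \<Longrightarrow> is_functor B C G \<Longrightarrow> t \<in> obj (map0 T A) \<Longrightarrow>
      fmap (map1 T (G \<circ>\<^sub>f F)) t = fmap (map1 T G) (fmap (map1 T F) t)"
  shows "two_functor Q T"
proof -
  have "fle Q (map1 T F) (map1 T G)" if "is_functor A B F" "is_functor A B G" "fle Q F G" for A B F G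
    using m[OF that] fle_iff[OF f[OF that(1)] f[OF that(2)]] by blast
  moreover have "fiso Q (map1 T (fid A)) (fid (map0 T A))" if A: "is_qcat Q A" for A
    using fiso_iff[OF f[OF fid_functor[OF A]] fid_functor[OF q[OF A]]] i[OF A] q[OF A]
    by (simp add: fid_map obj_iso_refl)
  moreover have "fiso Q (map1 T (G \<circ>\<^sub>f F)) (map1 T G \<circ>\<^sub>f map1 T F)" if F: "is_functor A B F" and G: "is_functor B C G" for A B C F G
    using fiso_iff[OF f[OF fcomp_functor[OF F G]] fcomp_functor[OF f[OF F] f[OF G]]] c[OF F G]
      q[OF functor_qcat(2)[OF G]] functor_obj[OF f[OF F]] functor_obj[OF f[OF G]]
    by (simp add: fcomp_map[OF f[OF F]] obj_iso_refl)
  ultimately show ?thesis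
    using q f unfolding two_functor_def by (simp add: Ob_Dist is_functor_def)
qed

lemma mult_functor:
  assumes A: "is_qcat Q A"
  shows "is_functor (P0 Q (P0 Q A)) (P0 Q A) (presheaf_mult Q A)"
proof (rule functorI)
  note P = P0_qcat[OF A] and PP = P0_qcat[OF P0_qcat[OF A]] and i = fid_functor[OF P0_qcat[OF A]]
  show "is_qcat Q (P0 Q (P0 Q A))" "is_qcat Q (P0 Q A)" by fact+
  show "fsrc (presheaf_mult Q A) = P0 Q (P0 Q A)" "ftgt (presheaf_mult Q A) = P0 Q A"
    "fmap (presheaf_mult Q A) \<in> extensional (obj (P0 Q (P0 Q A)))"
    by (auto simp: presheaf_mult_def)
  fix x assume x: "x \<in> obj (P0 Q (P0 Q A))"
  have cx: "is_colim Q (decode Q (P0 Q A) x) (fid (P0 Q A)) (fmap (presheaf_mult Q A) x)"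
    using P0_colim[OF decode_psh[OF P x] i A] by (simp add: mult_map[OF A x])
  note ox = colim_obj[OF decode_psh[OF P x] i cx] colim_ty[OF decode_psh[OF P x] i cx]
  show "fmap (presheaf_mult Q A) x \<in> obj (P0 Q A)" "ty (P0 Q A) (fmap (presheaf_mult Q A) x) = ty (P0 Q (P0 Q A)) x"
    using ox x by (auto simp: P0_ty)
  fix y assume y: "y \<in> obj (P0 Q (P0 Q A))"
  have cy: "is_colim Q (decode Q (P0 Q A) y) (fid (P0 Q A)) (fmap (presheaf_mult Q A) y)"
    using P0_colim[OF decode_psh[OF P y] i A] by (simp add: mult_map[OF A y])
  let ?mx = "fmap (presheaf_mult Q A) x" and ?my = "fmap (presheaf_mult Q A) y"
  let ?h = "hom (P0 Q (P0 Q A)) y x"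
  note h = P0_hom_arr[OF P x y]
  have "val (P0 Q A) y a \<cdot> ?h \<preceq>\<^bsub>ptp (P0 Q A) x, ty (P0 Q A) a\<^esub> hom (P0 Q A) a ?mx" if a: "a \<in> obj (P0 Q A)" for a
  proof -
    \<comment> \<open>Testing the colimit property with this identity yields the cocone
      \<open>x(a)\<close> below \<open>P(A)(a, M x)\<close>.\<close>
    have i1: "Ident Q (ptp (P0 Q A) x) \<preceq>\<^bsub>ptp (P0 Q A) x, ptp (P0 Q A) x\<^esub> hom (P0 Q A) ?mx ?mx"
      using qcat_ident[OF P ox(1)] ox(2) by simp
    have "val (P0 Q A) x a \<cdot> Ident Q (ptp (P0 Q A) x) \<preceq>\<^bsub>ptp (P0 Q A) x, ty (P0 Q A) a\<^esub> hom (P0 Q A) a ?mx"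
      using colim_le_iff[OF decode_psh[OF P x] i cx ox(1)] i1 ident_arr[OF ptp_Ob[OF P x]] ox(2) a
      by (simp add: fid_map)
    then have "val (P0 Q A) x a \<preceq>\<^bsub>ptp (P0 Q A) x, ty (P0 Q A) a\<^esub> hom (P0 Q A) a ?mx"
      using comp_ident(2)[OF val_arr[OF P x a]] by simp
    then show ?thesis using val_comp_hom[OF P x y a] by (metis arr_le_trans)
  qed
  then show "hom (P0 Q (P0 Q A)) y x \<preceq>\<^bsub>ty (P0 Q (P0 Q A)) x,ty (P0 Q (P0 Q A)) y\<^esub> hom (P0 Q A) ?my ?mx"
    using colim_le_iff[OF decode_psh[OF P y] i cy ox(1)] h ox(2) x y by (simp add: P0_ty fid_map)
qed

lemma presheaf_two_functor: "two_functor Q (presheaf_functor Q)"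
  by (rule two_functorI) (auto simp: presheaf_functor_def P1_fid P1_fcomp intro: P0_qcat P1_functor P1_mono)

lemma id2_two_functor: "two_functor Q id2"
  by (rule two_functorI) (auto simp: id2_def fid_map fcomp_map fle_iff)

lemma fiso_trans: "fiso Q F G \<Longrightarrow> fiso Q G H \<Longrightarrow> is_functor A B F \<Longrightarrow> is_functor A B G \<Longrightarrow> is_functor A B H \<Longrightarrow> fiso Q F H"
  by (auto simp: fiso_iff intro: obj_iso_trans)

text \<open>Apply \<open>S\<close> to the isomorphism that belongs to \<open>T\<close>, which is
  possible because \<open>S\<close> is monotone on functors, and chain with the one that belongs to
  \<open>S\<close>.\<close>

lemma comp2_two_functor:
  assumes S: "two_functor Q S" and T: "two_functor Q T"
  shows "two_functor Q (comp2 S T)"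
proof -
  note Sf = two_functor_functor[OF S] and Tf = two_functor_functor[OF T]
  have "fiso Q (map1 S (map1 T (fid A))) (fid (map0 S (map0 T A)))" if A: "is_qcat Q A" for A
  proof -
    note i = fid_functor[OF A] and TA = two_functor_qcat[OF T A]
    note iT = fid_functor[OF TA]
    show ?thesis
      by (rule fiso_trans[OF two_functor_fiso[OF S Tf[OF i] iT two_functor_fid[OF T A]] two_functor_fid[OF S TA]
            Sf[OF Tf[OF i]] Sf[OF iT] fid_functor[OF two_functor_qcat[OF S TA]]])
  qed
  moreover have "fiso Q (map1 S (map1 T (G \<circ>\<^sub>f F))) (map1 S (map1 T G) \<circ>\<^sub>f map1 S (map1 T F))"
    if F: "is_functor A B F" and G: "is_functor B C G" for A B C F G
  proof -
    note GF = Tf[OF fcomp_functor[OF F G]] and TF = Tf[OF F] and TG = Tf[OF G]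
    show ?thesis
      by (rule fiso_trans[OF two_functor_fiso[OF S GF fcomp_functor[OF TF TG] two_functor_fcomp[OF T F G]]
            two_functor_fcomp[OF S TF TG] Sf[OF GF] Sf[OF fcomp_functor[OF TF TG]] fcomp_functor[OF Sf[OF TF] Sf[OF TG]]])
  qed
  moreover have "fle Q (map1 S (map1 T F)) (map1 S (map1 T G))" if "is_functor A B F" "is_functor A B G" "fle Q F G" for A B F G
    using that by (intro two_functor_mono[OF S Tf Tf] two_functor_mono[OF T])
  moreover note two_functor_qcat[OF S two_functor_qcat[OF T]] Sf[OF Tf]
  ultimately show ?thesis
    unfolding two_functor_def comp2_def by (simp add: Ob_Dist is_functor_def)
qed

end

text \<open>\<open>full_sub_KZ\<close> asserts only that \<mu> and \<eta> exist. A choice is fixed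
  here because the notion of algebra refers to it and the characterisation by algebras is claimed
  for every choice.\<close>

locale sub_doctrine = small_quantaloid Q for Q :: "('u::zf_universe, 'u) quantaloid_data" +
  fixes T :: "'u two_fun" and \<epsilon> \<mu> \<eta> :: "'u trans"
  assumes sub_KZ: "full_sub_KZ Q T \<epsilon>"
    and fac: "factorisation Q T \<epsilon> \<mu> \<eta>"
begin

lemma T_two: "two_functor Q T"
  using sub_KZ by (simp add: full_sub_KZ_def)

lemmas T_qcat = two_functor_qcat[OF T_two]

lemmas T_functor = two_functor_functor[OF T_two]

lemma T_comp:
  assumes F: "is_functor A B F" and G: "is_functor B C G" and t: "t \<in> obj (map0 T A)"
  shows "obj_iso (map0 T C) (fmap (map1 T (G \<circ>\<^sub>f F)) t) (fmap (map1 T G) (fmap (map1 T F) t))"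
proof -
  from fiso_obj[OF two_functor_fcomp[OF T_two F G] T_functor[OF fcomp_functor[OF F G]] fcomp_functor[OF T_functor[OF F] T_functor[OF G]] t]
  show ?thesis by (simp add: fcomp_map[OF T_functor[OF F] t])
qed

lemma T_mono:
  assumes F: "is_functor A B F" and G: "is_functor A B G" and le: "fle Q F G" and t: "t \<in> obj (map0 T A)"
  shows "obj_le (map0 T B) (fmap (map1 T F) t) (fmap (map1 T G) t)"
  using two_functor_mono[OF T_two F G le] t by (simp add: fle_iff[OF T_functor[OF F] T_functor[OF G]])

lemma T_id:
  assumes A: "is_qcat Q A" and t: "t \<in> obj (map0 T A)"
  shows "obj_iso (map0 T A) (fmap (map1 T (fid A)) t) t"
  using fiso_obj[OF two_functor_fid[OF T_two A] T_functor[OF fid_functor[OF A]] fid_functor[OF T_qcat[OF A]] t]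
  by (simp add: fid_map[OF t])

lemma eps_two_natural: "two_natural Q T (presheaf_functor Q) \<epsilon>"
  using sub_KZ by (simp add: full_sub_KZ_def)

lemma eps_functor: "is_qcat Q A \<Longrightarrow> is_functor (map0 T A) (P0 Q A) (\<epsilon> A)"
  using two_natural_functor[OF eps_two_natural presheaf_two_functor T_two]
  by (simp add: presheaf_functor_def)

lemma eps_ff: "is_qcat Q A \<Longrightarrow> fully_faithful (\<epsilon> A)"
  using sub_KZ by (simp add: full_sub_KZ_def Ob_Dist)

lemma eps_hom:
  assumes "is_qcat Q A" "t \<in> obj (map0 T A)" "s \<in> obj (map0 T A)"
  shows "hom (P0 Q A) (fmap (\<epsilon> A) s) (fmap (\<epsilon> A) t) = hom (map0 T A) s t"
  using eps_ff[OF assms(1)] assms(2,3) functor_src[OF eps_functor[OF assms(1)]]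
  by (simp add: fully_faithful_def)

lemma eps_obj: "is_qcat Q A \<Longrightarrow> t \<in> obj (map0 T A) \<Longrightarrow> fmap (\<epsilon> A) t \<in> obj (P0 Q A)"
  using functor_obj[OF eps_functor] .

lemma eps_ptp: "is_qcat Q A \<Longrightarrow> t \<in> obj (map0 T A) \<Longrightarrow> ptp A (fmap (\<epsilon> A) t) = ty (map0 T A) t"
  using functor_ptp[OF eps_functor] .

lemma eps_psh: "is_qcat Q A \<Longrightarrow> t \<in> obj (map0 T A) \<Longrightarrow> is_psh A (decode Q A (fmap (\<epsilon> A) t))"
  using decode_psh eps_obj by blast

lemma eps_nat:
  assumes F: "is_functor A B F" and t: "t \<in> obj (map0 T A)"
  shows "fmap (\<epsilon> B) (fmap (map1 T F) t) = fmap (P1 Q F) (fmap (\<epsilon> A) t)"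
  using two_natural_obj[OF eps_two_natural presheaf_two_functor T_two F t] P0_iso_eq functor_qcat(2)[OF F]
  by (simp add: presheaf_functor_def)

lemma mu_functor: "is_qcat Q A \<Longrightarrow> is_functor (map0 T (map0 T A)) (map0 T A) (\<mu> A)"
  using two_natural_functor[OF _ T_two comp2_two_functor[OF T_two T_two], of \<mu> A] fac
  by (simp add: factorisation_def comp2_def)

lemma eta_functor: "is_qcat Q A \<Longrightarrow> is_functor A (map0 T A) (\<eta> A)"
  using two_natural_functor[OF _ T_two id2_two_functor, of \<eta> A] fac
  by (simp add: factorisation_def id2_def)

lemma eta_nat:
  assumes F: "is_functor A B F" and a: "a \<in> obj A"
  shows "obj_iso (map0 T B) (fmap (\<eta> B) (fmap F a)) (fmap (map1 T F) (fmap (\<eta> A) a))"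
  using two_natural_obj[OF _ T_two id2_two_functor F, of \<eta> a] fac a
  by (simp add: factorisation_def id2_def)

text \<open>The factorisation of the multiplication, read through \<open>mult_colim\<close>. All
  later reasoning about \<mu> starts from this form.\<close>

lemma eps_mu:
  assumes A: "is_qcat Q A" and t: "t \<in> obj (map0 T (map0 T A))"
  shows "is_colim Q (decode Q (map0 T A) (fmap (\<epsilon> (map0 T A)) t)) (\<epsilon> A) (fmap (\<epsilon> A) (fmap (\<mu> A) t))"
proof -
  note TA = T_qcat[OF A]
  note e = eps_functor[OF A] eps_functor[OF TA]
  note Pe = P1_functor[OF e(1)]
  note M = mult_functor[OF A]
  have "fiso Q (presheaf_mult Q A \<circ>\<^sub>f (P1 Q (\<epsilon> A) \<circ>\<^sub>f \<epsilon> (map0 T A))) (\<epsilon> A \<circ>\<^sub>f \<mu> A)"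
    using fac A by (auto simp: factorisation_def Ob_Dist)
  from fiso_obj[OF this fcomp_functor[OF fcomp_functor[OF e(2) Pe] M] fcomp_functor[OF mu_functor[OF A] e(1)] t]
  have "fmap (presheaf_mult Q A) (fmap (P1 Q (\<epsilon> A)) (fmap (\<epsilon> (map0 T A)) t)) = fmap (\<epsilon> A) (fmap (\<mu> A) t)"
    using P0_iso_eq[OF A] t
    by (simp add: fcomp_map[OF fcomp_functor[OF e(2) Pe]] fcomp_map[OF e(2)] fcomp_map[OF mu_functor[OF A]])
  then show ?thesis using mult_colim[OF e(1) A eps_obj[OF TA t]] by simp
qed

lemma eps_eta:
  assumes A: "is_qcat Q A" and a: "a \<in> obj A"
  shows "fmap (\<epsilon> A) (fmap (\<eta> A) a) = fmap (yoneda Q A) a"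
proof -
  have "fiso Q (yoneda Q A) (\<epsilon> A \<circ>\<^sub>f \<eta> A)"
    using fac A by (auto simp: factorisation_def Ob_Dist)
  from fiso_obj[OF this yoneda_functor[OF A] fcomp_functor[OF eta_functor[OF A] eps_functor[OF A]] a]
  show ?thesis using P0_iso_eq[OF A] by (simp add: fcomp_map[OF eta_functor[OF A] a]) metis
qed

lemma eta_obj: "is_qcat Q A \<Longrightarrow> a \<in> obj A \<Longrightarrow> fmap (\<eta> A) a \<in> obj (map0 T A)"
  using functor_obj[OF eta_functor] .

text \<open>The Yoneda lemma, transported along the fully faithful \<epsilon>, which sends
  \<open>\<eta> a\<close> to the representable at \<open>a\<close>.\<close>

lemma hom_eta:
  assumes A: "is_qcat Q A" and a: "a \<in> obj A" and t: "t \<in> obj (map0 T A)"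
  shows "hom (map0 T A) (fmap (\<eta> A) a) t = val A (fmap (\<epsilon> A) t) a"
  using eps_hom[OF A t eta_obj[OF A a]] yoneda_lemma[OF A a eps_obj[OF A t]] by (simp add: eps_eta[OF A a])

lemma eta_ff: "is_qcat Q A \<Longrightarrow> a \<in> obj A \<Longrightarrow> a' \<in> obj A \<Longrightarrow>
    hom (map0 T A) (fmap (\<eta> A) a') (fmap (\<eta> A) a) = hom A a' a"
  by (simp add: hom_eta eta_obj eps_eta yoneda_val)

text \<open>The class is a union over all Q-categories, but a presheaf records its base in
  \<open>dtgt\<close>, so only the summand of \<open>A\<close> can contribute.\<close>

lemma doctrine_class_iff:
  assumes A: "is_qcat Q A" and p: "is_psh A \<phi>"
  shows "\<phi> \<in> doctrine_class Q T \<epsilon> \<longleftrightarrow> (\<exists>t\<in>obj (map0 T A). \<phi> = decode Q A (fmap (\<epsilon> A) t))"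
proof
  assume "\<phi> \<in> doctrine_class Q T \<epsilon>"
  then obtain B t where B: "is_qcat Q B" "t \<in> obj (map0 T B)" "\<phi> = decode Q B (fmap (\<epsilon> B) t)"
    by (auto simp: doctrine_class_def Ob_Dist)
  then have "A = B" using psh_tgt(1)[OF p] psh_tgt(1)[OF eps_psh[OF B(1,2)]] by simp
  then show "\<exists>t\<in>obj (map0 T A). \<phi> = decode Q A (fmap (\<epsilon> A) t)" using B by blast
next
  assume "\<exists>t\<in>obj (map0 T A). \<phi> = decode Q A (fmap (\<epsilon> A) t)"
  then show "\<phi> \<in> doctrine_class Q T \<epsilon>" using A by (auto simp: doctrine_class_def Ob_Dist)
qed

lemma doctrine_class_decode:
  assumes A: "is_qcat Q A" and x: "x \<in> obj (P0 Q A)"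
  shows "decode Q A x \<in> doctrine_class Q T \<epsilon> \<longleftrightarrow> (\<exists>t\<in>obj (map0 T A). x = fmap (\<epsilon> A) t)"
  using doctrine_class_iff[OF A decode_psh[OF A x]] code_decode[OF A x] code_decode[OF A eps_obj[OF A]] by metis

lemma doctrine_class_psh: "doctrine_class Q T \<epsilon> \<subseteq> presheaves Q"
  using eps_psh by (auto simp: doctrine_class_def presheaves_def Ob_Dist is_psh_def)

text \<open>After applying \<epsilon> the claim is an inequality of presheaves on
  \<open>T(A)\<close>. At \<open>s\<close> the left one is the join over \<open>a\<close> of
  \<open>T(A)(s, \<eta> a) \<cdot> \<epsilon>(t)(a)\<close> and the right one is
  \<open>T(A)(s, t)\<close>. By \<open>hom_eta\<close> the factor \<open>\<epsilon>(t)(a)\<close> is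
  \<open>T(A)(\<eta> a, t)\<close>, so the claim is composition in \<open>T(A)\<close>.\<close>

lemma KZ:
  assumes A: "is_qcat Q A" and t: "t \<in> obj (map0 T A)"
  shows "obj_le (map0 T (map0 T A)) (fmap (map1 T (\<eta> A)) t) (fmap (\<eta> (map0 T A)) t)"
proof -
  note TA = T_qcat[OF A] and e = eta_functor[OF A]
  note et = eps_obj[OF A t] and y = yoneda_obj[OF TA t]
  note Pe = functor_obj[OF P1_functor[OF e] et]
  have pt: "ptp (map0 T A) (fmap (P1 Q (\<eta> A)) (fmap (\<epsilon> A) t)) = ty (map0 T A) t"
    using P1_ptp[OF e et] eps_ptp[OF A t] by simp
  have "val (map0 T A) (fmap (P1 Q (\<eta> A)) (fmap (\<epsilon> A) t)) s \<preceq>\<^bsub>ty (map0 T A) t, ty (map0 T A) s\<^esub> hom (map0 T A) s t"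
    if s: "s \<in> obj (map0 T A)" for s
  proof -
    have "hom (map0 T A) s (fmap (\<eta> A) a) \<cdot> val A (fmap (\<epsilon> A) t) a \<preceq>\<^bsub>ty (map0 T A) t, ty (map0 T A) s\<^esub> hom (map0 T A) s t"
      if a: "a \<in> obj A" for a
      using qcat_comp[OF TA t eta_obj[OF A a] s] by (simp add: hom_eta[OF A a t])
    then show ?thesis
      using act_le_iff[OF graph_dist[OF e] et s, of "hom (map0 T A) s t"] qcat_hom[OF TA t s] s
      by (simp add: P1_map[OF e et] eps_ptp[OF A t] graph_dmat[OF e])
  qed
  then have "obj_le (P0 Q (map0 T A)) (fmap (P1 Q (\<eta> A)) (fmap (\<epsilon> A) t)) (fmap (yoneda Q (map0 T A)) t)"
    using P0_obj_le_iff[OF TA Pe y] by (simp add: pt yoneda_ptp[OF TA t] yoneda_val[OF TA t])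
  then show ?thesis
    using eps_nat[OF e t] eps_eta[OF TA t]
    by (intro ff_obj_le[OF eps_functor[OF TA] eps_ff[OF TA] functor_obj[OF T_functor[OF e] t] eta_obj[OF TA t]]) simp
qed

section \<open>Algebras as left adjoints of the unit\<close>

definition adjoint :: "'u qcat \<Rightarrow> 'u qfun \<Rightarrow> bool" where
  "adjoint B L \<longleftrightarrow> is_functor (map0 T B) B L \<and>
    (\<forall>t\<in>obj (map0 T B). \<forall>b\<in>obj B. hom B (fmap L t) b = hom (map0 T B) t (fmap (\<eta> B) b))"

text \<open>The counit is the isomorphism between \<open>L \<circ>\<^sub>f \<eta> B\<close> and the
  identity. The unit of the adjunction is produced from \<open>KZ\<close>, and full faithfulness of
  \<eta> converts unit and counit into an equality of homs.\<close>

lemma algebra_adjoint: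
  assumes "is_algebra Q T \<mu> \<eta> B L"
  shows "adjoint B L"
  unfolding adjoint_def
proof (intro conjI ballI)
  have B: "is_qcat Q B" using assms by (simp add: is_algebra_def Ob_Dist)
  note TB = T_qcat[OF B] and e = eta_functor[OF B]
  show L: "is_functor (map0 T B) B L" using assms TB B by (simp add: is_algebra_def is_functor_def)
  note Le = fcomp_functor[OF e L]
  have un: "fiso Q (L \<circ>\<^sub>f \<eta> B) (fid B)" using assms by (simp add: is_algebra_def)
  then have un': "obj_iso B (fmap L (fmap (\<eta> B) b)) b" if "b \<in> obj B" for b
    using fiso_obj[OF un Le fid_functor[OF B] that] that by (simp add: fcomp_map[OF e] fid_map)
  fix t b assume t: "t \<in> obj (map0 T B)" and b: "b \<in> obj B"
  note Lt = functor_obj[OF L t] and tL = functor_ty[OF L t]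
  \<comment> \<open>The unit is the chain \<open>t\<close>, \<open>T(L \<eta>)(t)\<close>,
    \<open>T(L)(T(\<eta>)(t))\<close>, \<open>T(L)(\<eta>(t))\<close>, \<open>\<eta>(L t)\<close>;
    only the step by \<open>KZ\<close> is not an isomorphism.\<close>
  have "obj_le (map0 T B) t (fmap (map1 T (fid B)) t)"
    using T_id[OF B t] by (simp add: obj_iso_def)
  also have "obj_le (map0 T B) (fmap (map1 T (fid B)) t) (fmap (map1 T (L \<circ>\<^sub>f \<eta> B)) t)"
    using un by (intro T_mono[OF fid_functor[OF B] Le _ t]) (simp add: fiso_def)
  also have "obj_le (map0 T B) (fmap (map1 T (L \<circ>\<^sub>f \<eta> B)) t) (fmap (map1 T L) (fmap (map1 T (\<eta> B)) t))"
    using T_comp[OF e L t] by (simp add: obj_iso_def)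
  also have "obj_le (map0 T B) (fmap (map1 T L) (fmap (map1 T (\<eta> B)) t)) (fmap (map1 T L) (fmap (\<eta> (map0 T B)) t))"
    by (rule functor_obj_le[OF T_functor[OF L] KZ[OF B t]])
  also have "obj_le (map0 T B) (fmap (map1 T L) (fmap (\<eta> (map0 T B)) t)) (fmap (\<eta> B) (fmap L t))"
    using eta_nat[OF L t] by (simp add: obj_iso_def)
  finally have le: "obj_le (map0 T B) t (fmap (\<eta> B) (fmap L t))" .
  show "hom B (fmap L t) b = hom (map0 T B) t (fmap (\<eta> B) b)"
  proof (rule arr_le_antisym)
    have "hom B (fmap L t) b = hom (map0 T B) (fmap (\<eta> B) (fmap L t)) (fmap (\<eta> B) b)"
      by (simp add: eta_ff[OF B b Lt])
    also have "\<dots> \<preceq>\<^bsub>ty B b, ty (map0 T B) t\<^esub> hom (map0 T B) t (fmap (\<eta> B) b)"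
      using obj_le_hom_left[OF le eta_obj[OF B b]] functor_ty[OF e b] by simp
    finally show "hom B (fmap L t) b \<preceq>\<^bsub>ty B b, ty (map0 T B) t\<^esub> hom (map0 T B) t (fmap (\<eta> B) b)" .
    have "hom (map0 T B) t (fmap (\<eta> B) b) \<preceq>\<^bsub>ty B b, ty (map0 T B) t\<^esub> hom B (fmap L t) (fmap L (fmap (\<eta> B) b))"
      using functor_hom[OF L eta_obj[OF B b] t] functor_ty[OF e b] by simp
    also have "\<dots> = hom B (fmap L t) b" by (rule obj_iso_hom_right[OF un'[OF b] Lt])
    finally show "hom (map0 T B) t (fmap (\<eta> B) b) \<preceq>\<^bsub>ty B b, ty (map0 T B) t\<^esub> hom B (fmap L t) b" .
  qed
qed

text \<open>Adjointness and full faithfulness rewrite \<open>B(L(T(F)(t)), b)\<close> as the hom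
  from \<open>Y b\<close> to \<open>P(F)(\<epsilon>(t))\<close> in the presheaf category. The arrows
  below it are described by \<open>P0_le_hom\<close>, and \<open>P1_comp_le_iff\<close> turns that
  description into the colimit condition for \<open>F\<close>.\<close>

lemma adjoint_colim:
  assumes L: "adjoint B L" and F: "is_functor A B F" and t: "t \<in> obj (map0 T A)"
  shows "is_colim Q (decode Q A (fmap (\<epsilon> A) t)) F (fmap L (fmap (map1 T F) t))"
proof -
  note A = functor_qcat(1)[OF F] and B = functor_qcat(2)[OF F]
  have Lf: "is_functor (map0 T B) B L" using L by (simp add: adjoint_def)
  note s = functor_obj[OF T_functor[OF F] t]
  note et = eps_obj[OF A t]
  note Pe = functor_obj[OF P1_functor[OF F] et]
  have tt: "ty B (fmap L (fmap (map1 T F) t)) = ptp A (fmap (\<epsilon> A) t)"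
    using functor_ty[OF Lf s] functor_ty[OF T_functor[OF F] t] eps_ptp[OF A t] by simp
  have tp: "ptp B (fmap (P1 Q F) (fmap (\<epsilon> A) t)) = ptp A (fmap (\<epsilon> A) t)" by (rule P1_ptp[OF F et])
  show ?thesis
    unfolding is_colim_iff[OF eps_psh[OF A t] F]
  proof (intro conjI ballI allI impI)
    show "fmap L (fmap (map1 T F) t) \<in> obj B" by (rule functor_obj[OF Lf s])
    show "ty B (fmap L (fmap (map1 T F) t)) = ptp A (fmap (\<epsilon> A) t)" by (rule tt)
    fix b h assume b: "b \<in> obj B" and h: "arr (ty B b) (ptp A (fmap (\<epsilon> A) t)) h"
    have "hom B (fmap L (fmap (map1 T F) t)) b = hom (map0 T B) (fmap (map1 T F) t) (fmap (\<eta> B) b)"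
      using L s b by (simp add: adjoint_def)
    also have "\<dots> = hom (P0 Q B) (fmap (P1 Q F) (fmap (\<epsilon> A) t)) (fmap (yoneda Q B) b)"
      using eps_hom[OF B eta_obj[OF B b] s] by (simp add: eps_eta[OF B b] eps_nat[OF F t])
    finally have e: "hom B (fmap L (fmap (map1 T F) t)) b = \<dots>" .
    \<comment> \<open>Writing \<open>b'\<close> as \<open>fmap (fid B) b'\<close> prepares for
      \<open>P1_comp_le_iff\<close> with the identity as second functor.\<close>
    have "h \<preceq>\<^bsub>ty B b,ptp A (fmap (\<epsilon> A) t)\<^esub> hom (P0 Q B) (fmap (P1 Q F) (fmap (\<epsilon> A) t)) (fmap (yoneda Q B) b) \<longleftrightarrow>
      (\<forall>b'\<in>obj B. val B (fmap (P1 Q F) (fmap (\<epsilon> A) t)) b' \<cdot> h \<preceq>\<^bsub>ty B b, ty B b'\<^esub> hom B (fmap (fid B) b') b)"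
      using P0_le_hom[OF B yoneda_obj[OF B b] Pe] h by (simp add: yoneda_ptp[OF B b] tp yoneda_val[OF B b] fid_map)
    also have "\<dots> \<longleftrightarrow> (\<forall>a\<in>obj A. val A (fmap (\<epsilon> A) t) a \<cdot> h \<preceq>\<^bsub>ty B b,ty A a\<^esub> hom B (fmap F a) b)"
      using P1_comp_le_iff[OF F fid_functor[OF B] et b h] functor_obj[OF F] by (simp add: fid_map)
    finally show "h \<preceq>\<^bsub>ty B b,ptp A (fmap (\<epsilon> A) t)\<^esub> hom B (fmap L (fmap (map1 T F) t)) b \<longleftrightarrow>
      (\<forall>a\<in>obj A. val A (fmap (\<epsilon> A) t) a \<cdot> h \<preceq>\<^bsub>ty B b,ty A a\<^esub> hom B (fmap F a) b)"
      unfolding e .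
  qed
qed

text \<open>For the associative law, both \<open>L(\<mu>(t))\<close> and \<open>L(T(L)(t))\<close>
  are colimits of \<open>L\<close> weighted by \<open>\<epsilon>(t)\<close>, so uniqueness of
  colimits makes them isomorphic.\<close>

lemma adjoint_algebra:
  assumes L: "adjoint B L"
  shows "is_algebra Q T \<mu> \<eta> B L"
proof -
  have Lf: "is_functor (map0 T B) B L" using L by (simp add: adjoint_def)
  note B = functor_qcat(2)[OF Lf]
  note TB = T_qcat[OF B] and e = eta_functor[OF B] and m = mu_functor[OF B]
  have adj: "hom B (fmap L t) b = hom (map0 T B) t (fmap (\<eta> B) b)" if "t \<in> obj (map0 T B)" "b \<in> obj B" for t b
    using L that by (simp add: adjoint_def)
  have "fiso Q (L \<circ>\<^sub>f \<eta> B) (fid B)"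
    unfolding fiso_iff[OF fcomp_functor[OF e Lf] fid_functor[OF B]]
  proof
    fix b assume b: "b \<in> obj B"
    have "obj_iso B (fmap L (fmap (\<eta> B) b)) b"
    proof (rule obj_isoI_left[OF B functor_obj[OF Lf eta_obj[OF B b]] b])
      show "ty B b = ty B (fmap L (fmap (\<eta> B) b))"
        using functor_ty[OF Lf eta_obj[OF B b]] functor_ty[OF e b] by simp
      show "hom B (fmap L (fmap (\<eta> B) b)) x = hom B b x" if "x \<in> obj B" for x
        using adj[OF eta_obj[OF B b] that] eta_ff[OF B that b] by simp
    qed
    then show "obj_iso B (fmap (L \<circ>\<^sub>f \<eta> B) b) (fmap (fid B) b)"
      using b by (simp add: fcomp_map[OF e] fid_map)
  qed
  moreover have "fiso Q (L \<circ>\<^sub>f \<mu> B) (L \<circ>\<^sub>f map1 T L)"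
    unfolding fiso_iff[OF fcomp_functor[OF m Lf] fcomp_functor[OF T_functor[OF Lf] Lf]]
  proof
    fix t assume t: "t \<in> obj (map0 T (map0 T B))"
    note mt = functor_obj[OF m t] and et = eps_psh[OF TB t]
    \<comment> \<open>Since \<open>B(L s, b)\<close> equals \<open>P(B)(\<epsilon>(s), Y b)\<close>,
      this is the colimit property of \<open>\<epsilon>(\<mu>(t))\<close> from
      \<open>eps_mu\<close>, tested at the representables only.\<close>
    have "is_colim Q (decode Q (map0 T B) (fmap (\<epsilon> (map0 T B)) t)) L (fmap L (fmap (\<mu> B) t))"
      unfolding is_colim_iff[OF et Lf]
    proof (intro conjI ballI allI impI)
      show "fmap L (fmap (\<mu> B) t) \<in> obj B" by (rule functor_obj[OF Lf mt])
      show ty: "ty B (fmap L (fmap (\<mu> B) t)) = ptp (map0 T B) (fmap (\<epsilon> (map0 T B)) t)"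
        using functor_ty[OF Lf mt] functor_ty[OF m t] eps_ptp[OF TB t] by simp
      fix b h assume b: "b \<in> obj B" and h: "arr (ty B b) (ptp (map0 T B) (fmap (\<epsilon> (map0 T B)) t)) h"
      have "hom B (fmap L (fmap (\<mu> B) t)) b = hom (P0 Q B) (fmap (\<epsilon> B) (fmap (\<mu> B) t)) (fmap (yoneda Q B) b)"
        using adj[OF mt b] eps_hom[OF B eta_obj[OF B b] mt] by (simp add: eps_eta[OF B b])
      moreover have "hom B (fmap L s) b = hom (P0 Q B) (fmap (\<epsilon> B) s) (fmap (yoneda Q B) b)" if s: "s \<in> obj (map0 T B)" for s
        using adj[OF s b] eps_hom[OF B eta_obj[OF B b] s] by (simp add: eps_eta[OF B b])
      moreover have "ty (P0 Q B) (fmap (yoneda Q B) b) = ty B b"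
        using yoneda_ptp[OF B b] P0_ty[OF yoneda_obj[OF B b]] by simp
      ultimately show "h \<preceq>\<^bsub>ty B b,ptp (map0 T B) (fmap (\<epsilon> (map0 T B)) t)\<^esub> hom B (fmap L (fmap (\<mu> B) t)) b \<longleftrightarrow>
        (\<forall>s\<in>obj (map0 T B). val (map0 T B) (fmap (\<epsilon> (map0 T B)) t) s \<cdot> h \<preceq>\<^bsub>ty B b,ty (map0 T B) s\<^esub> hom B (fmap L s) b)"
        using colim_le_iff[OF et eps_functor[OF B] eps_mu[OF B t] yoneda_obj[OF B b]] h by simp
    qed
    from colim_unique[OF et Lf this adjoint_colim[OF L Lf t]]
    show "obj_iso B (fmap (L \<circ>\<^sub>f \<mu> B) t) (fmap (L \<circ>\<^sub>f map1 T L) t)"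
      by (simp add: fcomp_map[OF m t] fcomp_map[OF T_functor[OF Lf] t])
  qed
  ultimately show ?thesis using Lf B by (simp add: is_algebra_def is_functor_def Ob_Dist)
qed

text \<open>An algebra computes all the colimits by \<open>adjoint_colim\<close>. Conversely, the
  colimits of the identity functor with weights from the doctrine assemble to a left adjoint of
  \<eta>.\<close>

lemma algebra_iff_cocomplete:
  assumes B: "is_qcat Q B"
  shows "(\<exists>L. is_algebra Q T \<mu> \<eta> B L) \<longleftrightarrow> cocomplete Q (doctrine_class Q T \<epsilon>) B"
proof
  assume "\<exists>L. is_algebra Q T \<mu> \<eta> B L"
  then obtain L where L: "adjoint B L" using algebra_adjoint by blast
  show "cocomplete Q (doctrine_class Q T \<epsilon>) B"
    unfolding cocomplete_def
  proof (intro ballI)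
    fix A \<phi> F assume A: "A \<in> Ob (Dist Q)" and p: "\<phi> \<in> presheaves_on Q A \<inter> doctrine_class Q T \<epsilon>"
      and "F \<in> functors Q A B"
    then have F: "is_functor A B F" using B by (simp add: is_functor_def Ob_Dist)
    have "is_psh A \<phi>" using p A by (simp add: is_psh_def Ob_Dist)
    then obtain t where "t \<in> obj (map0 T A)" "\<phi> = decode Q A (fmap (\<epsilon> A) t)"
      using doctrine_class_iff p A by (auto simp: Ob_Dist)
    then show "\<exists>c. is_colim Q \<phi> F c" using adjoint_colim[OF L F] by blast
  qed
next
  assume coc: "cocomplete Q (doctrine_class Q T \<epsilon>) B"
  note TB = T_qcat[OF B] and i = fid_functor[OF B] and e = eta_functor[OF B]
  have "\<exists>c. is_colim Q (decode Q B (fmap (\<epsilon> B) t)) (fid B) c" if t: "t \<in> obj (map0 T B)" for t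
    using coc eps_psh[OF B t] doctrine_class_iff[OF B eps_psh[OF B t]] t i B
    unfolding cocomplete_def is_psh_def is_functor_def Ob_Dist by blast
  then obtain l where l: "\<And>t. t \<in> obj (map0 T B) \<Longrightarrow> is_colim Q (decode Q B (fmap (\<epsilon> B) t)) (fid B) (l t)"
    by metis
  note lo = colim_obj[OF eps_psh[OF B] i l] and lt = colim_ty[OF eps_psh[OF B] i l]
  \<comment> \<open>The colimit condition for the identity diagram and the description of
    \<open>P(B)(\<epsilon>(t), Y b)\<close> by \<open>P0_le_hom\<close> admit the same arrows
    \<open>h\<close>.\<close>
  have adj: "hom B (l t) b = hom (map0 T B) t (fmap (\<eta> B) b)" if t: "t \<in> obj (map0 T B)" and b: "b \<in> obj B" for t b
  proof (rule arr_eqI)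
    show "arr (ty B b) (ptp B (fmap (\<epsilon> B) t)) (hom B (l t) b)" using qcat_hom[OF B b lo[OF t t]] lt[OF t t] by simp
    show "arr (ty B b) (ptp B (fmap (\<epsilon> B) t)) (hom (map0 T B) t (fmap (\<eta> B) b))"
      using qcat_hom[OF TB eta_obj[OF B b] t] functor_ty[OF e b] eps_ptp[OF B t] by simp
    fix h assume h: "arr (ty B b) (ptp B (fmap (\<epsilon> B) t)) h"
    have "h \<preceq>\<^bsub>ty B b, ptp B (fmap (\<epsilon> B) t)\<^esub> hom (P0 Q B) (fmap (\<epsilon> B) t) (fmap (yoneda Q B) b) \<longleftrightarrow>
      (\<forall>b'\<in>obj B. val B (fmap (\<epsilon> B) t) b' \<cdot> h \<preceq>\<^bsub>ty B b, ty B b'\<^esub> hom B b' b)"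
      using P0_le_hom[OF B yoneda_obj[OF B b] eps_obj[OF B t]] h by (simp add: yoneda_ptp[OF B b] yoneda_val[OF B b])
    then show "h \<preceq>\<^bsub>ty B b, ptp B (fmap (\<epsilon> B) t)\<^esub> hom B (l t) b \<longleftrightarrow>
        h \<preceq>\<^bsub>ty B b, ptp B (fmap (\<epsilon> B) t)\<^esub> hom (map0 T B) t (fmap (\<eta> B) b)"
      using colim_le_iff[OF eps_psh[OF B t] i l[OF t] b h] eps_hom[OF B eta_obj[OF B b] t]
      by (simp add: fid_map eps_eta[OF B b])
  qed
  define L where "L = \<lparr>fsrc = map0 T B, ftgt = B, fmap = (\<lambda>t\<in>obj (map0 T B). l t)\<rparr>"
  have "is_functor (map0 T B) B L"
  proof (rule functorI)
    fix t s assume t: "t \<in> obj (map0 T B)" and s: "s \<in> obj (map0 T B)"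
    \<comment> \<open>Taking \<open>b = l t\<close> in \<open>adj\<close> gives the unit of the
      adjunction, and functoriality of \<open>L\<close> follows from it.\<close>
    have "obj_le (map0 T B) t (fmap (\<eta> B) (l t))"
      using qcat_ident[OF B lo[OF t t]] adj[OF t lo[OF t t]] lt[OF t t] eps_ptp[OF B t] functor_ty[OF e lo[OF t t]]
        TB t eta_obj[OF B lo[OF t t]] by (simp add: obj_le_def)
    then have "hom (map0 T B) s t \<preceq>\<^bsub>ty (map0 T B) t, ty (map0 T B) s\<^esub> hom (map0 T B) s (fmap (\<eta> B) (l t))"
      by (rule obj_le_hom_right[OF _ s])
    then show "hom (map0 T B) s t \<preceq>\<^bsub>ty (map0 T B) t, ty (map0 T B) s\<^esub> hom B (fmap L s) (fmap L t)"
      using adj[OF s lo[OF t t]] s t by (simp add: L_def)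
  qed (use TB B lo lt eps_ptp[OF B] in \<open>auto simp: L_def\<close>)
  then have "adjoint B L" using adj by (simp add: adjoint_def L_def)
  then show "\<exists>L. is_algebra Q T \<mu> \<eta> B L" using adjoint_algebra by blast
qed

text \<open>By \<open>adjoint_colim\<close> the colimits in \<open>B\<close> and \<open>B'\<close>
  are \<open>L(T(F)(t))\<close> and \<open>L'(T(G \<circ>\<^sub>f F)(t))\<close>, so preservation of
  colimits compares \<open>G\<close> after \<open>L\<close> with \<open>L'\<close> after
  \<open>T(G)\<close>. The homomorphism law is the case where \<open>F\<close> is the
  identity.\<close>

lemma algebra_hom_iff_cocontinuous:
  assumes "is_algebra Q T \<mu> \<eta> B L" "is_algebra Q T \<mu> \<eta> B' L'" "G \<in> functors Q B B'"
  shows "is_algebra_hom Q T L L' G \<longleftrightarrow> cocontinuous Q (doctrine_class Q T \<epsilon>) G"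
proof -
  note L = algebra_adjoint[OF assms(1)] and L' = algebra_adjoint[OF assms(2)]
  have Lf: "is_functor (map0 T B) B L" and Lf': "is_functor (map0 T B') B' L'"
    using L L' by (auto simp: adjoint_def)
  note B = functor_qcat(2)[OF Lf] and B' = functor_qcat(2)[OF Lf']
  have G: "is_functor B B' G" using assms(3) B B' by (simp add: is_functor_def)
  note TG = T_functor[OF G]
  have iso: "fiso Q (G \<circ>\<^sub>f L) (L' \<circ>\<^sub>f map1 T G) \<longleftrightarrow>
    (\<forall>t\<in>obj (map0 T B). obj_iso B' (fmap G (fmap L t)) (fmap L' (fmap (map1 T G) t)))"
    unfolding fiso_iff[OF fcomp_functor[OF Lf G] fcomp_functor[OF TG Lf']]
    by (simp add: fcomp_map[OF Lf] fcomp_map[OF TG])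
  show ?thesis
    unfolding is_algebra_hom_def iso
  proof
    assume h: "\<forall>t\<in>obj (map0 T B). obj_iso B' (fmap G (fmap L t)) (fmap L' (fmap (map1 T G) t))"
    show "cocontinuous Q (doctrine_class Q T \<epsilon>) G"
      unfolding cocontinuous_def functor_src[OF G]
    proof (intro ballI allI impI)
      fix A \<phi> F c assume A: "A \<in> Ob (Dist Q)" and p: "\<phi> \<in> presheaves_on Q A \<inter> doctrine_class Q T \<epsilon>"
        and "F \<in> functors Q A B" and c: "is_colim Q \<phi> F c"
      then have F: "is_functor A B F" using B by (simp add: is_functor_def Ob_Dist)
      have ps: "is_psh A \<phi>" using p A by (simp add: is_psh_def Ob_Dist)
      then obtain t where t: "t \<in> obj (map0 T A)" "\<phi> = decode Q A (fmap (\<epsilon> A) t)"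
        using doctrine_class_iff p A by (auto simp: Ob_Dist)
      note s = functor_obj[OF T_functor[OF F] t(1)]
      have "obj_iso B' (fmap L' (fmap (map1 T (G \<circ>\<^sub>f F)) t)) (fmap L' (fmap (map1 T G) (fmap (map1 T F) t)))"
        by (rule functor_obj_iso[OF Lf' T_comp[OF F G t(1)]])
      moreover have "obj_iso B' (fmap L' (fmap (map1 T G) (fmap (map1 T F) t))) (fmap G (fmap L (fmap (map1 T F) t)))"
        using h s by (auto intro: obj_iso_sym)
      moreover have "obj_iso B' (fmap G (fmap L (fmap (map1 T F) t))) (fmap G c)"
        using colim_unique[OF ps F _ c] adjoint_colim[OF L F t(1)] t(2) by (auto intro: functor_obj_iso[OF G])
      ultimately have "obj_iso B' (fmap L' (fmap (map1 T (G \<circ>\<^sub>f F)) t)) (fmap G c)"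
        by (meson obj_iso_trans)
      then show "is_colim Q \<phi> (G \<circ>\<^sub>f F) (fmap G c)"
        using colim_iso[OF ps fcomp_functor[OF F G]] adjoint_colim[OF L' fcomp_functor[OF F G] t(1)] t(2) by blast
    qed
  next
    assume cc: "cocontinuous Q (doctrine_class Q T \<epsilon>) G"
    show "\<forall>t\<in>obj (map0 T B). obj_iso B' (fmap G (fmap L t)) (fmap L' (fmap (map1 T G) t))"
    proof
      fix t assume t: "t \<in> obj (map0 T B)"
      note i = fid_functor[OF B]
      \<comment> \<open>The colimit of the identity is obtained as \<open>L ?s\<close> and not as
        \<open>L t\<close>, because \<open>T\<close> preserves identities only up to isomorphism;
        \<open>T_id\<close> closes the gap at the end.\<close>
      let ?s = "fmap (map1 T (fid B)) t"
      note p = eps_psh[OF B t]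
      have "decode Q B (fmap (\<epsilon> B) t) \<in> presheaves_on Q B \<inter> doctrine_class Q T \<epsilon>"
        using p doctrine_class_iff[OF B p] t by (auto simp: is_psh_def)
      moreover have "fid B \<in> functors Q B (fsrc G)" using i functor_src[OF G] by (simp add: is_functor_def)
      ultimately have "is_colim Q (decode Q B (fmap (\<epsilon> B) t)) (G \<circ>\<^sub>f fid B) (fmap G (fmap L ?s))"
        using cc adjoint_colim[OF L i t] B unfolding cocontinuous_def Ob_Dist by blast
      moreover have "G \<circ>\<^sub>f fid B = G"
        by (rule functor_eqI[OF fcomp_functor[OF i G] G]) (simp add: fcomp_map[OF i] fid_map)
      ultimately have "obj_iso B' (fmap G (fmap L ?s)) (fmap L' (fmap (map1 T G) t))"
        using colim_unique[OF p G _ adjoint_colim[OF L' G t]] by simp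
      moreover have "obj_iso B' (fmap G (fmap L t)) (fmap G (fmap L ?s))"
        by (intro functor_obj_iso[OF G] functor_obj_iso[OF Lf] obj_iso_sym[OF T_id[OF B t]])
      ultimately show "obj_iso B' (fmap G (fmap L t)) (fmap L' (fmap (map1 T G) t))"
        by (rule obj_iso_trans[rotated])
    qed
  qed
qed

end

section \<open>Saturated classes\<close>

context small_quantaloid
begin

text \<open>Any choice of preimages under a fully faithful functor is automatically functorial,
  since all homs can be compared in \<open>D\<close>. It supplies comparison functors, lifted
  diagrams, and the structure of the doctrine of a class.\<close>

lemma ff_factor:
  assumes G: "is_functor A D G" and J: "is_functor B D J" and ff: "fully_faithful J"
    and o: "\<And>a. a \<in> obj A \<Longrightarrow> f a \<in> obj B" and e: "\<And>a. a \<in> obj A \<Longrightarrow> fmap J (f a) = fmap G a"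
  shows "is_functor A B \<lparr>fsrc = A, ftgt = B, fmap = restrict f (obj A)\<rparr>"
proof (rule functorI)
  fix a a' assume a: "a \<in> obj A" and a': "a' \<in> obj A"
  have "hom B (f a') (f a) = hom D (fmap J (f a')) (fmap J (f a))"
    using ff functor_src[OF J] o[OF a] o[OF a'] by (simp add: fully_faithful_def)
  then show "hom A a' a \<preceq>\<^bsub>ty A a,ty A a'\<^esub>
      hom B (fmap \<lparr>fsrc = A, ftgt = B, fmap = restrict f (obj A)\<rparr> a')
        (fmap \<lparr>fsrc = A, ftgt = B, fmap = restrict f (obj A)\<rparr> a)"
    using functor_hom[OF G a a'] a a' by (simp add: e)
next
  fix a assume a: "a \<in> obj A"
  show "ty B (fmap \<lparr>fsrc = A, ftgt = B, fmap = restrict f (obj A)\<rparr> a) = ty A a"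
    using functor_ty[OF J o[OF a]] functor_ty[OF G a] a by (simp add: e)
qed (use functor_qcat[OF G] functor_qcat[OF J] o in auto)

end

context sub_doctrine
begin

text \<open>A diagram \<open>G\<close> with values in the class lifts to \<open>H\<close> into
  \<open>T(B)\<close>. If the weight is \<open>\<epsilon>(t)\<close>, the colimit of
  \<open>G\<close> is \<epsilon> applied to \<open>\<mu>(T(H)(t))\<close>.\<close>

lemma doctrine_class_saturated: "saturated Q (doctrine_class Q T \<epsilon>)"
  unfolding saturated_def
proof (intro conjI ballI impI)
  show "doctrine_class Q T \<epsilon> \<subseteq> presheaves Q" by (rule doctrine_class_psh)
  show "representable Q A a \<in> doctrine_class Q T \<epsilon>" if "A \<in> Ob (Dist Q)" and a: "a \<in> obj A" for A a
  proof -
    have A: "is_qcat Q A" using that by (simp add: Ob_Dist)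
    have "representable Q A a = decode Q A (fmap (\<epsilon> A) (fmap (\<eta> A) a))"
      by (simp add: eps_eta[OF A a] yoneda_map[OF A a] decode_code[OF representable_psh[OF A a]])
    then show ?thesis
      using doctrine_class_iff[OF A representable_psh[OF A a]] eta_obj[OF A a] by blast
  qed
  fix A B \<phi> G assume AB: "A \<in> Ob (Dist Q)" "B \<in> Ob (Dist Q)"
    and p: "\<phi> \<in> presheaves_on Q A \<inter> doctrine_class Q T \<epsilon>" and "G \<in> functors Q A (P0 Q B)"
    and C: "\<forall>a\<in>obj A. decode Q B (fmap G a) \<in> doctrine_class Q T \<epsilon>"
  then have A: "is_qcat Q A" and B: "is_qcat Q B" and ps: "is_psh A \<phi>" and G: "is_functor A (P0 Q B) G"
    by (auto simp: Ob_Dist is_psh_def is_functor_def P0_qcat)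
  obtain t where t: "t \<in> obj (map0 T A)" "\<phi> = decode Q A (fmap (\<epsilon> A) t)"
    using doctrine_class_iff[OF A ps] p by blast
  have "\<exists>s\<in>obj (map0 T B). fmap G a = fmap (\<epsilon> B) s" if "a \<in> obj A" for a
    using C that doctrine_class_decode[OF B functor_obj[OF G that]] by blast
  then obtain g where g: "\<And>a. a \<in> obj A \<Longrightarrow> g a \<in> obj (map0 T B)" "\<And>a. a \<in> obj A \<Longrightarrow> fmap (\<epsilon> B) (g a) = fmap G a"
    by metis
  define H where "H = \<lparr>fsrc = A, ftgt = map0 T B, fmap = restrict g (obj A)\<rparr>"
  have H: "is_functor A (map0 T B) H"
    unfolding H_def by (rule ff_factor[OF G eps_functor[OF B] eps_ff[OF B] g])
  have eH: "\<epsilon> B \<circ>\<^sub>f H = G"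
    by (rule functor_eqI[OF fcomp_functor[OF H eps_functor[OF B]] G]) (simp add: fcomp_map[OF H], simp add: H_def g)
  let ?s = "fmap (map1 T H) t"
  note s = functor_obj[OF T_functor[OF H] t(1)]
  \<comment> \<open>By naturality \<open>\<epsilon>(T(H)(t))\<close> is
    \<open>P(H)(\<epsilon>(t))\<close>; \<open>colim_P1\<close> moves \<open>H\<close> from the
    weight into the diagram and turns \<open>eps_mu\<close> into a statement about
    \<open>G\<close>.\<close>
  have "is_colim Q \<phi> G (fmap (\<epsilon> B) (fmap (\<mu> B) ?s))"
    using eps_mu[OF B s] colim_P1[OF H eps_functor[OF B] eps_obj[OF A t(1)]] t(2)
    by (simp add: eps_nat[OF H t(1)] eH)
  then have "colim Q \<phi> G = fmap (\<epsilon> B) (fmap (\<mu> B) ?s)"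
    by (rule P0_colim_eq[OF ps G B])
  then show "decode Q B (colim Q \<phi> G) \<in> doctrine_class Q T \<epsilon>"
    using doctrine_class_decode[OF B eps_obj[OF B functor_obj[OF mu_functor[OF B] s]]] functor_obj[OF mu_functor[OF B] s] by auto
qed

end

section \<open>Doctrines with the same class\<close>

context small_quantaloid
begin

lemma sub_doctrineE:
  assumes "full_sub_KZ Q T \<epsilon>"
  obtains \<mu> \<eta> where "sub_doctrine Q T \<epsilon> \<mu> \<eta>"
  using assms small_quantaloid_axioms unfolding full_sub_KZ_def
  by (metis assms sub_doctrine.intro sub_doctrine_axioms.intro)

text \<open>Inclusion of classes provides preimages under \<open>\<epsilon>' A\<close> object by
  object, and \<open>ff_factor\<close> makes them a functor.\<close>

lemma comparison_functor:
  assumes "full_sub_KZ Q T \<epsilon>" "full_sub_KZ Q T' \<epsilon>'" "doctrine_class Q T \<epsilon> \<subseteq> doctrine_class Q T' \<epsilon>'"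
    and A: "is_qcat Q A"
  shows "\<exists>F. is_functor (map0 T A) (map0 T' A) F \<and> (\<forall>t\<in>obj (map0 T A). fmap (\<epsilon>' A) (fmap F t) = fmap (\<epsilon> A) t)"
proof -
  obtain \<mu> \<eta> \<mu>' \<eta>' where "sub_doctrine Q T \<epsilon> \<mu> \<eta>" "sub_doctrine Q T' \<epsilon>' \<mu>' \<eta>'"
    using assms sub_doctrineE by metis
  then interpret S: sub_doctrine Q T \<epsilon> \<mu> \<eta> + S': sub_doctrine Q T' \<epsilon>' \<mu>' \<eta>' .
  have "\<exists>s\<in>obj (map0 T' A). fmap (\<epsilon> A) t = fmap (\<epsilon>' A) s" if "t \<in> obj (map0 T A)" for t
    using assms(3) S.doctrine_class_decode[OF A S.eps_obj[OF A that]] S'.doctrine_class_decode[OF A S.eps_obj[OF A that]] that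
    by blast
  then obtain f where f: "\<And>t. t \<in> obj (map0 T A) \<Longrightarrow> f t \<in> obj (map0 T' A)"
      "\<And>t. t \<in> obj (map0 T A) \<Longrightarrow> fmap (\<epsilon>' A) (f t) = fmap (\<epsilon> A) t"
    by metis
  show ?thesis
    using ff_factor[OF S.eps_functor[OF A] S'.eps_functor[OF A] S'.eps_ff[OF A] f] f
    by (intro exI[of _ "\<lparr>fsrc = map0 T A, ftgt = map0 T' A, fmap = restrict f (obj (map0 T A))\<rparr>"]) auto
qed

text \<open>Serves both the round trip from a doctrine to its class and back, and the claim that a
  doctrine is determined by its class up to equivalence. All isomorphisms are checked after
  \<epsilon> or \<open>\<epsilon>'\<close>, where they become equalities.\<close>

lemma equivalent_iff_class_eq:
  assumes K: "full_sub_KZ Q T \<epsilon>" "full_sub_KZ Q T' \<epsilon>'"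
  shows "equivalent_doctrines Q T \<epsilon> T' \<epsilon>' \<longleftrightarrow> doctrine_class Q T \<epsilon> = doctrine_class Q T' \<epsilon>'"
proof -
  obtain \<mu> \<eta> \<mu>' \<eta>' where "sub_doctrine Q T \<epsilon> \<mu> \<eta>" "sub_doctrine Q T' \<epsilon>' \<mu>' \<eta>'"
    using assms sub_doctrineE by metis
  then interpret S: sub_doctrine Q T \<epsilon> \<mu> \<eta> + S': sub_doctrine Q T' \<epsilon>' \<mu>' \<eta>' .
  show ?thesis
  proof
    assume "equivalent_doctrines Q T \<epsilon> T' \<epsilon>'"
    then obtain \<delta> where nat: "two_natural Q T T' \<delta>"
      and eq: "\<And>A. is_qcat Q A \<Longrightarrow> is_equivalence Q (\<delta> A)"
      and fac: "\<And>A. is_qcat Q A \<Longrightarrow> fiso Q (\<epsilon>' A \<circ>\<^sub>f \<delta> A) (\<epsilon> A)"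
      by (auto simp: equivalent_doctrines_def Ob_Dist)
    have d: "is_functor (map0 T A) (map0 T' A) (\<delta> A)" if "is_qcat Q A" for A
      by (rule two_natural_functor[OF nat S'.T_two S.T_two that])
    have ed: "fmap (\<epsilon>' A) (fmap (\<delta> A) t) = fmap (\<epsilon> A) t" if A: "is_qcat Q A" and t: "t \<in> obj (map0 T A)" for A t
      using fiso_obj[OF fac[OF A] fcomp_functor[OF d[OF A] S'.eps_functor[OF A]] S.eps_functor[OF A] t] P0_iso_eq[OF A]
      by (simp add: fcomp_map[OF d[OF A] t])
    \<comment> \<open>An equivalence is essentially surjective; after \<open>\<epsilon>' A\<close>,
      whose target is skeletal, this gives exactly the same presheaves.\<close>
    have surj: "\<exists>t\<in>obj (map0 T A). fmap (\<epsilon> A) t = fmap (\<epsilon>' A) s" if A: "is_qcat Q A" and s: "s \<in> obj (map0 T' A)" for A s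
    proof -
      obtain G where "G \<in> functors Q (map0 T' A) (map0 T A)" and i: "fiso Q (\<delta> A \<circ>\<^sub>f G) (fid (map0 T' A))"
        using eq[OF A] functor_src[OF d[OF A]] by (auto simp: is_equivalence_def)
      then have G: "is_functor (map0 T' A) (map0 T A) G"
        using S.T_qcat[OF A] S'.T_qcat[OF A] by (simp add: is_functor_def)
      have "obj_iso (map0 T' A) (fmap (\<delta> A) (fmap G s)) s"
        using fiso_obj[OF i fcomp_functor[OF G d[OF A]] fid_functor[OF S'.T_qcat[OF A]] s] s by (simp add: fcomp_map[OF G] fid_map)
      then have "fmap (\<epsilon>' A) (fmap (\<delta> A) (fmap G s)) = fmap (\<epsilon>' A) s"
        using functor_obj_iso[OF S'.eps_functor[OF A]] P0_iso_eq[OF A] by blast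
      then show ?thesis using ed[OF A functor_obj[OF G s]] functor_obj[OF G s] by auto
    qed
    show "doctrine_class Q T \<epsilon> = doctrine_class Q T' \<epsilon>'"
    proof (intro equalityI subsetI)
      fix \<phi> assume "\<phi> \<in> doctrine_class Q T \<epsilon>"
      then obtain A t where A: "is_qcat Q A" and t: "t \<in> obj (map0 T A)" "\<phi> = decode Q A (fmap (\<epsilon> A) t)"
        by (auto simp: doctrine_class_def Ob_Dist)
      then show "\<phi> \<in> doctrine_class Q T' \<epsilon>'"
        using S'.doctrine_class_decode[OF A S.eps_obj[OF A t(1)]] ed[OF A t(1)] functor_obj[OF d[OF A] t(1)] by metis
    next
      fix \<phi> assume "\<phi> \<in> doctrine_class Q T' \<epsilon>'"
      then obtain A t where A: "is_qcat Q A" and t: "t \<in> obj (map0 T' A)" "\<phi> = decode Q A (fmap (\<epsilon>' A) t)"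
        by (auto simp: doctrine_class_def Ob_Dist)
      then show "\<phi> \<in> doctrine_class Q T \<epsilon>"
        using S.doctrine_class_decode[OF A S'.eps_obj[OF A t(1)]] surj[OF A t(1)] by metis
    qed
  next
    assume eq: "doctrine_class Q T \<epsilon> = doctrine_class Q T' \<epsilon>'"
    obtain \<delta> where d: "\<And>A. is_qcat Q A \<Longrightarrow> is_functor (map0 T A) (map0 T' A) (\<delta> A)"
      and ed: "\<And>A t. is_qcat Q A \<Longrightarrow> t \<in> obj (map0 T A) \<Longrightarrow> fmap (\<epsilon>' A) (fmap (\<delta> A) t) = fmap (\<epsilon> A) t"
      using comparison_functor[OF K] eq by (metis order_refl)
    obtain \<gamma> where g: "\<And>A. is_qcat Q A \<Longrightarrow> is_functor (map0 T' A) (map0 T A) (\<gamma> A)"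
      and eg: "\<And>A t. is_qcat Q A \<Longrightarrow> t \<in> obj (map0 T' A) \<Longrightarrow> fmap (\<epsilon> A) (fmap (\<gamma> A) t) = fmap (\<epsilon>' A) t"
      using comparison_functor[OF K(2,1)] eq by (metis order_refl)
    have "two_natural Q T T' \<delta>"
    proof (rule two_naturalI[OF S'.T_two S.T_two d])
      fix A B F t assume F: "is_functor A B F" and t: "t \<in> obj (map0 T A)"
      note A = functor_qcat(1)[OF F] and B = functor_qcat(2)[OF F]
      note dt = functor_obj[OF d[OF A] t] and Ft = functor_obj[OF S.T_functor[OF F] t]
      \<comment> \<open>Naturality of \<delta> holds as an equation after the fully faithful
        \<open>\<epsilon>' B\<close>, which reflects it to an isomorphism.\<close>
      have "fmap (\<epsilon>' B) (fmap (\<delta> B) (fmap (map1 T F) t)) = fmap (\<epsilon>' B) (fmap (map1 T' F) (fmap (\<delta> A) t))"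
        by (simp add: ed[OF B Ft] S.eps_nat[OF F t] S'.eps_nat[OF F dt] ed[OF A t])
      then show "obj_iso (map0 T' B) (fmap (\<delta> B) (fmap (map1 T F) t)) (fmap (map1 T' F) (fmap (\<delta> A) t))"
        by (intro ff_obj_iso[OF S'.eps_functor[OF B] S'.eps_ff[OF B] functor_obj[OF d[OF B] Ft]
              functor_obj[OF S'.T_functor[OF F] dt]])
          (simp add: obj_iso_refl[OF P0_qcat[OF B] S'.eps_obj[OF B functor_obj[OF S'.T_functor[OF F] dt]]])
    qed
    moreover have "is_equivalence Q (\<delta> A)" if A: "is_qcat Q A" for A
    proof -
      have "fiso Q (\<gamma> A \<circ>\<^sub>f \<delta> A) (fid (map0 T A))"
        unfolding fiso_iff[OF fcomp_functor[OF d[OF A] g[OF A]] fid_functor[OF S.T_qcat[OF A]]]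
      proof
        fix t assume t: "t \<in> obj (map0 T A)"
        note dt = functor_obj[OF d[OF A] t] 
        show "obj_iso (map0 T A) (fmap (\<gamma> A \<circ>\<^sub>f \<delta> A) t) (fmap (fid (map0 T A)) t)"
          using ff_obj_iso[OF S.eps_functor[OF A] S.eps_ff[OF A] functor_obj[OF g[OF A] dt] t]
            obj_iso_refl[OF P0_qcat[OF A] S.eps_obj[OF A t]] t
          by (simp add: eg[OF A dt] ed[OF A t] fcomp_map[OF d[OF A]] fid_map)
      qed
      moreover have "fiso Q (\<delta> A \<circ>\<^sub>f \<gamma> A) (fid (map0 T' A))"
        unfolding fiso_iff[OF fcomp_functor[OF g[OF A] d[OF A]] fid_functor[OF S'.T_qcat[OF A]]]
      proof
        fix t assume t: "t \<in> obj (map0 T' A)"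
        note dt = functor_obj[OF g[OF A] t] 
        show "obj_iso (map0 T' A) (fmap (\<delta> A \<circ>\<^sub>f \<gamma> A) t) (fmap (fid (map0 T' A)) t)"
          using ff_obj_iso[OF S'.eps_functor[OF A] S'.eps_ff[OF A] functor_obj[OF d[OF A] dt] t]
            obj_iso_refl[OF P0_qcat[OF A] S'.eps_obj[OF A t]] t
          by (simp add: eg[OF A t] ed[OF A dt] fcomp_map[OF g[OF A]] fid_map)
      qed
      ultimately show ?thesis
        using d[OF A] g[OF A] functor_src[OF d[OF A]] by (auto simp: is_equivalence_def is_functor_def)
    qed
    moreover have "fiso Q (\<epsilon>' A \<circ>\<^sub>f \<delta> A) (\<epsilon> A)" if A: "is_qcat Q A" for A
      unfolding fiso_iff[OF fcomp_functor[OF d[OF A] S'.eps_functor[OF A]] S.eps_functor[OF A]]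
      using obj_iso_refl[OF P0_qcat[OF A] S.eps_obj[OF A]] by (simp add: fcomp_map[OF d[OF A]] ed[OF A])
    ultimately show "equivalent_doctrines Q T \<epsilon> T' \<epsilon>'"
      unfolding equivalent_doctrines_def by (auto simp: Ob_Dist)
  qed
qed

end

section \<open>The doctrine of a saturated class\<close>

locale saturated_class = small_quantaloid Q for Q :: "('u::zf_universe, 'u) quantaloid_data" +
  fixes C :: "'u dist set"
  assumes sat: "saturated Q C"
begin

text \<open>Saturation speaks of the colimit chosen by \<open>colim\<close>; this form accepts any
  colimit.\<close>

lemma class_colim:
  assumes p: "is_psh A \<phi>" "\<phi> \<in> C" and B: "is_qcat Q B" and G: "is_functor A (P0 Q B) G"
    and GC: "\<And>a. a \<in> obj A \<Longrightarrow> decode Q B (fmap G a) \<in> C" and c: "is_colim Q \<phi> G c"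
  shows "decode Q B c \<in> C"
proof -
  have "decode Q B (colim Q \<phi> G) \<in> C"
    using sat assms unfolding saturated_def Ob_Dist is_psh_def is_functor_def by blast
  then show ?thesis using P0_colim_eq[OF p(1) G B c] by simp
qed

lemma representable_class: "is_qcat Q A \<Longrightarrow> a \<in> obj A \<Longrightarrow> representable Q A a \<in> C"
  using sat by (auto simp: saturated_def Ob_Dist)

lemma class_obj_decode:
  assumes "is_qcat Q A" "x \<in> obj (presheaf_cat Q C A)"
  shows "x \<in> obj (P0 Q A)" "decode Q A x \<in> C"
  using assms by (auto simp: pc_obj_iff)

lemma inclusion_map: "x \<in> obj (presheaf_cat Q C A) \<Longrightarrow> fmap (class_inclusion Q C A) x = x"
  by (simp add: class_inclusion_def)

lemma inclusion_functor:
  assumes A: "is_qcat Q A"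
  shows "is_functor (presheaf_cat Q C A) (P0 Q A) (class_inclusion Q C A)"
proof (rule functorI[OF pc_qcat[OF A] P0_qcat[OF A]])
  show "hom (presheaf_cat Q C A) y x \<preceq>\<^bsub>ty (presheaf_cat Q C A) x,ty (presheaf_cat Q C A) y\<^esub>
    hom (P0 Q A) (fmap (class_inclusion Q C A) y) (fmap (class_inclusion Q C A) x)"
    if "x \<in> obj (presheaf_cat Q C A)" "y \<in> obj (presheaf_cat Q C A)" for x y
    using that arr_le_refl[OF qcat_hom[OF pc_qcat[OF A], of x C y]] pc_hom[OF A that] by (simp add: inclusion_map)
qed (use class_obj_decode[OF A] in \<open>auto simp: class_inclusion_def pc_ty P0_ty\<close>)

lemma inclusion_ff: "is_qcat Q A \<Longrightarrow> fully_faithful (class_inclusion Q C A)"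
  by (auto simp: fully_faithful_def class_inclusion_def pc_hom)

text \<open>The colimit in the presheaf category lies in the class by saturation and is reflected by
  the full inclusion. That one object is the colimit at both places gives cocompleteness of
  \<open>C(B)\<close> and cocontinuity of the inclusion.\<close>

lemma class_colim_ex:
  assumes p: "is_psh A \<phi>" "\<phi> \<in> C" and B: "is_qcat Q B" and F: "is_functor A (presheaf_cat Q C B) F"
  shows "\<exists>c. is_colim Q \<phi> F c \<and> is_colim Q \<phi> (class_inclusion Q C B \<circ>\<^sub>f F) c"
proof -
  note J = inclusion_functor[OF B]
  note JF = fcomp_functor[OF F J]
  let ?c = "colim Q \<phi> (class_inclusion Q C B \<circ>\<^sub>f F)"
  note c = P0_colim[OF p(1) JF B]
  have "decode Q B ?c \<in> C"
    using class_obj_decode[OF B functor_obj[OF F]]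
    by (intro class_colim[OF p B JF _ c]) (simp add: fcomp_map[OF F] inclusion_map functor_obj[OF F])
  then have o: "?c \<in> obj (presheaf_cat Q C B)"
    using colim_obj[OF p(1) JF c] B by (simp add: pc_obj_iff)
  then show ?thesis
    using colim_reflect[OF p(1) F J inclusion_ff[OF B] o] c by (auto simp: inclusion_map)
qed

text \<open>\<open>P(F)(x)\<close> is the colimit of the representables weighted by itself
  (\<open>colim_yoneda\<close>), hence the colimit of \<open>yoneda Q B \<circ>\<^sub>f F\<close>
  weighted by \<open>x\<close> (\<open>colim_P1\<close>); the two saturation axioms then
  apply.\<close>

lemma class_map_obj:
  assumes F: "is_functor A B F" and x: "x \<in> obj (presheaf_cat Q C A)"
  shows "fmap (P1 Q F) x \<in> obj (presheaf_cat Q C B)"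
proof -
  note A = functor_qcat(1)[OF F] and B = functor_qcat(2)[OF F]
  note xo = class_obj_decode[OF A x]
  note PF = functor_obj[OF P1_functor[OF F] xo(1)] and Y = yoneda_functor[OF B]
  have "is_colim Q (decode Q A x) (yoneda Q B \<circ>\<^sub>f F) (fmap (P1 Q F) x)"
    using colim_yoneda[OF decode_psh[OF B PF]] colim_P1[OF F Y xo(1)] by (simp add: code_decode[OF B PF])
  moreover have "decode Q B (fmap (yoneda Q B \<circ>\<^sub>f F) a) \<in> C" if "a \<in> obj A" for a
    using functor_obj[OF F that] representable_class[OF B] decode_code[OF representable_psh[OF B]] that
    by (simp add: fcomp_map[OF F] yoneda_map[OF B])
  ultimately have "decode Q B (fmap (P1 Q F) x) \<in> C"
    using class_colim[OF decode_psh[OF A xo(1)] xo(2) B fcomp_functor[OF F Y]] by blast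
  then show ?thesis using PF B by (simp add: pc_obj_iff)
qed

lemma class_functor_map0: "map0 (class_functor Q C) A = presheaf_cat Q C A"
  by (simp add: class_functor_def)

lemma class_functor_map:
  assumes F: "is_functor A B F" and x: "x \<in> obj (presheaf_cat Q C A)"
  shows "fmap (map1 (class_functor Q C) F) x = fmap (P1 Q F) x"
  using x class_obj_decode(1)[OF functor_qcat(1)[OF F] x] functor_src[OF F] P1_map[OF F]
  by (simp add: class_functor_def)

lemma class_functor_functor:
  assumes F: "is_functor A B F"
  shows "is_functor (presheaf_cat Q C A) (presheaf_cat Q C B) (map1 (class_functor Q C) F)"
proof -
  note A = functor_qcat(1)[OF F] and B = functor_qcat(2)[OF F]
  note J = inclusion_functor[OF A] and PF = P1_functor[OF F]
  let ?H = "\<lparr>fsrc = presheaf_cat Q C A, ftgt = presheaf_cat Q C B, fmap = restrict (fmap (P1 Q F)) (obj (presheaf_cat Q C A))\<rparr>"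
  have "is_functor (presheaf_cat Q C A) (presheaf_cat Q C B) ?H"
    by (rule ff_factor[OF fcomp_functor[OF J PF] inclusion_functor[OF B] inclusion_ff[OF B]])
      (auto simp: fcomp_map[OF J] inclusion_map class_map_obj[OF F])
  moreover have "map1 (class_functor Q C) F = ?H"
  proof -
    have "fmap (map1 (class_functor Q C) F) = restrict (fmap (P1 Q F)) (obj (presheaf_cat Q C A))"
      using class_functor_map[OF F] functor_src[OF F] by (auto simp: class_functor_def fun_eq_iff)
    then show ?thesis using functor_src[OF F] by (simp add: class_functor_def)
  qed
  ultimately show ?thesis by simp
qed

lemma class_two_functor: "two_functor Q (class_functor Q C)"
proof (rule two_functorI, unfold class_functor_map0)
  show "is_qcat Q (presheaf_cat Q C A)" if "is_qcat Q A" for A using that by (rule pc_qcat)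
  show "is_functor (presheaf_cat Q C A) (presheaf_cat Q C B) (map1 (class_functor Q C) F)" if "is_functor A B F" for A B F
    using that by (rule class_functor_functor)
  show "obj_le (presheaf_cat Q C B) (fmap (map1 (class_functor Q C) F) x) (fmap (map1 (class_functor Q C) G) x)"
    if F: "is_functor A B F" and G: "is_functor A B G" and "fle Q F G" and x: "x \<in> obj (presheaf_cat Q C A)" for A B F G x
    using P1_mono[OF that(1-3) class_obj_decode(1)[OF functor_qcat(1)[OF F] x]]
      pc_obj_le[OF functor_qcat(2)[OF F] class_map_obj[OF F x] class_map_obj[OF G x]]
    by (simp add: class_functor_map[OF F x] class_functor_map[OF G x])
  show "fmap (map1 (class_functor Q C) (fid A)) x = x" if A: "is_qcat Q A" and x: "x \<in> obj (presheaf_cat Q C A)" for A x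
    using P1_fid[OF A class_obj_decode(1)[OF A x]] class_functor_map[OF fid_functor[OF A] x] by simp
  show "fmap (map1 (class_functor Q C) (G \<circ>\<^sub>f F)) x = fmap (map1 (class_functor Q C) G) (fmap (map1 (class_functor Q C) F) x)"
    if F: "is_functor A B F" and G: "is_functor B D G" and x: "x \<in> obj (presheaf_cat Q C A)" for A B D F G x
    using P1_fcomp[OF F G class_obj_decode(1)[OF functor_qcat(1)[OF F] x]]
    by (simp add: class_functor_map[OF fcomp_functor[OF F G] x] class_functor_map[OF F x] class_functor_map[OF G class_map_obj[OF F x]])
qed

text \<open>The corestriction of the left-hand side of the required factorisation, so that this law
  is an equation; that the values lie in the class is shown in
  \<open>class_mult_colim\<close>.\<close>

definition class_mult :: "'u trans" where
  "class_mult A = \<lparr>fsrc = presheaf_cat Q C (presheaf_cat Q C A), ftgt = presheaf_cat Q C A,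
     fmap = restrict (\<lambda>x. fmap (presheaf_mult Q A) (fmap (P1 Q (class_inclusion Q C A)) x))
       (obj (presheaf_cat Q C (presheaf_cat Q C A)))\<rparr>"

definition class_unit :: "'u trans" where
  "class_unit A = \<lparr>fsrc = A, ftgt = presheaf_cat Q C A, fmap = restrict (fmap (yoneda Q A)) (obj A)\<rparr>"

lemma class_mult_colim:
  assumes A: "is_qcat Q A" and x: "x \<in> obj (presheaf_cat Q C (presheaf_cat Q C A))"
  shows "is_colim Q (decode Q (presheaf_cat Q C A) x) (class_inclusion Q C A) (fmap (class_mult A) x)"
    and "fmap (class_mult A) x \<in> obj (presheaf_cat Q C A)"
proof -
  note CA = pc_qcat[OF A] and J = inclusion_functor[OF A]
  note xo = class_obj_decode[OF CA x]
  show c: "is_colim Q (decode Q (presheaf_cat Q C A) x) (class_inclusion Q C A) (fmap (class_mult A) x)"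
    using mult_colim[OF J A xo(1)] x by (simp add: class_mult_def)
  have "decode Q A (fmap (class_mult A) x) \<in> C"
    using class_obj_decode[OF A] by (intro class_colim[OF decode_psh[OF CA xo(1)] xo(2) A J _ c]) (simp add: inclusion_map)
  then show "fmap (class_mult A) x \<in> obj (presheaf_cat Q C A)"
    using colim_obj[OF decode_psh[OF CA xo(1)] J c] A by (simp add: pc_obj_iff)
qed

lemma class_mult_functor:
  assumes A: "is_qcat Q A"
  shows "is_functor (presheaf_cat Q C (presheaf_cat Q C A)) (presheaf_cat Q C A) (class_mult A)"
proof -
  note CA = pc_qcat[OF A] and J = inclusion_functor[OF A]
  note JJ = inclusion_functor[OF CA] and PJ = P1_functor[OF J] and M = mult_functor[OF A]
  show ?thesis
    unfolding class_mult_def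
    by (rule ff_factor[OF fcomp_functor[OF fcomp_functor[OF JJ PJ] M] J inclusion_ff[OF A]])
      (use class_mult_colim(2)[OF A] in \<open>auto simp: class_mult_def inclusion_map fcomp_map[OF fcomp_functor[OF JJ PJ]] fcomp_map[OF JJ]\<close>)
qed

lemma class_unit_obj:
  assumes A: "is_qcat Q A" and a: "a \<in> obj A"
  shows "fmap (yoneda Q A) a \<in> obj (presheaf_cat Q C A)"
  using yoneda_obj[OF A a] representable_class[OF A a] decode_code[OF representable_psh[OF A a]] A
  by (simp add: pc_obj_iff yoneda_map[OF A a])

lemma class_unit_functor:
  assumes A: "is_qcat Q A"
  shows "is_functor A (presheaf_cat Q C A) (class_unit A)"
  unfolding class_unit_def
  by (rule ff_factor[OF yoneda_functor[OF A] inclusion_functor[OF A] inclusion_ff[OF A]])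
    (auto simp: class_unit_obj[OF A] inclusion_map)

text \<open>The substantial point is naturality of the multiplication. Both sides are colimits of
  the same functor weighted by \<open>x\<close>: one by changing the weight
  (\<open>colim_P1\<close>), the other because \<open>P(F)\<close> preserves colimits
  (\<open>P1_colim\<close>).\<close>

lemma class_factorisation: "factorisation Q (class_functor Q C) (class_inclusion Q C) class_mult class_unit"
  unfolding factorisation_def
proof (intro conjI ballI)
  show "two_natural Q (comp2 (class_functor Q C) (class_functor Q C)) (class_functor Q C) class_mult"
  proof (rule two_naturalI[OF class_two_functor comp2_two_functor[OF class_two_functor class_two_functor]])
    show "is_functor (map0 (comp2 (class_functor Q C) (class_functor Q C)) A) (map0 (class_functor Q C) A) (class_mult A)"
      if "is_qcat Q A" for A
      using class_mult_functor[OF that] by (simp add: comp2_def class_functor_map0)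
    fix A B F x assume F: "is_functor A B F" and "x \<in> obj (map0 (comp2 (class_functor Q C) (class_functor Q C)) A)"
    then have x: "x \<in> obj (presheaf_cat Q C (presheaf_cat Q C A))" by (simp add: comp2_def class_functor_map0)
    note A = functor_qcat(1)[OF F] and B = functor_qcat(2)[OF F]
    note CA = pc_qcat[OF A, of C] and CB = pc_qcat[OF B, of C]
    note JA = inclusion_functor[OF A] and JB = inclusion_functor[OF B]
    note CF = class_functor_functor[OF F] and PF = P1_functor[OF F]
    note mx = class_mult_colim[OF A x]
    note xo = class_obj_decode[OF CA x] and xp = class_map_obj[OF CF x]
    \<comment> \<open>Naturality of the inclusion as an equation of functors, which gives both
      colimits the same diagram.\<close>
    have e: "class_inclusion Q C B \<circ>\<^sub>f map1 (class_functor Q C) F = P1 Q F \<circ>\<^sub>f class_inclusion Q C A"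
      by (rule functor_eqI[OF fcomp_functor[OF CF JB] fcomp_functor[OF JA PF]])
        (simp add: fcomp_map[OF CF] fcomp_map[OF JA] inclusion_map class_functor_map[OF F] class_map_obj[OF F])
    have "is_colim Q (decode Q (presheaf_cat Q C A) x) (P1 Q F \<circ>\<^sub>f class_inclusion Q C A)
        (fmap (class_mult B) (fmap (P1 Q (map1 (class_functor Q C) F)) x))"
      using class_mult_colim(1)[OF B xp] colim_P1[OF CF JB xo(1)] by (simp add: e)
    moreover have "is_colim Q (decode Q (presheaf_cat Q C A) x) (P1 Q F \<circ>\<^sub>f class_inclusion Q C A)
        (fmap (P1 Q F) (fmap (class_mult A) x))"
      by (rule P1_colim[OF decode_psh[OF CA xo(1)] JA F mx(1)])
    ultimately have "fmap (class_mult B) (fmap (P1 Q (map1 (class_functor Q C) F)) x) = fmap (P1 Q F) (fmap (class_mult A) x)"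
      using P0_colim_eq[OF decode_psh[OF CA xo(1)] fcomp_functor[OF JA PF] B] by metis
    then show "obj_iso (map0 (class_functor Q C) B)
        (fmap (class_mult B) (fmap (map1 (comp2 (class_functor Q C) (class_functor Q C)) F) x))
        (fmap (map1 (class_functor Q C) F) (fmap (class_mult A) x))"
      using obj_iso_refl[OF CB class_map_obj[OF F mx(2)]]
      by (simp add: comp2_def class_functor_map0 class_functor_map[OF CF x] class_functor_map[OF F mx(2)])
  qed
  show "two_natural Q id2 (class_functor Q C) class_unit"
  proof (rule two_naturalI[OF class_two_functor id2_two_functor])
    show "is_functor (map0 id2 A) (map0 (class_functor Q C) A) (class_unit A)" if "is_qcat Q A" for A
      using class_unit_functor[OF that] by (simp add: id2_def class_functor_map0)
    fix A B F a assume F: "is_functor A B F" and "a \<in> obj (map0 id2 A)"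
    then have a: "a \<in> obj A" by (simp add: id2_def)
    note A = functor_qcat(1)[OF F] and B = functor_qcat(2)[OF F]
    show "obj_iso (map0 (class_functor Q C) B) (fmap (class_unit B) (fmap (map1 id2 F) a))
        (fmap (map1 (class_functor Q C) F) (fmap (class_unit A) a))"
      using obj_iso_refl[OF pc_qcat[OF B] class_unit_obj[OF B functor_obj[OF F a]]]
        functor_obj[OF F a] class_functor_map[OF F class_unit_obj[OF A a]] yoneda_natural[OF F a] a
      by (simp add: id2_def class_functor_map0 class_unit_def)
  qed
  fix A assume "A \<in> Ob (Dist Q)"
  then have A: "is_qcat Q A" by (simp add: Ob_Dist)
  note CA = pc_qcat[OF A, of C] and J = inclusion_functor[OF A]
  note JJ = inclusion_functor[OF CA] and PJ = P1_functor[OF J] and M = mult_functor[OF A]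
  have L: "is_functor (presheaf_cat Q C (presheaf_cat Q C A)) (P0 Q A)
      (presheaf_mult Q A \<circ>\<^sub>f (P1 Q (class_inclusion Q C A) \<circ>\<^sub>f class_inclusion Q C (map0 (class_functor Q C) A)))"
    using fcomp_functor[OF fcomp_functor[OF JJ PJ] M] by (simp add: class_functor_map0)
  note R = fcomp_functor[OF class_mult_functor[OF A] J]
  have "presheaf_mult Q A \<circ>\<^sub>f (P1 Q (class_inclusion Q C A) \<circ>\<^sub>f class_inclusion Q C (map0 (class_functor Q C) A)) =
      class_inclusion Q C A \<circ>\<^sub>f class_mult A"
    by (rule functor_eqI[OF L R])
      (use class_mult_colim(2)[OF A] in \<open>simp add: class_functor_map0 fcomp_map[OF fcomp_functor[OF JJ PJ]] fcomp_map[OF JJ]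
        fcomp_map[OF class_mult_functor[OF A]] inclusion_map, simp add: class_mult_def\<close>)
  then show "fiso Q (presheaf_mult Q A \<circ>\<^sub>f (P1 Q (class_inclusion Q C A) \<circ>\<^sub>f class_inclusion Q C (map0 (class_functor Q C) A)))
      (class_inclusion Q C A \<circ>\<^sub>f class_mult A)"
    using fiso_iff[OF R R] obj_iso_refl[OF P0_qcat[OF A] functor_obj[OF R]] by simp
  note U = class_unit_functor[OF A]
  note JU = fcomp_functor[OF U J]
  have "yoneda Q A = class_inclusion Q C A \<circ>\<^sub>f class_unit A"
    by (rule functor_eqI[OF yoneda_functor[OF A] JU])
      (simp add: fcomp_map[OF U], simp add: class_unit_def inclusion_map class_unit_obj[OF A])
  then show "fiso Q (yoneda Q A) (class_inclusion Q C A \<circ>\<^sub>f class_unit A)"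
    using fiso_iff[OF JU JU] obj_iso_refl[OF P0_qcat[OF A] functor_obj[OF JU]] by simp
qed

lemma class_full_sub_KZ: "full_sub_KZ Q (class_functor Q C) (class_inclusion Q C)"
  unfolding full_sub_KZ_def
proof (intro conjI ballI exI)
  show "two_functor Q (class_functor Q C)" by (rule class_two_functor)
  show "two_natural Q (class_functor Q C) (presheaf_functor Q) (class_inclusion Q C)"
  proof (rule two_naturalI[OF presheaf_two_functor class_two_functor])
    show "is_functor (map0 (class_functor Q C) A) (map0 (presheaf_functor Q) A) (class_inclusion Q C A)" if "is_qcat Q A" for A
      using inclusion_functor[OF that] by (simp add: class_functor_map0 presheaf_functor_def)
    fix A B F x assume F: "is_functor A B F" and "x \<in> obj (map0 (class_functor Q C) A)"
    then have x: "x \<in> obj (presheaf_cat Q C A)" by (simp add: class_functor_map0)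
    show "obj_iso (map0 (presheaf_functor Q) B) (fmap (class_inclusion Q C B) (fmap (map1 (class_functor Q C) F) x))
        (fmap (map1 (presheaf_functor Q) F) (fmap (class_inclusion Q C A) x))"
      using class_map_obj[OF F x] obj_iso_refl[OF P0_qcat class_obj_decode(1)[OF _ class_map_obj[OF F x]]] functor_qcat(2)[OF F]
      by (simp add: presheaf_functor_def class_functor_map[OF F x] inclusion_map[OF x] inclusion_map)
  qed
  show "fully_faithful (class_inclusion Q C A)" if "A \<in> Ob (Dist Q)" for A
    using that inclusion_ff by (simp add: Ob_Dist)
  show "factorisation Q (class_functor Q C) (class_inclusion Q C) class_mult class_unit"
    by (rule class_factorisation)
qed

lemma doctrine_class_class_functor: "doctrine_class Q (class_functor Q C) (class_inclusion Q C) = C"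
proof (intro equalityI subsetI)
  fix \<phi> assume "\<phi> \<in> doctrine_class Q (class_functor Q C) (class_inclusion Q C)"
  then show "\<phi> \<in> C"
    using class_obj_decode(2) by (auto simp: doctrine_class_def class_functor_map0 inclusion_map Ob_Dist)
next
  fix \<phi> assume p: "\<phi> \<in> C"
  then obtain A where "is_qcat Q A" "is_psh A \<phi>"
    using sat by (auto simp: saturated_def presheaves_def Ob_Dist is_psh_def)
  then show "\<phi> \<in> doctrine_class Q (class_functor Q C) (class_inclusion Q C)"
    using p code_obj[of A \<phi>] decode_code[of A \<phi>] unfolding doctrine_class_def class_functor_map0 Ob_Dist
    by (intro CollectI exI[of _ A] exI[of _ "code \<phi>"]) (simp add: pc_obj_iff inclusion_map)
qed

lemma class_cat_cocomplete: "is_qcat Q A \<Longrightarrow> cocomplete Q C (presheaf_cat Q C A)"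
  unfolding cocomplete_def Ob_Dist
  using class_colim_ex pc_qcat by (auto simp: is_psh_def is_functor_def) blast

lemma inclusion_cocontinuous:
  assumes A: "is_qcat Q A"
  shows "cocontinuous Q C (class_inclusion Q C A)"
  unfolding cocontinuous_def
proof (intro ballI allI impI)
  note J = inclusion_functor[OF A]
  fix B \<phi> F c assume "B \<in> Ob (Dist Q)" "\<phi> \<in> presheaves_on Q B \<inter> C" "F \<in> functors Q B (fsrc (class_inclusion Q C A))"
    and c: "is_colim Q \<phi> F c"
  then have p: "is_psh B \<phi>" "\<phi> \<in> C" and F: "is_functor B (presheaf_cat Q C A) F"
    using functor_src[OF J] pc_qcat[OF A] by (auto simp: Ob_Dist is_psh_def is_functor_def)
  obtain c' where c': "is_colim Q \<phi> F c'" "is_colim Q \<phi> (class_inclusion Q C A \<circ>\<^sub>f F) c'"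
    using class_colim_ex[OF p A F] by blast
  have "c = c'" using colim_unique[OF p(1) F c c'(1)] pc_iso_eq[OF A] by blast
  then show "is_colim Q \<phi> (class_inclusion Q C A \<circ>\<^sub>f F) (fmap (class_inclusion Q C A) c)"
    using c' inclusion_map[OF colim_obj[OF p(1) F c]] by simp
qed

text \<open>Here \<open>D\<close> enters only through its cocomplete categories and cocontinuous
  functors, so the lemma can be used in both directions between two classes that agree in
  these.\<close>

lemma class_superset:
  assumes D: "D \<subseteq> presheaves Q"
    and coc: "\<And>B. is_qcat Q B \<Longrightarrow> cocomplete Q C B \<Longrightarrow> cocomplete Q D B"
    and cts: "\<And>B B' G. is_functor B B' G \<Longrightarrow> cocomplete Q C B \<Longrightarrow> cocomplete Q C B' \<Longrightarrow>
      cocontinuous Q C G \<Longrightarrow> cocontinuous Q D G"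
  shows "D \<subseteq> C"
proof
  fix \<phi> assume d: "\<phi> \<in> D"
  then obtain A where A: "is_qcat Q A" and p: "is_psh A \<phi>"
    using D by (auto simp: presheaves_def Ob_Dist is_psh_def)
  note J = inclusion_functor[OF A] and U = class_unit_functor[OF A]
  \<comment> \<open>The hypothesis \<open>cts\<close> covers only functors between
    \<open>C\<close>-cocomplete categories, and the target of the inclusion is
    \<open>P0 Q A\<close>.\<close>
  have P: "cocomplete Q C (P0 Q A)"
    unfolding cocomplete_def Ob_Dist
    using P0_colim[OF _ _ A] P0_qcat[OF A] by (auto simp: is_psh_def is_functor_def)
  have "cocomplete Q D (presheaf_cat Q C A)" "cocontinuous Q D (class_inclusion Q C A)"
    using coc[OF pc_qcat[OF A] class_cat_cocomplete[OF A]]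
      cts[OF J class_cat_cocomplete[OF A] P inclusion_cocontinuous[OF A]] by auto
  moreover obtain c where c: "is_colim Q \<phi> (class_unit A) c"
    using calculation(1) p U d A unfolding cocomplete_def Ob_Dist is_psh_def is_functor_def by blast
  moreover have "class_unit A \<in> functors Q A (fsrc (class_inclusion Q C A))"
    using U functor_src[OF J] by (simp add: is_functor_def)
  ultimately have "is_colim Q \<phi> (class_inclusion Q C A \<circ>\<^sub>f class_unit A) (fmap (class_inclusion Q C A) c)"
    using p d A unfolding cocontinuous_def Ob_Dist is_psh_def by blast
  \<comment> \<open>The preserved colimit is therefore one of the Yoneda embedding, which by
    \<open>colim_yoneda\<close> and skeletality is \<phi> itself.\<close>
  moreover have "class_inclusion Q C A \<circ>\<^sub>f class_unit A = yoneda Q A"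
    by (rule functor_eqI[OF fcomp_functor[OF U J] yoneda_functor[OF A]])
      (simp add: fcomp_map[OF U], simp add: class_unit_def inclusion_map class_unit_obj[OF A])
  moreover note co = colim_obj[OF p U c]
  ultimately have "is_colim Q \<phi> (yoneda Q A) c" by (simp add: inclusion_map)
  then have "code \<phi> = c"
    using P0_colim_eq[OF p yoneda_functor[OF A] A] colim_yoneda[OF p] by metis
  then show "\<phi> \<in> C"
    using class_obj_decode(2)[OF A co] decode_code[OF p] by simp
qed

end

section \<open>The extension to distributors\<close>

context small_quantaloid
begin

lemma ident_dist: "is_qcat Q A \<Longrightarrow> is_dist A A (Ident (Dist Q) A)"
  by (rule distI[where M = "hom A"])
    (auto simp: Dist_def qcat_hom qcat_comp is_qcat_def PiE_iff fun_eq_iff extensional_def)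

lemma ident_dmat: "dmat (Ident (Dist Q) A) a' a = hom A a' a"
  by (simp add: Dist_def)

text \<open>The supremum of \<open>HOL-Algebra\<close> is a choice among least upper bounds, so one
  must be exhibited. The entrywise join is a distributor because composition preserves
  joins.\<close>

lemma dist_Sup_least:
  assumes A: "is_qcat Q A" and B: "is_qcat Q B" and S: "\<And>\<Phi>. \<Phi> \<in> S \<Longrightarrow> is_dist A B \<Phi>"
  shows "least (Hom (Dist Q) A B) (\<Squnion>\<^bsub>Hom (Dist Q) A B\<^esub> S) (Upper (Hom (Dist Q) A B) S)"
proof -
  define M where "M b a = join_of (ty A a) (ty B b) (\<lambda>\<Phi>. dmat \<Phi> b a) S" for b a
  define \<Lambda> where "\<Lambda> = \<lparr>dsrc = A, dtgt = B, dmat = (\<lambda>b\<in>obj B. \<lambda>a\<in>obj A. M b a)\<rparr>"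
  have ar: "arr (ty A a) (ty B b) (dmat \<Phi> b a)" if "\<Phi> \<in> S" "a \<in> obj A" "b \<in> obj B" for \<Phi> a b
    using dist_arr[OF S] that by blast
  have Ma: "arr (ty A a) (ty B b) (M b a)" if "a \<in> obj A" "b \<in> obj B" for a b
    unfolding M_def using that qcat_ty[OF A] qcat_ty[OF B] ar by (intro join_arr) auto
  have Mu: "dmat \<Phi> b a \<preceq>\<^bsub>ty A a, ty B b\<^esub> M b a" if "\<Phi> \<in> S" "a \<in> obj A" "b \<in> obj B" for \<Phi> a b
    unfolding M_def using that ar by (intro join_upper[of S _ _ "\<lambda>\<Phi>. dmat \<Phi> b a"]) auto
  have L: "is_dist A B \<Lambda>"
  proof (rule distI[OF A B, where M = M])
    fix a a' b assume i: "a \<in> obj A" "a' \<in> obj A" "b \<in> obj B"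
    have "dmat \<Phi> b a' \<cdot> hom A a' a \<preceq>\<^bsub>ty A a, ty B b\<^esub> M b a" if "\<Phi> \<in> S" for \<Phi>
      using arr_le_trans[OF dist_right[OF S[OF that] i] Mu[OF that i(1,3)]] .
    then show "M b a' \<cdot> hom A a' a \<preceq>\<^bsub>ty A a,ty B b\<^esub> M b a"
      unfolding M_def[of b a']
      by (intro iffD2[OF join_comp_le_iff[OF ar[OF _ i(2,3)] qcat_hom[OF A i(1,2)] Ma[OF i(1,3)]]]) auto
  next
    fix a b b' assume i: "a \<in> obj A" "b \<in> obj B" "b' \<in> obj B"
    have "hom B b b' \<cdot> dmat \<Phi> b' a \<preceq>\<^bsub>ty A a, ty B b\<^esub> M b a" if "\<Phi> \<in> S" for \<Phi>
      using arr_le_trans[OF dist_left[OF S[OF that] i] Mu[OF that i(1,2)]] .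
    then show "hom B b b' \<cdot> M b' a \<preceq>\<^bsub>ty A a,ty B b\<^esub> M b a"
      unfolding M_def[of b' a]
      by (intro iffD2[OF comp_join_le_iff[OF ar[OF _ i(1,3)] qcat_hom[OF B i(3,2)] Ma[OF i(1,2)]]]) auto
  qed (simp_all add: \<Lambda>_def Ma)
  have up: "u \<in> Upper (Hom (Dist Q) A B) S \<longleftrightarrow> is_dist A B u \<and> (\<forall>\<Phi>\<in>S. \<Phi> \<sqsubseteq>\<^bsub>Hom (Dist Q) A B\<^esub> u)" for u
    using S A B by (auto simp: Upper_def Dist_def is_dist_def)
  have "least (Hom (Dist Q) A B) \<Lambda> (Upper (Hom (Dist Q) A B) S)"
    unfolding least_def
  proof (intro conjI ballI)
    show "Upper (Hom (Dist Q) A B) S \<subseteq> carrier (Hom (Dist Q) A B)" by (auto simp: Upper_def)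
    show "\<Lambda> \<in> Upper (Hom (Dist Q) A B) S"
      unfolding up using L Mu by (auto simp: dist_le_iff[OF S L]) (simp add: \<Lambda>_def)
    fix u assume "u \<in> Upper (Hom (Dist Q) A B) S"
    then have u: "is_dist A B u" and le: "\<And>\<Phi>. \<Phi> \<in> S \<Longrightarrow> \<Phi> \<sqsubseteq>\<^bsub>Hom (Dist Q) A B\<^esub> u" by (auto simp: up)
    have "M b a \<preceq>\<^bsub>ty A a, ty B b\<^esub> dmat u b a" if "a \<in> obj A" "b \<in> obj B" for a b
      unfolding M_def using le that dist_le_iff[OF S u] by (intro join_least dist_arr[OF u]) auto
    then show "\<Lambda> \<sqsubseteq>\<^bsub>Hom (Dist Q) A B\<^esub> u" unfolding dist_le_iff[OF L u] by (simp add: \<Lambda>_def)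
  qed
  then show ?thesis unfolding sup_def by (rule someI)
qed

end

context sub_doctrine
begin

lemma extension_dmat:
  assumes F: "is_dist A B \<Phi>" and i: "s \<in> obj (map0 T A)" "t \<in> obj (map0 T B)"
  shows "dmat (doctrine_extension Q T \<epsilon> \<Phi>) t s = hom (P0 Q B) (fmap (\<epsilon> B) t) (act A \<Phi> (fmap (\<epsilon> A) s))"
  using i by (simp add: doctrine_extension_def dist_src[OF F])

text \<open>Both actions are composition in \<open>P(B)\<close>: the left one directly, the right
  one after \<open>act_hom\<close> has carried \<open>hom (map0 T A)\<close> into
  \<open>P(B)\<close>.\<close>

lemma extension_dist:
  assumes F: "is_dist A B \<Phi>"
  shows "is_dist (map0 T A) (map0 T B) (doctrine_extension Q T \<epsilon> \<Phi>)"
proof (rule distI)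
  note A = dist_qcat(1)[OF F] and B = dist_qcat(2)[OF F]
  note eA = eps_obj[OF A] and eB = eps_obj[OF B]
  let ?x = "\<lambda>s. act A \<Phi> (fmap (\<epsilon> A) s)"
  have xo: "?x s \<in> obj (P0 Q B)" "ty (P0 Q B) (?x s) = ty (map0 T A) s" if "s \<in> obj (map0 T A)" for s
    using act_obj[OF F eA[OF that]] act_ptp[OF F eA[OF that]] eps_ptp[OF A that] by (auto simp: P0_ty)
  have te: "ty (P0 Q B) (fmap (\<epsilon> B) t) = ty (map0 T B) t" if "t \<in> obj (map0 T B)" for t
    using functor_ty[OF eps_functor[OF B] that] .
  show "is_qcat Q (map0 T A)" "is_qcat Q (map0 T B)" using T_qcat A B by auto
  show "dsrc (doctrine_extension Q T \<epsilon> \<Phi>) = map0 T A" "dtgt (doctrine_extension Q T \<epsilon> \<Phi>) = map0 T B"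
    "dmat (doctrine_extension Q T \<epsilon> \<Phi>) = (\<lambda>t\<in>obj (map0 T B). \<lambda>s\<in>obj (map0 T A). hom (P0 Q B) (fmap (\<epsilon> B) t) (?x s))"
    by (auto simp: doctrine_extension_def dist_src[OF F])
  show h: "arr (ty (map0 T A) s) (ty (map0 T B) t) (hom (P0 Q B) (fmap (\<epsilon> B) t) (?x s))"
    if "s \<in> obj (map0 T A)" "t \<in> obj (map0 T B)" for s t
    using qcat_hom[OF P0_qcat[OF B] xo(1)[OF that(1)] eB[OF that(2)]] xo(2)[OF that(1)] te[OF that(2)] by simp
  show "hom (P0 Q B) (fmap (\<epsilon> B) t) (?x s') \<cdot> hom (map0 T A) s' s \<preceq>\<^bsub>ty (map0 T A) s,ty (map0 T B) t\<^esub>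
      hom (P0 Q B) (fmap (\<epsilon> B) t) (?x s)"
    if i: "s \<in> obj (map0 T A)" "s' \<in> obj (map0 T A)" "t \<in> obj (map0 T B)" for s s' t
  proof -
    have "hom (map0 T A) s' s \<preceq>\<^bsub>ty (map0 T A) s, ty (map0 T A) s'\<^esub> hom (P0 Q B) (?x s') (?x s)"
      using act_hom[OF F eA[OF i(1)] eA[OF i(2)]] eps_hom[OF A i(1,2)] eps_ptp[OF A] i by simp
    from comp_mono_right[OF this h[OF i(2,3)]]
    show ?thesis
      using qcat_comp[OF P0_qcat[OF B] xo(1)[OF i(1)] xo(1)[OF i(2)] eB[OF i(3)]] xo(2)[OF i(1)] te[OF i(3)]
      by (auto intro: arr_le_trans)
  qed
  show "hom (map0 T B) t t' \<cdot> hom (P0 Q B) (fmap (\<epsilon> B) t') (?x s) \<preceq>\<^bsub>ty (map0 T A) s,ty (map0 T B) t\<^esub>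
      hom (P0 Q B) (fmap (\<epsilon> B) t) (?x s)"
    if i: "s \<in> obj (map0 T A)" "t \<in> obj (map0 T B)" "t' \<in> obj (map0 T B)" for s t t'
    using qcat_comp[OF P0_qcat[OF B] xo(1)[OF i(1)] eB[OF i(3)] eB[OF i(2)]] xo(2)[OF i(1)] te[OF i(2)]
      eps_hom[OF B i(3,2)] by simp
qed

lemma extension_mono:
  assumes F: "is_dist A B \<Phi>" and G: "is_dist A B \<Psi>" and le: "\<Phi> \<sqsubseteq>\<^bsub>Hom (Dist Q) A B\<^esub> \<Psi>"
  shows "doctrine_extension Q T \<epsilon> \<Phi> \<sqsubseteq>\<^bsub>Hom (Dist Q) (map0 T A) (map0 T B)\<^esub> doctrine_extension Q T \<epsilon> \<Psi>"
  unfolding dist_le_iff[OF extension_dist[OF F] extension_dist[OF G]]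
proof (intro ballI)
  note A = dist_qcat(1)[OF F] and B = dist_qcat(2)[OF F]
  fix t s assume t: "t \<in> obj (map0 T B)" and s: "s \<in> obj (map0 T A)"
  note es = eps_obj[OF A s] and et = eps_obj[OF B t]
  have "obj_le (P0 Q B) (act A \<Phi> (fmap (\<epsilon> A) s)) (act A \<Psi> (fmap (\<epsilon> A) s))"
    using le[unfolded dist_le_iff[OF F G]] by (intro act_dist_mono[OF F G es]) blast
  from obj_le_hom_right[OF this et]
  show "dmat (doctrine_extension Q T \<epsilon> \<Phi>) t s \<preceq>\<^bsub>ty (map0 T A) s,ty (map0 T B) t\<^esub> dmat (doctrine_extension Q T \<epsilon> \<Psi>) t s"
    using P0_ty[OF act_obj[OF F es]] act_ptp[OF F es] functor_ty[OF eps_functor[OF B] t]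
    by (simp add: extension_dmat[OF F s t] extension_dmat[OF G s t] eps_ptp[OF A s])
qed

text \<open>Tensoring with \<Psi> enlarges the second factor
  \<open>P(B)(\<epsilon>(t), \<Phi> \<otimes> \<epsilon>(s))\<close> to a hom of \<open>P(C)\<close>
  by \<open>act_hom\<close>; then compose in \<open>P(C)\<close>.\<close>

lemma extension_dcomp:
  assumes F: "is_dist A B \<Phi>" and G: "is_dist B C \<Psi>"
  shows "dcomp Q (doctrine_extension Q T \<epsilon> \<Psi>) (doctrine_extension Q T \<epsilon> \<Phi>)
    \<sqsubseteq>\<^bsub>Hom (Dist Q) (map0 T A) (map0 T C)\<^esub> doctrine_extension Q T \<epsilon> (dcomp Q \<Psi> \<Phi>)"
  unfolding dcomp_le_iff[OF extension_dist[OF F] extension_dist[OF G] extension_dist[OF dcomp_dist[OF F G]]]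
proof (intro ballI)
  note A = dist_qcat(1)[OF F] and B = dist_qcat(2)[OF F] and C = dist_qcat(2)[OF G]
  fix u s t assume u: "u \<in> obj (map0 T C)" and s: "s \<in> obj (map0 T A)" and t: "t \<in> obj (map0 T B)"
  note es = eps_obj[OF A s] and et = eps_obj[OF B t] and eu = eps_obj[OF C u]
  let ?x = "act A \<Phi> (fmap (\<epsilon> A) s)" and ?y = "act B \<Psi> (fmap (\<epsilon> B) t)"
  note x = act_obj[OF F es] and px = act_ptp[OF F es]
  note y = act_obj[OF G et] and py = act_ptp[OF G et]
  note z = act_obj[OF G x] and pz = act_ptp[OF G x]
  have "hom (P0 Q C) (fmap (\<epsilon> C) u) ?y \<cdot> hom (P0 Q B) (fmap (\<epsilon> B) t) ?x
     \<preceq>\<^bsub>ty (map0 T A) s,ty (map0 T C) u\<^esub> hom (P0 Q C) (fmap (\<epsilon> C) u) ?y \<cdot> hom (P0 Q C) ?y (act B \<Psi> ?x)"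
    using act_hom[OF G x et] P0_hom_arr[OF C y eu] px py
    by (intro comp_mono_right[where Y = "ty (map0 T B) t"]) (simp_all add: eps_ptp[OF A s] eps_ptp[OF B t] eps_ptp[OF C u])
  also have "\<dots> \<preceq>\<^bsub>ty (map0 T A) s,ty (map0 T C) u\<^esub> hom (P0 Q C) (fmap (\<epsilon> C) u) (act B \<Psi> ?x)"
    using qcat_comp[OF P0_qcat[OF C] z y eu] pz px
    by (simp add: P0_ty[OF z] P0_ty[OF eu] eps_ptp[OF A s] eps_ptp[OF C u])
  finally show "dmat (doctrine_extension Q T \<epsilon> \<Psi>) u t \<cdot> dmat (doctrine_extension Q T \<epsilon> \<Phi>) t s
      \<preceq>\<^bsub>ty (map0 T A) s,ty (map0 T C) u\<^esub> dmat (doctrine_extension Q T \<epsilon> (dcomp Q \<Psi> \<Phi>)) u s"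
    using s t u by (simp add: extension_dmat[OF F] extension_dmat[OF G] extension_dmat[OF dcomp_dist[OF F G]] act_dcomp[OF F G es])
qed

text \<open>Naturality of \<epsilon> is an equation in the skeletal \<open>P(B)\<close>, and
  \<epsilon> preserves homs, so strict equality holds even though \<open>T\<close> is functorial
  only up to isomorphism.\<close>

lemma extension_graph:
  assumes F: "is_functor A B F"
  shows "doctrine_extension Q T \<epsilon> (graph F) = graph (map1 T F)"
proof (rule dist_eqI[OF extension_dist[OF graph_dist[OF F]] graph_dist[OF T_functor[OF F]]])
  note A = functor_qcat(1)[OF F] and B = functor_qcat(2)[OF F]
  fix s t assume s: "s \<in> obj (map0 T A)" and t: "t \<in> obj (map0 T B)"
  have "act A (graph F) (fmap (\<epsilon> A) s) = fmap (\<epsilon> B) (fmap (map1 T F) s)"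
    by (simp add: eps_nat[OF F s] P1_map[OF F eps_obj[OF A s]])
  then show "dmat (doctrine_extension Q T \<epsilon> (graph F)) t s = dmat (graph (map1 T F)) t s"
    by (simp add: extension_dmat[OF graph_dist[OF F] s t] graph_dmat[OF T_functor[OF F] s t]
        eps_hom[OF B functor_obj[OF T_functor[OF F] s] t])
qed

text \<open>The identity acts trivially on presheaves and \<epsilon> preserves homs. Passing through
  \<open>extension_graph\<close> would leave \<open>T\<close> of an identity functor, which is an
  identity only up to isomorphism.\<close>

lemma extension_ident:
  assumes A: "is_qcat Q A"
  shows "doctrine_extension Q T \<epsilon> (Ident (Dist Q) A) = Ident (Dist Q) (map0 T A)"
proof (rule dist_eqI[OF extension_dist[OF ident_dist[OF A]] ident_dist[OF T_qcat[OF A]]])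
  fix s t assume s: "s \<in> obj (map0 T A)" and t: "t \<in> obj (map0 T A)"
  show "dmat (doctrine_extension Q T \<epsilon> (Ident (Dist Q) A)) t s = dmat (Ident (Dist Q) (map0 T A)) t s"
    by (simp add: extension_dmat[OF ident_dist[OF A] s t] ident_dmat eps_hom[OF A s t]
        act_ident[OF A eps_obj[OF A s] ident_dist[OF A]])
qed

lemma extension_normal: "normal_functor (Dist Q) (Dist Q) (map0 T) (doctrine_extension Q T \<epsilon>)"
  using extension_ident by (simp add: normal_functor_def Ob_Dist)

lemma hom_Dist_iff: "is_qcat Q A \<Longrightarrow> is_qcat Q B \<Longrightarrow> \<Phi> \<in> carrier (Hom (Dist Q) A B) \<longleftrightarrow> is_dist A B \<Phi>"
  by (simp add: Dist_def is_dist_def)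

lemma extension_lax_Sup: "lax_Sup_functor (Dist Q) (Dist Q) (map0 T) (doctrine_extension Q T \<epsilon>)"
proof -
  let ?E = "doctrine_extension Q T \<epsilon>"
  have "?E \<Phi> \<in> carrier (Hom (Dist Q) (map0 T A) (map0 T B))"
    if "is_qcat Q A" "is_qcat Q B" "\<Phi> \<in> carrier (Hom (Dist Q) A B)" for A B \<Phi>
    using that extension_dist T_qcat by (simp add: hom_Dist_iff)
  moreover have "?E \<Phi> \<sqsubseteq>\<^bsub>Hom (Dist Q) (map0 T A) (map0 T B)\<^esub> ?E \<Psi>"
    if "is_qcat Q A" "is_qcat Q B" "\<Phi> \<in> carrier (Hom (Dist Q) A B)" "\<Psi> \<in> carrier (Hom (Dist Q) A B)" "\<Phi> \<sqsubseteq>\<^bsub>Hom (Dist Q) A B\<^esub> \<Psi>" for A B \<Phi> \<Psi>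
    using that extension_mono by (simp add: hom_Dist_iff)
  moreover have "Comp (Dist Q) (?E \<Psi>) (?E \<Phi>) \<sqsubseteq>\<^bsub>Hom (Dist Q) (map0 T A) (map0 T C)\<^esub> ?E (Comp (Dist Q) \<Psi> \<Phi>)"
    if "is_qcat Q A" "is_qcat Q B" "is_qcat Q C" "\<Phi> \<in> carrier (Hom (Dist Q) A B)" "\<Psi> \<in> carrier (Hom (Dist Q) B C)" for A B C \<Phi> \<Psi>
    using that extension_dcomp[of A B \<Phi> C \<Psi>] by (simp add: hom_Dist_iff) (simp add: Dist_def)
  moreover have "Ident (Dist Q) (map0 T A) \<sqsubseteq>\<^bsub>Hom (Dist Q) (map0 T A) (map0 T A)\<^esub> ?E (Ident (Dist Q) A)" if "is_qcat Q A" for A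
    using that extension_ident dist_le_iff[OF ident_dist ident_dist, of "map0 T A"] qcat_hom[OF T_qcat[OF that]] T_qcat[OF that]
    by (simp add: ident_dmat arr_le_refl)
  \<comment> \<open>By monotonicity the image of the supremum is an upper bound of the images, hence
    above their least upper bound.\<close>
  moreover have "\<Squnion>\<^bsub>Hom (Dist Q) (map0 T A) (map0 T B)\<^esub> (?E ` S) \<sqsubseteq>\<^bsub>Hom (Dist Q) (map0 T A) (map0 T B)\<^esub> ?E (\<Squnion>\<^bsub>Hom (Dist Q) A B\<^esub> S)"
    if A: "is_qcat Q A" and B: "is_qcat Q B" and "S \<subseteq> carrier (Hom (Dist Q) A B)" for A B S
  proof -
    have S: "is_dist A B \<Phi>" if "\<Phi> \<in> S" for \<Phi> using that \<open>S \<subseteq> _\<close> hom_Dist_iff[OF A B] by blast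
    let ?u = "\<Squnion>\<^bsub>Hom (Dist Q) A B\<^esub> S"
    have "?u \<in> Upper (Hom (Dist Q) A B) S" using dist_Sup_least[OF A B S] by (simp add: least_def)
    then have u: "is_dist A B ?u" and le: "\<And>\<Phi>. \<Phi> \<in> S \<Longrightarrow> \<Phi> \<sqsubseteq>\<^bsub>Hom (Dist Q) A B\<^esub> ?u"
      using hom_Dist_iff[OF A B] S by (auto simp: Upper_def)
    have "?E ?u \<in> Upper (Hom (Dist Q) (map0 T A) (map0 T B)) (?E ` S)"
      using extension_mono[OF S u le] extension_dist[OF u] hom_Dist_iff[OF T_qcat[OF A] T_qcat[OF B]] by (auto simp: Upper_def)
    moreover have "least (Hom (Dist Q) (map0 T A) (map0 T B)) (\<Squnion>\<^bsub>Hom (Dist Q) (map0 T A) (map0 T B)\<^esub> (?E ` S))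
        (Upper (Hom (Dist Q) (map0 T A) (map0 T B)) (?E ` S))"
      using extension_dist[OF S] by (intro dist_Sup_least T_qcat A B) auto
    ultimately show ?thesis by (simp add: least_def)
  qed
  ultimately show ?thesis
    unfolding lax_Sup_functor_def lax_functor_def using T_qcat by (simp add: Ob_Dist)
qed

text \<open>From left to right this collects the two characterisations of algebras and
  homomorphisms. Conversely, the same characterisations for the class of the doctrine show that both
  classes have the same cocomplete categories and the same cocontinuous functors between
  them.\<close>

lemma class_eq_iff_algebras:
  assumes "saturated Q C"
  shows "C = doctrine_class Q T \<epsilon> \<longleftrightarrow>
    (\<forall>B\<in>Ob (Dist Q). (\<exists>L. is_algebra Q T \<mu> \<eta> B L) \<longleftrightarrow> cocomplete Q C B) \<and>
    (\<forall>B L B' L'. \<forall>G\<in>functors Q B B'.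
       is_algebra Q T \<mu> \<eta> B L \<longrightarrow> is_algebra Q T \<mu> \<eta> B' L' \<longrightarrow>
       (is_algebra_hom Q T L L' G \<longleftrightarrow> cocontinuous Q C G))" (is "_ \<longleftrightarrow> ?obj \<and> ?hom")
proof
  assume "C = doctrine_class Q T \<epsilon>"
  then show "?obj \<and> ?hom"
    using algebra_iff_cocomplete algebra_hom_iff_cocontinuous by (simp add: Ob_Dist)
next
  assume a: "?obj \<and> ?hom"
  let ?D = "doctrine_class Q T \<epsilon>"
  have coc: "cocomplete Q C B \<longleftrightarrow> cocomplete Q ?D B" if "is_qcat Q B" for B
    using a algebra_iff_cocomplete[OF that] that by (simp add: Ob_Dist)
  \<comment> \<open>The assumption compares homomorphisms between algebras only; the cocompleteness
    of source and target supplies \<open>L\<close> and \<open>L'\<close>.\<close>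
  have cts: "cocontinuous Q C G \<longleftrightarrow> cocontinuous Q ?D G"
    if G: "is_functor B B' G" and BB: "cocomplete Q ?D B" "cocomplete Q ?D B'" for B B' G
  proof -
    obtain L L' where L: "is_algebra Q T \<mu> \<eta> B L" "is_algebra Q T \<mu> \<eta> B' L'"
      using BB algebra_iff_cocomplete functor_qcat[OF G] by blast
    moreover have "G \<in> functors Q B B'" using G by (simp add: is_functor_def)
    ultimately show ?thesis using a algebra_hom_iff_cocontinuous[OF L] by blast
  qed
  \<comment> \<open>Both classes are saturated, so \<open>class_superset\<close> applies in either
    direction.\<close>
  interpret C: saturated_class Q C
    using assms by unfold_locales
  interpret D: saturated_class Q ?D
    using doctrine_class_saturated by unfold_locales
  have "C \<subseteq> presheaves Q" using assms by (simp add: saturated_def)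
  then have "C \<subseteq> ?D"
    by (rule D.class_superset) (use coc cts in auto)
  moreover have "?D \<subseteq> C"
    by (rule C.class_superset[OF doctrine_class_psh]) (use coc cts functor_qcat in auto)
  ultimately show "C = ?D" by simp
qed

end

theorem theorem4p6:
  fixes Q :: "('u::zf_universe, 'u) quantaloid_data"
  assumes "small_quantaloid Q"
  shows
    "(\<forall>C. saturated Q C \<longrightarrow> full_sub_KZ Q (class_functor Q C) (class_inclusion Q C))
   \<and> (\<forall>T \<epsilon>. full_sub_KZ Q T \<epsilon> \<longrightarrow> saturated Q (doctrine_class Q T \<epsilon>))
   \<and> (\<forall>C. saturated Q C \<longrightarrow> doctrine_class Q (class_functor Q C) (class_inclusion Q C) = C)
   \<and> (\<forall>T \<epsilon>. full_sub_KZ Q T \<epsilon> \<longrightarrow>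
        equivalent_doctrines Q T \<epsilon>
          (class_functor Q (doctrine_class Q T \<epsilon>)) (class_inclusion Q (doctrine_class Q T \<epsilon>)))
   \<and> (\<forall>T \<epsilon> T' \<epsilon>'. full_sub_KZ Q T \<epsilon> \<longrightarrow> full_sub_KZ Q T' \<epsilon>' \<longrightarrow>
        (equivalent_doctrines Q T \<epsilon> T' \<epsilon>' \<longleftrightarrow> doctrine_class Q T \<epsilon> = doctrine_class Q T' \<epsilon>'))
   \<and> (\<forall>C T \<epsilon> \<mu> \<eta>. saturated Q C \<longrightarrow> full_sub_KZ Q T \<epsilon> \<longrightarrow> factorisation Q T \<epsilon> \<mu> \<eta> \<longrightarrow>
        (C = doctrine_class Q T \<epsilon> \<longleftrightarrow>
          (\<forall>B\<in>Ob (Dist Q). (\<exists>L. is_algebra Q T \<mu> \<eta> B L) \<longleftrightarrow> cocomplete Q C B) \<and>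
          (\<forall>B L B' L'. \<forall>G\<in>functors Q B B'.
             is_algebra Q T \<mu> \<eta> B L \<longrightarrow> is_algebra Q T \<mu> \<eta> B' L' \<longrightarrow>
             (is_algebra_hom Q T L L' G \<longleftrightarrow> cocontinuous Q C G))))
   \<and> (\<forall>C T \<epsilon>. saturated Q C \<longrightarrow> full_sub_KZ Q T \<epsilon> \<longrightarrow> C = doctrine_class Q T \<epsilon> \<longrightarrow>
        normal_functor (Dist Q) (Dist Q) (map0 T) (doctrine_extension Q T \<epsilon>) \<and>
        lax_Sup_functor (Dist Q) (Dist Q) (map0 T) (doctrine_extension Q T \<epsilon>) \<and>
        (\<forall>A\<in>Ob (Dist Q). \<forall>B\<in>Ob (Dist Q). \<forall>F\<in>functors Q A B.
           doctrine_extension Q T \<epsilon> (graph F) = graph (map1 T F)))"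
proof -
  interpret small_quantaloid Q by fact
  have sat: "saturated_class Q C" if "saturated Q C" for C
    using that by unfold_locales
  have sub: "full_sub_KZ Q (class_functor Q C) (class_inclusion Q C)"
    and cls: "doctrine_class Q (class_functor Q C) (class_inclusion Q C) = C" if "saturated Q C" for C
    using saturated_class.class_full_sub_KZ[OF sat[OF that]]
      saturated_class.doctrine_class_class_functor[OF sat[OF that]] by auto
  have satT: "saturated Q (doctrine_class Q T \<epsilon>)" if "full_sub_KZ Q T \<epsilon>" for T \<epsilon>
    using sub_doctrineE[OF that] sub_doctrine.doctrine_class_saturated by metis
  have alg: "C = doctrine_class Q T \<epsilon> \<longleftrightarrow>
      (\<forall>B\<in>Ob (Dist Q). (\<exists>L. is_algebra Q T \<mu> \<eta> B L) \<longleftrightarrow> cocomplete Q C B) \<and>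
      (\<forall>B L B' L'. \<forall>G\<in>functors Q B B'.
         is_algebra Q T \<mu> \<eta> B L \<longrightarrow> is_algebra Q T \<mu> \<eta> B' L' \<longrightarrow>
         (is_algebra_hom Q T L L' G \<longleftrightarrow> cocontinuous Q C G))"
    if "saturated Q C" "full_sub_KZ Q T \<epsilon>" "factorisation Q T \<epsilon> \<mu> \<eta>" for C T \<epsilon> \<mu> \<eta>
  proof -
    interpret sub_doctrine Q T \<epsilon> \<mu> \<eta> using that by unfold_locales
    show ?thesis by (rule class_eq_iff_algebras[OF that(1)])
  qed
  have ext: "normal_functor (Dist Q) (Dist Q) (map0 T) (doctrine_extension Q T \<epsilon>) \<and>
      lax_Sup_functor (Dist Q) (Dist Q) (map0 T) (doctrine_extension Q T \<epsilon>) \<and>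
      (\<forall>A\<in>Ob (Dist Q). \<forall>B\<in>Ob (Dist Q). \<forall>F\<in>functors Q A B.
         doctrine_extension Q T \<epsilon> (graph F) = graph (map1 T F))"
    if K: "full_sub_KZ Q T \<epsilon>" for T \<epsilon>
  proof -
    obtain \<mu> \<eta> where "sub_doctrine Q T \<epsilon> \<mu> \<eta>" using sub_doctrineE[OF K] .
    then interpret sub_doctrine Q T \<epsilon> \<mu> \<eta> .
    show ?thesis
      using extension_normal extension_lax_Sup extension_graph by (auto simp: Ob_Dist is_functor_def)
  qed
  \<comment> \<open>The criterion by classes is applied to a doctrine and the doctrine built from
    its class; by \<open>cls\<close> the two classes coincide.\<close>
  have eqv: "equivalent_doctrines Q T \<epsilon>
      (class_functor Q (doctrine_class Q T \<epsilon>)) (class_inclusion Q (doctrine_class Q T \<epsilon>))"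
    if K: "full_sub_KZ Q T \<epsilon>" for T \<epsilon>
    using equivalent_iff_class_eq[OF K sub[OF satT[OF K]]] cls[OF satT[OF K]] by simp
  show ?thesis
    by (intro conjI allI impI; (rule sub satT cls eqv equivalent_iff_class_eq alg; assumption | use ext in blast))
qed

end
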